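(* Let $s,\alpha\in\mathbb{N}$ with $\alpha\ge 2$. Let $\beta,g\in\mathbb{N}$ with $\beta\ge 2\alpha$, $g\ge 2\alpha s$ and $g\ge\lfloor s(\beta-1)/2\rfloor$, and let $b\ge\beta g s$ be a prime. Then there is a constant $C_{\alpha,\beta,b,s}>0$, depending only on $\alpha,\beta,b,s$ (in particular independent of $w$), such that for every $w\in\mathbb{N}$ the explicitly constructed point set $P\subset[0,1)^s$ (the interlaced Chen–Skriganov digital net over $\mathbb{F}_b$ with parameters $s,\beta,g,w$, defined in the context) has cardinality $N=b^{gw}$ (points counted with multiplicity) and satisfies $$e^{\mathrm{wor}}(\mathcal{H}_{\alpha,s};P)\le C_{\alpha,\beta,b,s}\,\frac{(\log N)^{(s-1)/2}}{N^{\alpha}}.$$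
   Context: $\mathbb{N}$ is the set of positive integers. For a prime $b$, $\mathbb{F}_b$ is the field with $b$ elements, identified with $\{0,1,\ldots,b-1\}$. **Worst-case error.** For a normed space $V$ of integrable functions $f:[0,1)^s\to\mathbb{R}$ and a finite multiset $P\subset[0,1)^s$, $$e^{\mathrm{wor}}(V;P)=\sup_{f\in V,\ \|f\|_V\le 1}\left|\frac{1}{|P|}\sum_{\boldsymbol{x}\in P}f(\boldsymbol{x})-\int_{[0,1)^s}f(\boldsymbol{x})\,d\boldsymbol{x}\right|,$$ where points of $P$ are counted according to multiplicity. **Function space.** For $\alpha\ge2$, $\mathcal{H}_\alpha$ is the space of $f:[0,1)\to\mathbb{R}$ such that $f^{(r)}$ is absolutely continuous for $r=0,\ldots,\alpha-1$ and $f^{(\alpha)}\in L^2[0,1)$, with inner product $$\langle f,h\rangle_\alpha=\sum_{r=0}^{\alpha-1}\int_0^1 f^{(r)}(x)\,dx\int_0^1 h^{(r)}(x)\,dx+\int_0^1 f^{(\alpha)}(x)h^{(\alpha)}(x)\,dx.$$ It is a reproducing kernel Hilbert space with kernel $$\mathcal{K}_\alpha(x,y)=\sum_{r=0}^{\alpha}\frac{B_r(x)B_r(y)}{(r!)^2}+(-1)^{\alpha+1}\frac{B_{2\alpha}(|x-y|)}{(2\alpha)!},$$ where $B_r$ is the Bernoulli polynomial of degree $r$. The space $\mathcal{H}_{\alpha,s}=\bigotimes_{j=1}^s\mathcal{H}_\alpha$ is the $s$-fold Hilbert space tensor product, i.e. the reproducing kernel Hilbert space with kernel $\mathcal{K}_{\alpha,s}(\boldsymbol{x},\boldsymbol{y})=\prod_{j=1}^s\mathcal{K}_\alpha(x_j,y_j)$;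 its norm is the associated Hilbert space norm. **Digital nets.** Let $C_1,\ldots,C_s\in\mathbb{F}_b^{n\times m}$. For $0\le h<b^m$ with $b$-adic expansion $h=\eta_0+\eta_1b+\cdots+\eta_{m-1}b^{m-1}$, put $(\xi_{1,h,j},\ldots,\xi_{n,h,j})^\top=C_j(\eta_0,\ldots,\eta_{m-1})^\top$ and $x_{h,j}=\sum_{i=1}^n\xi_{i,h,j}b^{-i}$. The multiset $\{\boldsymbol{x}_h=(x_{h,1},\ldots,x_{h,s}):0\le h<b^m\}$ is the digital net over $\mathbb{F}_b$ with generating matrices $C_1,\ldots,C_s$. **The construction of $P$.** Let $s,\beta,g,w\in\mathbb{N}$ and let $b\ge\beta gs$ be a prime. Let $\{\beta_{j,l}\}_{1\le j\le\beta s,\,1\le l\le g}$ be $\beta g s$ distinct elements of $\mathbb{F}_b$ (any such choice). Define $C_j=(c^{(j)}_{u,v})_{u,v=1,\ldots,gw}\in\mathbb{F}_b^{gw\times gw}$ for $1\le j\le\beta s$ by $$c^{(j)}_{(l-1)w+i,\,v}=\binom{v-1}{i-1}\beta_{j,l}^{\,v-i}\qquad(1\le i\le w,\ 1\le l\le g,\ 1\le v\le gw),$$ where binomial coefficients are taken modulo $b$, $\binom{p}{q}=0$ if $p<q$ (the entry is then $0$), and $0^0=1$. Let $\boldsymbol{c}_{h,j}$ be the $h$-th row of $C_j$. Define $D_1,\ldots,D_s\in\mathbb{F}_b^{\beta gw\times gw}$ by letting the $(\beta(h-1)+i)$-th row of $D_j$ be $\boldsymbol{c}_{h,\beta(j-1)+i}$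 for $1\le h\le gw$, $1\le i\le\beta$, $1\le j\le s$. Then $P\subset[0,1)^s$ is the digital net over $\mathbb{F}_b$ with generating matrices $D_1,\ldots,D_s$. *)

theory Defs
  imports
    "HOL-Analysis.Analysis"
    "HOL-Library.Multiset"
    "HOL-Computational_Algebra.Primes"
begin

text \<open>
  Points of \<open>[0,1)\<^sup>s\<close> are functions on the index set \<open>{1..s}\<close>, extended by
  \<^const>\<open>undefined\<close> outside of it, so that the library's product measure applies.
\<close>

definition unit_cube :: "nat \<Rightarrow> (nat \<Rightarrow> real) set" where
  "unit_cube s = {1..s} \<rightarrow>\<^sub>E {0..<1}"

definition unit_cube_measure :: "nat \<Rightarrow> (nat \<Rightarrow> real) measure" where
  "unit_cube_measure s = (\<Pi>\<^sub>M j\<in>{1..s}. restrict_space lborel {0..<1})"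

lemma space_unit_cube_measure: "space (unit_cube_measure s) = unit_cube s"
  by (simp add: unit_cube_measure_def unit_cube_def space_PiM space_restrict_space)

text \<open>
  The supremum is taken in \<^typ>\<open>ereal\<close>, so it is meaningful without
  a boundedness assumption.
\<close>

definition worst_case_error ::
  "nat \<Rightarrow> ((nat \<Rightarrow> real) \<Rightarrow> real) set \<Rightarrow> (((nat \<Rightarrow> real) \<Rightarrow> real) \<Rightarrow> real)
    \<Rightarrow> (nat \<Rightarrow> real) multiset \<Rightarrow> ereal" where
  "worst_case_error s V nrm P =
     (SUP f\<in>{f \<in> V. nrm f \<le> 1}.
        ereal \<bar>(\<Sum>x\<in>#P. f x) / real (size P) - (LINT x|unit_cube_measure s. f x)\<bar>)"

text \<open>
  A Hilbert space \<open>V\<close> of real functions on \<open>X\<close>, with inner product \<open>ip\<close>. A function on \<open>X\<close>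
  is represented by its extension by zero; this makes \<open>V\<close> closed under the pointwise
  operations, and equality in \<open>V\<close> is equality on \<open>X\<close>. The values of \<open>ip\<close> outside \<open>V\<close> play
  no role.
\<close>

definition ip_norm :: "('f \<Rightarrow> 'f \<Rightarrow> real) \<Rightarrow> 'f \<Rightarrow> real" where
  "ip_norm ip f = sqrt (ip f f)"

locale hilbert_function_space =
  fixes X :: "'x set"
    and V :: "('x \<Rightarrow> real) set"
    and ip :: "('x \<Rightarrow> real) \<Rightarrow> ('x \<Rightarrow> real) \<Rightarrow> real"
  assumes zero_outside: "\<lbrakk>f \<in> V; x \<notin> X\<rbrakk> \<Longrightarrow> f x = 0"
    and zero_closed: "(\<lambda>x. 0) \<in> V"
    and add_closed: "\<lbrakk>f \<in> V; h \<in> V\<rbrakk> \<Longrightarrow> (\<lambda>x. f x + h x) \<in> V"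
    and scale_closed: "f \<in> V \<Longrightarrow> (\<lambda>x. c * f x) \<in> V"
    and ip_commute: "\<lbrakk>f \<in> V; h \<in> V\<rbrakk> \<Longrightarrow> ip f h = ip h f"
    and ip_add: "\<lbrakk>f \<in> V; f' \<in> V; h \<in> V\<rbrakk> \<Longrightarrow> ip (\<lambda>x. f x + f' x) h = ip f h + ip f' h"
    and ip_scale: "\<lbrakk>f \<in> V; h \<in> V\<rbrakk> \<Longrightarrow> ip (\<lambda>x. c * f x) h = c * ip f h"
    and ip_nonneg: "f \<in> V \<Longrightarrow> ip f f \<ge> 0"
    and ip_definite: "\<lbrakk>f \<in> V; ip f f = 0\<rbrakk> \<Longrightarrow> f = (\<lambda>x. 0)"
    and complete: "Metric_space.mcomplete V (\<lambda>f h. ip_norm ip (\<lambda>x. f x - h x))"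

text \<open>
  By the Moore--Aronszajn theorem, a kernel on \<open>X\<close> determines \<open>V\<close>, and \<open>ip\<close> on \<open>V\<close>, uniquely.
\<close>

locale reproducing_kernel_hilbert_space = hilbert_function_space X V ip
  for X :: "'x set"
    and V :: "('x \<Rightarrow> real) set"
    and ip :: "('x \<Rightarrow> real) \<Rightarrow> ('x \<Rightarrow> real) \<Rightarrow> real" +
  fixes K :: "'x \<Rightarrow> 'x \<Rightarrow> real"
  assumes kernel_section: "y \<in> X \<Longrightarrow> (\<lambda>x. if x \<in> X then K x y else 0) \<in> V"
    and reproducing: "\<lbrakk>f \<in> V; y \<in> X\<rbrakk> \<Longrightarrow> ip f (\<lambda>x. if x \<in> X then K x y else 0) = f y"

text \<open>Bernoulli numbers with the convention \<open>B\<^sub>1 = - 1/2\<close>.\<close>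

fun bernoulli_number :: "nat \<Rightarrow> real" where
  "bernoulli_number 0 = 1"
| "bernoulli_number (Suc n) =
     - (\<Sum>k\<le>n. real ((n + 2) choose k) * bernoulli_number k) / real (n + 2)"

definition bernoulli_poly :: "nat \<Rightarrow> real \<Rightarrow> real" where
  "bernoulli_poly r x = (\<Sum>k\<le>r. real (r choose k) * bernoulli_number k * x ^ (r - k))"

text \<open>
  The reproducing kernel of the space of \<open>f : [0,1) \<rightarrow> \<real>\<close> with \<open>f, f', \<dots>, f\<^sup>(\<^sup>\<alpha>\<^sup>-\<^sup>1\<^sup>)\<close>
  absolutely continuous and \<open>f\<^sup>(\<^sup>\<alpha>\<^sup>) \<in> L\<^sup>2\<close>, under the inner product
  \<open>\<Sum>r<\<alpha>. (\<integral> f\<^sup>(\<^sup>r\<^sup>)) * (\<integral> h\<^sup>(\<^sup>r\<^sup>)) + \<integral> f\<^sup>(\<^sup>\<alpha>\<^sup>) * h\<^sup>(\<^sup>\<alpha>\<^sup>)\<close>.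
\<close>

definition sobolev_kernel :: "nat \<Rightarrow> real \<Rightarrow> real \<Rightarrow> real" where
  "sobolev_kernel \<alpha> x y =
     (\<Sum>r=0..\<alpha>. bernoulli_poly r x * bernoulli_poly r y / (fact r)\<^sup>2)
     + (-1) ^ (\<alpha> + 1) * bernoulli_poly (2 * \<alpha>) \<bar>x - y\<bar> / fact (2 * \<alpha>)"

definition sobolev_kernel_prod :: "nat \<Rightarrow> nat \<Rightarrow> (nat \<Rightarrow> real) \<Rightarrow> (nat \<Rightarrow> real) \<Rightarrow> real" where
  "sobolev_kernel_prod \<alpha> s x y = (\<Prod>j=1..s. sobolev_kernel \<alpha> (x j) (y j))"

text \<open>
  \<open>(V, ip)\<close> is the \<open>s\<close>-fold Hilbert space tensor power of the unanchored Sobolev space of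
  smoothness \<open>\<alpha>\<close> on \<open>[0,1)\<close>, that is, the reproducing kernel Hilbert space of the product
  kernel.
\<close>

abbreviation is_sobolev_space ::
  "nat \<Rightarrow> nat \<Rightarrow> ((nat \<Rightarrow> real) \<Rightarrow> real) set
    \<Rightarrow> (((nat \<Rightarrow> real) \<Rightarrow> real) \<Rightarrow> ((nat \<Rightarrow> real) \<Rightarrow> real) \<Rightarrow> real) \<Rightarrow> bool" where
  "is_sobolev_space \<alpha> s V ip \<equiv>
     reproducing_kernel_hilbert_space (unit_cube s) V ip (sobolev_kernel_prod \<alpha> s)"

text \<open>
  The field with \<open>b\<close> elements (\<open>b\<close> prime) is \<open>{0..<b}\<close> with arithmetic modulo \<open>b\<close>.
  Matrices are functions of a row and a column index, both counted from 1; a family of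
  matrices takes the index of the matrix, also counted from 1, as its first argument.
\<close>

definition net_digit :: "nat \<Rightarrow> nat \<Rightarrow> (nat \<Rightarrow> nat \<Rightarrow> nat \<Rightarrow> nat) \<Rightarrow> nat \<Rightarrow> nat \<Rightarrow> nat \<Rightarrow> nat" where
  "net_digit b m C i h j = (\<Sum>v=1..m. C j i v * (h div b ^ (v - 1) mod b)) mod b"

definition net_point ::
  "nat \<Rightarrow> nat \<Rightarrow> nat \<Rightarrow> nat \<Rightarrow> (nat \<Rightarrow> nat \<Rightarrow> nat \<Rightarrow> nat) \<Rightarrow> nat \<Rightarrow> nat \<Rightarrow> real" where
  "net_point b n m s C h =
     (\<lambda>j\<in>{1..s}. \<Sum>i=1..n. real (net_digit b m C i h j) / real b ^ i)"

definition digital_net ::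
  "nat \<Rightarrow> nat \<Rightarrow> nat \<Rightarrow> nat \<Rightarrow> (nat \<Rightarrow> nat \<Rightarrow> nat \<Rightarrow> nat) \<Rightarrow> (nat \<Rightarrow> real) multiset" where
  "digital_net b n m s C = image_mset (net_point b n m s C) (mset_set {0..<b ^ m})"

text \<open>
  Row \<open>r = (l - 1) * w + i\<close> with \<open>1 \<le> i \<le> w\<close>. For \<open>v < i\<close> the truncated exponent is
  harmless because the binomial coefficient vanishes.
\<close>

definition chen_skriganov_matrix ::
  "nat \<Rightarrow> nat \<Rightarrow> (nat \<Rightarrow> nat \<Rightarrow> nat) \<Rightarrow> nat \<Rightarrow> nat \<Rightarrow> nat \<Rightarrow> nat" where
  "chen_skriganov_matrix b w B j r v =
     (let l = (r - 1) div w + 1; i = (r - 1) mod w + 1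
      in ((v - 1) choose (i - 1)) * B j l ^ (v - i) mod b)"

text \<open>Row \<open>r = \<beta> * (h - 1) + i\<close> with \<open>1 \<le> i \<le> \<beta>\<close>.\<close>

definition interlace ::
  "nat \<Rightarrow> (nat \<Rightarrow> nat \<Rightarrow> nat \<Rightarrow> nat) \<Rightarrow> nat \<Rightarrow> nat \<Rightarrow> nat \<Rightarrow> nat" where
  "interlace \<beta> C j r v =
     (let h = (r - 1) div \<beta> + 1; i = (r - 1) mod \<beta> + 1
      in C (\<beta> * (j - 1) + i) h v)"

definition interlaced_cs_net ::
  "nat \<Rightarrow> nat \<Rightarrow> nat \<Rightarrow> nat \<Rightarrow> nat \<Rightarrow> (nat \<Rightarrow> nat \<Rightarrow> nat) \<Rightarrow> (nat \<Rightarrow> real) multiset" where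
  "interlaced_cs_net b s \<beta> g w B =
     digital_net b (\<beta> * g * w) (g * w) s (interlace \<beta> (chen_skriganov_matrix b w B))"

lemma chen_skriganov_matrix_entry:
  assumes "1 \<le> i" "i \<le> w" "1 \<le> l"
  shows "chen_skriganov_matrix b w B j ((l - 1) * w + i) v =
           ((v - 1) choose (i - 1)) * B j l ^ (v - i) mod b"
proof -
  obtain i' l' where "i = Suc i'" "l = Suc l'"
    using assms by (metis Suc_le_D One_nat_def)
  then show ?thesis using assms by (simp add: chen_skriganov_matrix_def Let_def)
qed

lemma interlace_row:
  assumes "1 \<le> i" "i \<le> \<beta>" "1 \<le> h"
  shows "interlace \<beta> C j (\<beta> * (h - 1) + i) = C (\<beta> * (j - 1) + i) h"
proof -
  obtain i' h' where "i = Suc i'" "h = Suc h'"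
    using assms by (metis Suc_le_D One_nat_def)
  then show ?thesis using assms by (simp add: interlace_def Let_def fun_eq_iff)
qed

lemma digital_net_subset_unit_cube:
  assumes "b \<ge> 2"
  shows "set_mset (digital_net b n m s C) \<subseteq> unit_cube s"
proof -
  have 1: "(\<Sum>i=1..n. real (net_digit b m C i h j) / real b ^ i) \<le> 1 - 1 / real b ^ n" for h j
  proof (induction n)
    case (Suc n)
    have "net_digit b m C (Suc n) h j < b"
      using assms by (simp add: net_digit_def)
    then have "real (net_digit b m C (Suc n) h j) \<le> real b - 1" by linarith
    then have "real (net_digit b m C (Suc n) h j) / real b ^ Suc n \<le> (real b - 1) / real b ^ Suc n"
      by (rule divide_right_mono) simp
    also have "\<dots> = 1 / real b ^ n - 1 / real b ^ Suc n"
      using assms by (simp add: field_simps)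
    finally show ?case using Suc.IH by simp
  qed simp
  have "1 / real b ^ n > 0" using assms by simp
  then have "(\<Sum>i=1..n. real (net_digit b m C i h j) / real b ^ i) < 1" for h j
    using 1[of h j] by linarith
  moreover have "(\<Sum>i=1..n. real (net_digit b m C i h j) / real b ^ i) \<ge> 0" for h j
    by (intro sum_nonneg) simp
  ultimately show ?thesis
    by (auto simp: digital_net_def unit_cube_def net_point_def)
qed

end

theory Submission
  imports Defs "HOL-Computational_Algebra.Computational_Algebra"
begin

text \<open>
  With \<open>n = \<beta>gw\<close> digits, the full grid of mesh \<open>b\<^sup>-\<^sup>n\<close> integrates the unit ball up to
  \<open>O(b\<^sup>-\<^sup>n\<^sup>/\<^sup>2)\<close>, because a Lipschitz kernel makes its elements Hoelder continuous with exponent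
  1/2; as \<open>\<beta> \<ge> 2\<alpha>\<close>, this is \<open>O(N\<^sup>-\<^sup>\<alpha>)\<close>. So the net need only be compared with the grid, which is a
  finite problem: the squared difference is at most the sum of the discrete Walsh coefficients
  \<open>K(\<kappa>, \<mu>)\<close> of the kernel over pairs of nonzero elements of the dual net.

  The one-dimensional kernel is a polynomial of total degree \<open>2\<alpha>\<close> plus a multiple of
  \<open>\<bar>x - y\<bar>\<^sup>2\<^sup>\<alpha>\<^sup>-\<^sup>1\<close>, since the odd Bernoulli numbers vanish. Hence its coefficients vanish unless the
  two digit vectors differ in at most \<open>2\<alpha>\<close> places, and on the diagonal they are
  \<open>O(b\<^sup>-\<^sup>2\<^sup>\<mu>)\<close> with \<open>\<mu>\<close> the sum of the \<open>\<alpha>\<close> largest positions of nonzero digits. By Hermite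
  interpolation, distinct elements of the dual net differ in more than \<open>g \<ge> 2\<alpha>s\<close> places, so only the
  diagonal survives. Interpolation also bounds the number of dual elements with prescribed
  leading digits; grouping the diagonal sum by the vector of the \<open>\<alpha>\<close>-th largest positions leaves a sum
  that decays geometrically in all but \<open>s - 1\<close> directions, which gives \<open>(log N)\<^sup>s\<^sup>-\<^sup>1 N\<^sup>-\<^sup>2\<^sup>\<alpha>\<close>.
\<close>

subsection \<open>Digit vectors and Walsh coefficients\<close>

text \<open>The number of digits n grows with w, so no constant may depend on it. The coefficient
  estimates are therefore inductions on n that strip the leading digit. A nonzero digit costs a
  polynomial one degree; the kink becomes a polynomial if the leading digits of its arguments differ
  and gains b^(-2\<alpha>) if they agree. Stripping lowers each counted position by one, so this
  gain pays for \<alpha> positions, counted twice. For the geometric decay let m = gw, let a be the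
  sum of the \<alpha>-th largest positions and y the total excess of the larger ones over them. The
  weight is b^(-2(\<alpha> a + y)), and a group has at most b^(max(a - m, 0)) elements, so a surplus
  a > m is paid for at once. If a < m, a nonzero dual element needs digits above the box to
  compensate. Interlacing lets a digit at distance d above it add only about d / \<beta> positions
  to the interpolation count, which gives \<beta> (m - a) \<le> y + const. As \<beta> \<ge>
  2\<alpha>, part of b^(-2y) replaces the missing b^(-2\<alpha>(m - a)), and the rest controls the
  sum over the digits above the box.\<close>

definition digit_vecs :: "nat \<Rightarrow> nat \<Rightarrow> (nat \<Rightarrow> nat) set" where
  "digit_vecs b n = {a. (\<forall>i<n. a i < b) \<and> (\<forall>i\<ge>n. a i = 0)}"

definition radix_val :: "nat \<Rightarrow> nat \<Rightarrow> (nat \<Rightarrow> nat) \<Rightarrow> real" where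
  "radix_val b n a = (\<Sum>i<n. real (a i) / real b ^ Suc i)"

lemma digit_vecs_0 [simp]: "digit_vecs b 0 = {\<lambda>_. 0}"
  by (auto simp: digit_vecs_def)

lemma case_nat_in_digit_vecs:
  "p < b \<Longrightarrow> a \<in> digit_vecs b n \<Longrightarrow> case_nat p a \<in> digit_vecs b (Suc n)"
  by (auto simp: digit_vecs_def split: nat.split)

lemma digit_vecs_Suc:
  "digit_vecs b (Suc n) = (\<lambda>(p, a). case_nat p a) ` ({..<b} \<times> digit_vecs b n)"
proof (intro equalityI subsetI)
  fix a assume a: "a \<in> digit_vecs b (Suc n)"
  have "a = case_nat (a 0) (a \<circ> Suc)"
    by (auto simp: fun_eq_iff split: nat.split)
  moreover have "a 0 < b" "a \<circ> Suc \<in> digit_vecs b n"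
    using a by (auto simp: digit_vecs_def)
  ultimately show "a \<in> (\<lambda>(p, a). case_nat p a) ` ({..<b} \<times> digit_vecs b n)"
    by (intro image_eqI[of _ _ "(a 0, a \<circ> Suc)"]) auto
qed (auto intro!: case_nat_in_digit_vecs)

lemma comp_Suc_in_digit_vecs: "k \<in> digit_vecs b (Suc n) \<Longrightarrow> k \<circ> Suc \<in> digit_vecs b n"
  by (auto simp: digit_vecs_def)

lemma inj_case_nat: "inj_on (\<lambda>(p, a). case_nat p a) A"
proof (rule inj_onI, clarify)
  fix p q :: 'b and a c :: "nat \<Rightarrow> 'b" assume *: "case_nat p a = case_nat q c"
  have "p = q" using fun_cong[OF *, of 0] by simp
  moreover have "a i = c i" for i using fun_cong[OF *, of "Suc i"] by simp
  ultimately show "p = q \<and> a = c" by auto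
qed

lemma sum_digit_vecs_Suc:
  "(\<Sum>a\<in>digit_vecs b (Suc n). F a) = (\<Sum>p<b. \<Sum>a\<in>digit_vecs b n. F (case_nat p a))"
  unfolding digit_vecs_Suc by (subst sum.reindex[OF inj_case_nat]) (simp add: sum.cartesian_product case_prod_beta)

lemma finite_digit_vecs [simp]: "finite (digit_vecs b n)"
  by (induction n) (auto simp: digit_vecs_Suc)

lemma sum_digit_vecs_prod:
  fixes f :: "nat \<Rightarrow> nat \<Rightarrow> 'a::comm_semiring_1"
  shows "(\<Sum>a\<in>digit_vecs b n. \<Prod>i<n. f i (a i)) = (\<Prod>i<n. \<Sum>d<b. f i d)"
proof (induction n arbitrary: f)
  case (Suc n)
  have "(\<Sum>a\<in>digit_vecs b (Suc n). \<Prod>i<Suc n. f i (a i))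
      = (\<Sum>p<b. f 0 p * (\<Sum>a\<in>digit_vecs b n. \<Prod>i<n. f (Suc i) (a i)))"
    by (simp add: sum_digit_vecs_Suc prod.lessThan_Suc_shift sum_distrib_left del: prod.lessThan_Suc)
  also have "\<dots> = (\<Prod>i<Suc n. \<Sum>d<b. f i d)"
    by (simp add: Suc.IH[of "\<lambda>i. f (Suc i)"] prod.lessThan_Suc_shift sum_distrib_right del: prod.lessThan_Suc)
  finally show ?case .
qed simp

lemma radix_val_Suc:
  assumes "b > 0"
  shows "radix_val b (Suc n) (case_nat p a) = (real p + radix_val b n a) / real b"
  using assms
  by (simp add: radix_val_def sum.lessThan_Suc_shift sum_divide_distrib add_divide_distrib
      mult_ac del: sum.lessThan_Suc)

lemma radix_val_nonneg: "radix_val b n a \<ge> 0"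
  by (auto simp: radix_val_def intro!: sum_nonneg)

lemma radix_val_upper:
  assumes "b > 0" "a \<in> digit_vecs b n"
  shows "radix_val b n a \<le> 1 - 1 / real b ^ n"
  using assms(2)
proof (induction n arbitrary: a)
  case (Suc n)
  then obtain p c where pc: "a = case_nat p c" "p < b" "c \<in> digit_vecs b n"
    by (auto simp: digit_vecs_Suc)
  have "real p \<le> real b - 1" using pc by linarith
  then have "real p + radix_val b n c \<le> real b - 1 / real b ^ n"
    using Suc.IH[OF pc(3)] by simp
  then have "(real p + radix_val b n c) / real b \<le> (real b - 1 / real b ^ n) / real b"
    by (rule divide_right_mono) simp
  also have "\<dots> = 1 - 1 / real b ^ Suc n"
    using assms(1) by (simp add: diff_divide_distrib)
  finally show ?case
    using assms(1) by (simp add: pc radix_val_Suc)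
qed (simp add: radix_val_def)

lemma radix_val_less_1:
  assumes "b > 0" "a \<in> digit_vecs b n"
  shows "radix_val b n a < 1"
proof -
  have "1 / real b ^ n > 0" using assms by simp
  then show ?thesis using radix_val_upper[OF assms] by linarith
qed

section \<open>Characters of the digit group and their orthogonality\<close>

definition root1 :: "nat \<Rightarrow> complex" where
  "root1 b = cis (2 * pi / real b)"

text \<open>Frequency and point are both digit vectors, paired index by index; index 0 is the
  leading digit of a point. On \<open>digit_vecs b n\<close> these are the characters of the n-fold
  power of Z/b, symmetric in both arguments.\<close>

definition walsh :: "nat \<Rightarrow> nat \<Rightarrow> (nat \<Rightarrow> nat) \<Rightarrow> (nat \<Rightarrow> nat) \<Rightarrow> complex" where
  "walsh b n k a = root1 b ^ (\<Sum>i<n. k i * a i)"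

lemma root1_power: "root1 b ^ k = cis (2 * pi * real k / real b)"
proof -
  have "root1 b ^ k = cis (real k * (2 * pi / real b))"
    by (simp only: root1_def Complex.DeMoivre)
  also have "real k * (2 * pi / real b) = 2 * pi * real k / real b" by simp
  finally show ?thesis .
qed

lemma norm_root1_power [simp]: "norm (root1 b ^ k) = 1"
  by (simp add: root1_power)

lemma root1_cnj_power [simp]: "root1 b ^ k * cnj (root1 b ^ k) = 1"
  "cnj (root1 b ^ k) * root1 b ^ k = 1"
  by (simp_all add: root1_power cis_cnj cis_mult)

lemma root1_power_b [simp]: "b > 0 \<Longrightarrow> root1 b ^ b = 1"
  by (simp add: root1_power)

lemma root1_power_mod:
  assumes "b > 0"
  shows "root1 b ^ (k mod b) = root1 b ^ k"
proof -
  have "root1 b ^ k = root1 b ^ (b * (k div b) + k mod b)" by simp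
  also have "\<dots> = root1 b ^ (k mod b)"
    unfolding power_add power_mult using assms by simp
  finally show ?thesis by simp
qed

lemma root1_power_neq_1:
  assumes "0 < k" "k < b"
  shows "root1 b ^ k \<noteq> 1"
proof
  assume *: "root1 b ^ k = 1"
  have "Re (cis (2 * pi * real k / real b)) = 1" using * by (simp add: root1_power del: cis.sel)
  then have "cos (2 * pi * real k / real b) = 1" by simp
  then obtain x :: int where "2 * pi * real k / real b = of_int x * 2 * pi"
    by (auto simp: cos_one_2pi_int)
  then have x: "2 * pi * real k / real b = 2 * pi * real_of_int x"
    by simp
  have "real k / real b = real_of_int x"
    using x by (metis mult_cancel_left pi_neq_zero times_divide_eq_right zero_neq_numeral mult_eq_0_iff)
  moreover have "0 < real k / real b" "real k / real b < 1" using assms by auto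
  ultimately have "0 < real_of_int x" "real_of_int x < 1" by simp_all
  then show False by simp
qed

lemma sum_root1_powers:
  assumes "b > 0"
  shows "(\<Sum>p<b. root1 b ^ (k * p)) = (if b dvd k then of_nat b else 0)"
proof (cases "b dvd k")
  case True
  then have "root1 b ^ (k * p) = 1" for p
    using assms by (auto elim!: dvdE simp: power_mult)
  then show ?thesis using True by simp
next
  case False
  let ?z = "root1 b ^ k"
  have "?z = root1 b ^ (k mod b)" using assms by (simp add: root1_power_mod)
  moreover have "0 < k mod b" using False by (simp add: mod_greater_zero_iff_not_dvd)
  ultimately have "?z \<noteq> 1" using root1_power_neq_1[of "k mod b" b] assms by simp
  moreover have "?z ^ b = 1"
    using assms by (metis mult.commute power_mult power_one root1_power_b)
  ultimately show ?thesis
    using False by (simp add: power_mult sum_gp_strict)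
qed

text \<open>Conjugation replaces k by b - k, and 0 < b - k + l < 2b, so b divides this number only
  if it equals b.\<close>

lemma sum_root1_cross:
  assumes "b > 0" "k < b" "l < b"
  shows "(\<Sum>p<b. cnj (root1 b ^ (k * p)) * root1 b ^ (l * p)) = (if k = l then of_nat b else 0)"
proof -
  have "cnj (root1 b ^ (k * p)) = root1 b ^ ((b - k) * p)" for p
  proof -
    have "root1 b ^ (k * p) * root1 b ^ ((b - k) * p) = (root1 b ^ b) ^ p"
    proof -
      have "k * p + (b - k) * p = b * p"
        using assms by (metis add_mult_distrib le_add_diff_inverse less_imp_le_nat)
      then show ?thesis by (simp only: power_add[symmetric] power_mult[symmetric])
    qed
    then have "root1 b ^ (k * p) * root1 b ^ ((b - k) * p) = 1" using assms by simp
    then show ?thesis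
      by (metis root1_cnj_power(2) mult.assoc mult.left_neutral mult.right_neutral)
  qed
  then have "(\<Sum>p<b. cnj (root1 b ^ (k * p)) * root1 b ^ (l * p)) = (\<Sum>p<b. root1 b ^ ((b - k + l) * p))"
    by (simp add: power_add add_mult_distrib)
  moreover have "b dvd (b - k + l) \<longleftrightarrow> k = l"
  proof
    assume "b dvd (b - k + l)"
    then obtain c where c: "b - k + l = b * c" by (auto elim: dvdE)
    have "c < 2"
    proof (rule ccontr)
      assume "\<not> c < 2" then have "b * 2 \<le> b * c" by simp
      with c assms show False by linarith
    qed
    moreover have "c \<noteq> 0" using c assms by (intro notI) simp
    ultimately have "c = 1" by simp
    then show "k = l" using c assms by simp
  qed (use assms in simp)
  ultimately show ?thesis by (simp add: sum_root1_powers[OF assms(1)])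
qed

lemma walsh_Suc: "walsh b (Suc n) k (case_nat p a) = root1 b ^ (k 0 * p) * walsh b n (k \<circ> Suc) a"
  by (simp add: walsh_def sum.lessThan_Suc_shift power_add del: sum.lessThan_Suc)

lemma walsh_prod: "walsh b n k a = (\<Prod>i<n. root1 b ^ (k i * a i))"
  by (simp add: walsh_def power_sum)

lemma walsh_commute: "walsh b n k a = walsh b n a k"
  by (simp add: walsh_def mult.commute)

lemma walsh_orthogonal:
  assumes "b > 0" "k \<in> digit_vecs b n" "l \<in> digit_vecs b n"
  shows "(\<Sum>a\<in>digit_vecs b n. cnj (walsh b n k a) * walsh b n l a) = (if k = l then of_nat b ^ n else 0)"
proof -
  have "(\<Sum>a\<in>digit_vecs b n. cnj (walsh b n k a) * walsh b n l a)
     = (\<Sum>a\<in>digit_vecs b n. \<Prod>i<n. cnj (root1 b ^ (k i * a i)) * root1 b ^ (l i * a i))"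
    by (simp add: walsh_prod prod.distrib)
  also have "\<dots> = (\<Prod>i<n. if k i = l i then of_nat b else 0)"
    unfolding sum_digit_vecs_prod[where f = "\<lambda>i d. cnj (root1 b ^ (k i * d)) * root1 b ^ (l i * d)"]
    using assms by (intro prod.cong refl sum_root1_cross) (auto simp: digit_vecs_def)
  also have "\<dots> = (if k = l then of_nat b ^ n else 0)"
  proof (cases "k = l")
    case False
    then obtain i where i: "k i \<noteq> l i" by auto
    have "i < n"
    proof (rule ccontr)
      assume "\<not> i < n"
      then have "k i = 0" "l i = 0" using assms by (auto simp: digit_vecs_def)
      with i show False by simp
    qed
    with i False show ?thesis by (auto intro!: prod_zero)
  qed simp
  finally show ?thesis .
qed

section \<open>Discrete Walsh coefficients and their recursion in the number of digits\<close>

definition walsh_coeff :: "nat \<Rightarrow> nat \<Rightarrow> (real \<Rightarrow> real) \<Rightarrow> (nat \<Rightarrow> nat) \<Rightarrow> complex" where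
  "walsh_coeff b n F k =
     (\<Sum>a\<in>digit_vecs b n. of_real (F (radix_val b n a)) * cnj (walsh b n k a)) / of_nat b ^ n"

text \<open>Averages over the grid of mesh b^(-n) replace integrals, so that inversion is a finite
  identity. Only the first character is conjugated: F(x) G(y) has the coefficient of F times the
  conjugate of that of G.\<close>

definition walsh_coeff2 ::
  "nat \<Rightarrow> nat \<Rightarrow> (real \<Rightarrow> real \<Rightarrow> real) \<Rightarrow> (nat \<Rightarrow> nat) \<Rightarrow> (nat \<Rightarrow> nat) \<Rightarrow> complex" where
  "walsh_coeff2 b n F k l =
     (\<Sum>a\<in>digit_vecs b n. \<Sum>c\<in>digit_vecs b n. of_real (F (radix_val b n a) (radix_val b n c))
        * (cnj (walsh b n k a) * walsh b n l c)) / of_nat b ^ (2 * n)"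

text \<open>Fixing the leading digit p restricts F to [p/b, (p+1)/b), rescaled to [0,1). What is
  left has one digit less, which makes bounds uniform in n accessible to induction.\<close>

lemma walsh_coeff_Suc:
  assumes "b > 0"
  shows "walsh_coeff b (Suc n) F k =
    (\<Sum>p<b. cnj (root1 b ^ (k 0 * p)) / of_nat b * walsh_coeff b n (\<lambda>x. F ((real p + x) / real b)) (k \<circ> Suc))"
  unfolding walsh_coeff_def sum_digit_vecs_Suc sum_divide_distrib sum_distrib_left
  by (intro sum.cong refl) (simp add: radix_val_Suc[OF assms] walsh_Suc)

lemma walsh_coeff2_Suc:
  assumes "b > 0"
  shows "walsh_coeff2 b (Suc n) F k l =
    (\<Sum>p<b. \<Sum>q<b. cnj (root1 b ^ (k 0 * p)) * root1 b ^ (l 0 * q) / of_nat b ^ 2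
       * walsh_coeff2 b n (\<lambda>x y. F ((real p + x) / real b) ((real q + y) / real b)) (k \<circ> Suc) (l \<circ> Suc))"
proof -
  have "walsh_coeff2 b (Suc n) F k l =
    (\<Sum>p<b. \<Sum>a\<in>digit_vecs b n. \<Sum>q<b. \<Sum>c\<in>digit_vecs b n. of_real (F (radix_val b (Suc n) (case_nat p a)) (radix_val b (Suc n) (case_nat q c)))
        * (cnj (walsh b (Suc n) k (case_nat p a)) * walsh b (Suc n) l (case_nat q c)) / of_nat b ^ (2 * Suc n))"
    by (simp add: walsh_coeff2_def sum_digit_vecs_Suc sum_divide_distrib)
  also have "\<dots> = (\<Sum>p<b. \<Sum>q<b. \<Sum>a\<in>digit_vecs b n. \<Sum>c\<in>digit_vecs b n. of_real (F (radix_val b (Suc n) (case_nat p a)) (radix_val b (Suc n) (case_nat q c)))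
        * (cnj (walsh b (Suc n) k (case_nat p a)) * walsh b (Suc n) l (case_nat q c)) / of_nat b ^ (2 * Suc n))"
    by (intro sum.cong refl sum.swap)
  also have "\<dots> = (\<Sum>p<b. \<Sum>q<b. cnj (root1 b ^ (k 0 * p)) * root1 b ^ (l 0 * q) / of_nat b ^ 2
       * walsh_coeff2 b n (\<lambda>x y. F ((real p + x) / real b) ((real q + y) / real b)) (k \<circ> Suc) (l \<circ> Suc))"
    unfolding walsh_coeff2_def sum_divide_distrib sum_distrib_left
    by (intro sum.cong refl) (simp add: radix_val_Suc[OF assms] walsh_Suc power2_eq_square mult_ac)
  finally show ?thesis .
qed

lemma sum_swap4:
  "(\<Sum>k\<in>K. \<Sum>l\<in>L. \<Sum>a\<in>A. \<Sum>c\<in>C. g k l a c) = (\<Sum>a\<in>A. \<Sum>c\<in>C. \<Sum>k\<in>K. \<Sum>l\<in>L. g k l a c)"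
proof -
  have "(\<Sum>k\<in>K. \<Sum>l\<in>L. \<Sum>a\<in>A. \<Sum>c\<in>C. g k l a c)
    = (\<Sum>x\<in>K \<times> L. \<Sum>y\<in>A \<times> C. g (fst x) (snd x) (fst y) (snd y))"
    unfolding sum.cartesian_product' by simp
  also have "\<dots> = (\<Sum>y\<in>A \<times> C. \<Sum>x\<in>K \<times> L. g (fst x) (snd x) (fst y) (snd y))"
    by (rule sum.swap)
  finally show ?thesis
    unfolding sum.cartesian_product' by simp
qed

lemma walsh_coeff2_inversion:
  assumes "b > 0" "a \<in> digit_vecs b n" "c \<in> digit_vecs b n"
  shows "of_real (F (radix_val b n a) (radix_val b n c)) =
    (\<Sum>k\<in>digit_vecs b n. \<Sum>l\<in>digit_vecs b n. walsh_coeff2 b n F k l * (walsh b n k a * cnj (walsh b n l c)))"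
proof -
  let ?D = "digit_vecs b n" and ?f = "\<lambda>a c. complex_of_real (F (radix_val b n a) (radix_val b n c))"
  let ?B = "of_nat b ^ (2 * n) :: complex"
  let ?w = "walsh b n"
  \<comment> \<open>Symmetry of the characters allows orthogonality to be applied with the frequency
    as summation variable.\<close>
  have "(\<Sum>k\<in>?D. \<Sum>l\<in>?D. walsh_coeff2 b n F k l * (?w k a * cnj (?w l c)))
    = (\<Sum>k\<in>?D. \<Sum>l\<in>?D. \<Sum>a'\<in>?D. \<Sum>c'\<in>?D. ?f a' c' / ?B
         * (cnj (?w a' k) * ?w a k) * (cnj (?w c l) * ?w c' l))"
    unfolding walsh_coeff2_def sum_divide_distrib sum_distrib_right
    by (intro sum.cong refl) (simp add: walsh_commute)
  also have "\<dots> = (\<Sum>a'\<in>?D. \<Sum>c'\<in>?D. \<Sum>k\<in>?D. \<Sum>l\<in>?D. ?f a' c' / ?B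
         * (cnj (?w a' k) * ?w a k) * (cnj (?w c l) * ?w c' l))"
    by (rule sum_swap4)
  also have "\<dots> = (\<Sum>a'\<in>?D. \<Sum>c'\<in>?D. ?f a' c' / ?B
         * (\<Sum>k\<in>?D. cnj (?w a' k) * ?w a k) * (\<Sum>l\<in>?D. cnj (?w c l) * ?w c' l))"
    unfolding sum_distrib_left sum_distrib_right
    by (intro sum.cong refl sum.swap)
  also have "\<dots> = (\<Sum>a'\<in>?D. \<Sum>c'\<in>?D. if a' = a then if c' = c then ?f a c else 0 else 0)"
    using assms
    by (intro sum.cong refl) (auto simp: walsh_orthogonal mult_2 power_add)
  also have "\<dots> = ?f a c"
  proof -
    have "(\<Sum>c'\<in>?D. if a' = a then if c' = c then ?f a c else 0 else 0) = (if a' = a then ?f a c else 0)" for a'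
      using assms by (cases "a' = a") simp_all
    then show ?thesis using assms by simp
  qed
  finally show ?thesis by simp
qed

subsection \<open>Walsh coefficients of polynomials\<close>

definition digit_supp :: "(nat \<Rightarrow> nat) \<Rightarrow> nat set" where
  "digit_supp k = {i. k i \<noteq> 0}"

text \<open>Positions are counted from 1. On the \<alpha> largest elements of a digit support this
  is Dick's weight of order \<alpha> for higher order nets.\<close>

definition pos_sum :: "nat set \<Rightarrow> nat" where
  "pos_sum T = (\<Sum>i\<in>T. Suc i)"

lemma digit_supp_subset: "k \<in> digit_vecs b n \<Longrightarrow> digit_supp k \<subseteq> {..<n}"
  unfolding digit_vecs_def digit_supp_def by (auto simp: not_less[symmetric])

lemma finite_digit_supp: "k \<in> digit_vecs b n \<Longrightarrow> finite (digit_supp k)"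
  by (rule finite_subset[OF digit_supp_subset]) auto

lemma digit_supp_Suc:
  "digit_supp k = (if k 0 = 0 then {} else {0}) \<union> Suc ` digit_supp (k \<circ> Suc)"
proof -
  have "i \<in> digit_supp k \<longleftrightarrow> i \<in> (if k 0 = 0 then {} else {0}) \<union> Suc ` digit_supp (k \<circ> Suc)" for i
    by (cases i) (auto simp: digit_supp_def)
  then show ?thesis by blast
qed

lemma card_digit_supp_Suc:
  assumes "finite (digit_supp (k \<circ> Suc))"
  shows "card (digit_supp k) = (if k 0 = 0 then 0 else 1) + card (digit_supp (k \<circ> Suc))"
  using assms by (subst digit_supp_Suc) (auto simp: card_image)

lemma pos_sum_Suc_image: "pos_sum (Suc ` T) = pos_sum T + card T"
  by (simp add: pos_sum_def sum.reindex sum.distrib[symmetric] flip: sum_constant)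
     (simp add: sum_Suc)

lemma pos_sum_insert_0: "finite T \<Longrightarrow> 0 \<notin> T \<Longrightarrow> pos_sum (insert 0 T) = Suc (pos_sum T)"
  by (simp add: pos_sum_def)

text \<open>Every later nonzero digit moves forward by one position and a nonzero leading digit
  stood at position 1, so the sum drops by the number of nonzero digits.\<close>

lemma pos_sum_digit_supp_Suc:
  assumes "finite (digit_supp (k \<circ> Suc))"
  shows "pos_sum (digit_supp k) = pos_sum (digit_supp (k \<circ> Suc)) + card (digit_supp k)"
  using assms
  by (subst (1 3) digit_supp_Suc) (auto simp: pos_sum_Suc_image pos_sum_insert_0 card_image)

lemma pos_sum_mono: "finite T \<Longrightarrow> S \<subseteq> T \<Longrightarrow> pos_sum S \<le> pos_sum T"
  unfolding pos_sum_def by (rule sum_mono2) auto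

lemma walsh_coeff_sum:
  "walsh_coeff b n (\<lambda>x. \<Sum>i\<in>I. c i * F i x) k = (\<Sum>i\<in>I. of_real (c i) * walsh_coeff b n (F i) k)"
proof -
  have "walsh_coeff b n (\<lambda>x. \<Sum>i\<in>I. c i * F i x) k
    = (\<Sum>a\<in>digit_vecs b n. \<Sum>i\<in>I. of_real (c i) * (of_real (F i (radix_val b n a)) * cnj (walsh b n k a) / of_nat b ^ n))"
    by (simp add: walsh_coeff_def sum_divide_distrib sum_distrib_right mult.assoc)
  also have "\<dots> = (\<Sum>i\<in>I. of_real (c i) * walsh_coeff b n (F i) k)"
    by (subst sum.swap) (simp add: walsh_coeff_def sum_distrib_left sum_divide_distrib)
  finally show ?thesis .
qed

text \<open>The factor with which the coefficient of x^i on n digits enters that of x^r on n + 1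
  digits: the binomial coefficient of x^i in ((p + x) / b)^r, averaged over p against the leading
  character.\<close>

definition monom_step :: "nat \<Rightarrow> nat \<Rightarrow> nat \<Rightarrow> nat \<Rightarrow> complex" where
  "monom_step b r i \<kappa> =
     (\<Sum>p<b. of_real (real (r choose i) * real p ^ (r - i) / real b ^ r) * (cnj (root1 b ^ (\<kappa> * p)) / of_nat b))"

lemma walsh_coeff_monom_Suc:
  assumes "b > 0"
  shows "walsh_coeff b (Suc n) (\<lambda>x. x ^ r) k
    = (\<Sum>i\<le>r. monom_step b r i (k 0) * walsh_coeff b n (\<lambda>x. x ^ i) (k \<circ> Suc))"
proof -
  have *: "((real p + x) / real b) ^ r = (\<Sum>i\<le>r. real (r choose i) * real p ^ (r - i) / real b ^ r * x ^ i)" for p x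
    by (subst add.commute) (simp add: power_divide binomial_ring sum_divide_distrib mult_ac)
  show ?thesis
    unfolding walsh_coeff_Suc[OF assms] * walsh_coeff_sum sum_distrib_left
    unfolding monom_step_def sum_distrib_right
    by (subst sum.swap, intro sum.cong refl) (simp add: mult_ac)
qed

text \<open>The coefficient of x^r in ((p + x) / b)^r does not depend on p, so a nontrivial
  character sums it to zero: a nonzero leading digit lowers the degree.\<close>

lemma monom_step_top:
  assumes "b > 0" "\<kappa> < b"
  shows "monom_step b r r \<kappa> = (if \<kappa> = 0 then 1 / of_nat b ^ r else 0)"
proof -
  have "(\<Sum>p<b. cnj (root1 b ^ (\<kappa> * p))) = (if \<kappa> = 0 then of_nat b else 0)"
    using sum_root1_cross[of b \<kappa> 0] assms by simp
  moreover have "monom_step b r r \<kappa> = (\<Sum>p<b. cnj (root1 b ^ (\<kappa> * p))) / (of_nat b * of_nat b ^ r)"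
    by (simp add: monom_step_def sum_divide_distrib mult_ac)
  ultimately show ?thesis using assms by simp
qed

lemma norm_monom_step_le:
  assumes "b > 0" "i \<le> r"
  shows "norm (monom_step b r i \<kappa>) \<le> real (r choose i)"
proof -
  have "norm (monom_step b r i \<kappa>) \<le> (\<Sum>p<b. real (r choose i) / real b)"
    unfolding monom_step_def
  proof (rule sum_norm_le)
    fix p assume "p \<in> {..<b}"
    have "real p ^ (r - i) \<le> real b ^ (r - i)"
      using \<open>p \<in> _\<close> by (intro power_mono) auto
    also have "\<dots> \<le> real b ^ r"
      using assms by (intro power_increasing) auto
    finally have "real p ^ (r - i) / real b ^ r \<le> 1" using assms by simp
    then have "real (r choose i) * (real p ^ (r - i) / real b ^ r) / real b \<le> real (r choose i) * 1 / real b"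
      by (intro divide_right_mono mult_left_mono) auto
    then show "norm (of_real (real (r choose i) * real p ^ (r - i) / real b ^ r) * (cnj (root1 b ^ (\<kappa> * p)) / of_nat b))
       \<le> real (r choose i) / real b"
      by (simp add: norm_mult norm_divide norm_power root1_def)
  qed
  also have "\<dots> = real (r choose i)" using assms by simp
  finally show ?thesis .
qed

text \<open>Each nonzero digit lowers the degree by at least one, and degree r cannot absorb more
  than r of them.\<close>

lemma walsh_coeff_monom_eq_0:
  assumes "b > 0" "k \<in> digit_vecs b n" "r < card (digit_supp k)"
  shows "walsh_coeff b n (\<lambda>x. x ^ r) k = 0"
  using assms(2,3)
proof (induction n arbitrary: r k)
  case 0
  then show ?case by (simp add: digit_supp_def)
next
  case (Suc n)
  note k' = comp_Suc_in_digit_vecs[OF Suc.prems(1)]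
  note card = card_digit_supp_Suc[OF finite_digit_supp[OF k']]
  have k0: "k 0 < b" using Suc.prems(1) by (auto simp: digit_vecs_def)
  have "monom_step b r i (k 0) * walsh_coeff b n (\<lambda>x. x ^ i) (k \<circ> Suc) = 0" if "i \<le> r" for i
  proof (cases "k 0 \<noteq> 0 \<and> i = r")
    case True
    then show ?thesis using monom_step_top[OF assms(1) k0] by simp
  next
    case False
    then have "i < card (digit_supp (k \<circ> Suc))"
      using card Suc.prems(2) that by (auto split: if_splits)
    then show ?thesis using Suc.IH[OF k', of i] by (simp only: mult_zero_right)
  qed
  then show ?case
    unfolding walsh_coeff_monom_Suc[OF assms(1)] by (intro sum.neutral) auto
qed

text \<open>Induction on r, and for fixed r on n. Dropping a digit worsens the claimed bound by b^c,
  where c is the number of nonzero digits, while the term of degree r carries b^(-r). For c < r this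
  contracts by at least 1/2, and for c > r the coefficient vanishes; only c = r needs care.\<close>

lemma walsh_coeff_monom_bound:
  assumes "b \<ge> 2"
  shows "\<exists>C\<ge>0. \<forall>n. \<forall>k\<in>digit_vecs b n.
    norm (walsh_coeff b n (\<lambda>x. x ^ r) k) \<le> C / real b ^ pos_sum (digit_supp k)"
proof (induction r rule: less_induct)
  case (less r)
  have b: "b > 0" using assms by simp
  have "\<forall>i. \<exists>C. i < r \<longrightarrow> C \<ge> 0 \<and> (\<forall>n. \<forall>k\<in>digit_vecs b n.
    norm (walsh_coeff b n (\<lambda>x. x ^ i) k) \<le> C / real b ^ pos_sum (digit_supp k))"
    using less.IH by meson
  then obtain C where C0: "\<And>i. i < r \<Longrightarrow> C i \<ge> 0"
    and C: "\<And>i n k. i < r \<Longrightarrow> k \<in> digit_vecs b n \<Longrightarrow>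
       norm (walsh_coeff b n (\<lambda>x. x ^ i) k) \<le> C i / real b ^ pos_sum (digit_supp k)"
    by metis
  \<comment> \<open>\<open>A\<close> collects the terms of lower degree. \<open>D\<close> satisfies
    A + D/2 \<le> D, and its summand 1 covers n = 0, where the coefficient of x^0 is 1.\<close>
  define A where "A = (\<Sum>i<r. real (r choose i) * C i * real b ^ r)"
  define D where "D = 2 * A + 1"
  have A0: "A \<ge> 0" unfolding A_def by (intro sum_nonneg) (use C0 in auto)
  have "norm (walsh_coeff b n (\<lambda>x. x ^ r) k) \<le> D / real b ^ pos_sum (digit_supp k)"
    if "k \<in> digit_vecs b n" for n k
    using that
  proof (induction n arbitrary: k)
    case 0
    then have "pos_sum (digit_supp k) = 0" by (simp add: digit_supp_def pos_sum_def)
    then show ?case using A0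
      by (cases "r = 0") (auto simp: zero_power walsh_coeff_def radix_val_def D_def walsh_def)
  next
    case (Suc n)
    note k' = comp_Suc_in_digit_vecs[OF Suc.prems]
    note card = card_digit_supp_Suc[OF finite_digit_supp[OF k']]
    note pos = pos_sum_digit_supp_Suc[OF finite_digit_supp[OF k']]
    have k0: "k 0 < b" using Suc.prems by (auto simp: digit_vecs_def)
    let ?k = "k \<circ> Suc" and ?c = "card (digit_supp k)"
    let ?P = "real b ^ pos_sum (digit_supp k)"
    have P: "?P > 0" using b by simp
    let ?t = "\<lambda>i. monom_step b r i (k 0) * walsh_coeff b n (\<lambda>x. x ^ i) ?k"
    consider "?c > r" | "?c \<le> r" by linarith
    then show ?case
    proof cases
      case 1
      then show ?thesis using walsh_coeff_monom_eq_0[OF b Suc.prems] A0 by (simp add: D_def)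
    next
      case 2
      have pw: "1 / real b ^ pos_sum (digit_supp ?k) = real b ^ ?c / ?P"
        using b by (simp add: pos power_add)
      have low: "norm (\<Sum>i<r. ?t i) \<le> A / ?P"
      proof -
        have "norm (?t i) \<le> real (r choose i) * C i * real b ^ r / ?P" if i: "i < r" for i
        proof -
          have "norm (?t i) \<le> real (r choose i) * (C i / real b ^ pos_sum (digit_supp ?k))"
            unfolding norm_mult using i C[OF i k'] norm_monom_step_le[OF b] C0[OF i]
            by (intro mult_mono) auto
          also have "\<dots> = real (r choose i) * C i * real b ^ ?c / ?P"
            using pw by (simp add: divide_inverse)
          also have "\<dots> \<le> real (r choose i) * C i * real b ^ r / ?P"
            using 2 b C0[OF i] by (intro divide_right_mono mult_left_mono power_increasing) auto
          finally show ?thesis .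
        qed
        then have "norm (\<Sum>i<r. ?t i) \<le> (\<Sum>i<r. real (r choose i) * C i * real b ^ r / ?P)"
          by (intro sum_norm_le) auto
        then show ?thesis by (simp add: A_def sum_divide_distrib)
      qed
      have top: "norm (?t r) \<le> (if k 0 = 0 then real b ^ ?c / real b ^ r * (D / ?P) else 0)"
      proof (cases "k 0 = 0")
        case True
        have "norm (?t r) = norm (walsh_coeff b n (\<lambda>x. x ^ r) ?k) / real b ^ r"
          using True monom_step_top[OF b k0, of r] by (simp add: norm_mult norm_divide norm_power)
        also have "\<dots> \<le> (D / real b ^ pos_sum (digit_supp ?k)) / real b ^ r"
          by (intro divide_right_mono Suc.IH[OF k']) simp
        also have "\<dots> = real b ^ ?c / real b ^ r * (D / ?P)"
          using pw by (simp add: divide_inverse mult_ac)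
        finally show ?thesis using True by simp
      qed (simp add: monom_step_top[OF b k0])
      have eq: "walsh_coeff b (Suc n) (\<lambda>x. x ^ r) k = (\<Sum>i<r. ?t i) + ?t r"
        unfolding walsh_coeff_monom_Suc[OF b] by (simp flip: lessThan_Suc_atMost)
      show ?thesis
      proof (cases "k 0 = 0 \<and> ?c = r")
        case True
        \<comment> \<open>Here b^(c - r) = 1 gains nothing, but the lower monomials vanish because
          all r nonzero digits are still there.\<close>
        have "?t i = 0" if "i < r" for i
          using walsh_coeff_monom_eq_0[OF b k', of i] card True that by simp
        then have "(\<Sum>i<r. ?t i) = 0" by (intro sum.neutral) auto
        then have "walsh_coeff b (Suc n) (\<lambda>x. x ^ r) k = ?t r" using eq by simp
        then show ?thesis using top True b by simp
      next
        case False
        \<comment> \<open>Either the leading digit is nonzero and the top term vanishes, or c < r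
          and b^(c - r) \<le> 1/2.\<close>
        have "norm (?t r) \<le> (D / 2) / ?P"
        proof (cases "k 0 = 0")
          case True
          with False 2 have "?c < r" by auto
          then have "real b ^ Suc ?c \<le> real b ^ r" using b by (intro power_increasing) auto
          moreover have "2 * real b ^ ?c \<le> real b ^ Suc ?c" using assms by simp
          ultimately have "2 * real b ^ ?c \<le> real b ^ r" by linarith
          then have "real b ^ ?c / real b ^ r \<le> 1 / 2" using b by (simp add: field_simps)
          then have "real b ^ ?c / real b ^ r * (D / ?P) \<le> 1 / 2 * (D / ?P)"
            using A0 P by (intro mult_right_mono) (auto simp: D_def)
          then show ?thesis using top True by simp
        next
          case False
          then have "norm (?t r) \<le> 0" using top by (simp only: if_False)
          also have "\<dots> \<le> (D / 2) / ?P" using A0 P by (simp add: D_def)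
          finally show ?thesis .
        qed
        then have "norm (walsh_coeff b (Suc n) (\<lambda>x. x ^ r) k) \<le> A / ?P + (D / 2) / ?P"
          unfolding eq by (intro norm_triangle_le add_mono low)
        also have "\<dots> \<le> D / ?P"
          unfolding add_divide_distrib[symmetric] using P by (intro divide_right_mono) (auto simp: D_def)
        finally show ?thesis .
      qed
    qed
  qed
  then show ?case using A0 by (intro exI[of _ D]) (auto simp: D_def)
qed

text \<open>Bivariate polynomials of total degree at most M, as functions generated by monomials, so
  that statements linear in the function reduce to single monomials by induction.\<close>

inductive bipoly :: "nat \<Rightarrow> (real \<Rightarrow> real \<Rightarrow> real) \<Rightarrow> bool" where
  bipoly_monom: "i + j \<le> M \<Longrightarrow> bipoly M (\<lambda>x y. c * x ^ i * y ^ j)"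
| bipoly_add: "bipoly M F \<Longrightarrow> bipoly M G \<Longrightarrow> bipoly M (\<lambda>x y. F x y + G x y)"

lemma bipoly_mono: "bipoly M F \<Longrightarrow> M \<le> N \<Longrightarrow> bipoly N F"
  by (induction rule: bipoly.induct) (auto intro: bipoly.intros)

lemma bipoly_const: "bipoly M (\<lambda>x y. c)"
  using bipoly_monom[of 0 0 M c] by simp

lemma bipoly_fst: "M \<ge> 1 \<Longrightarrow> bipoly M (\<lambda>x y. x)"
  using bipoly_monom[of 1 0 M 1] by simp

lemma bipoly_snd: "M \<ge> 1 \<Longrightarrow> bipoly M (\<lambda>x y. y)"
  using bipoly_monom[of 0 1 M 1] by simp

lemma bipoly_monom_mult:
  assumes "bipoly N G" "i + j \<le> M"
  shows "bipoly (M + N) (\<lambda>x y. (c * x ^ i * y ^ j) * G x y)"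
  using assms
proof (induction rule: bipoly.induct)
  case (bipoly_monom i' j' N d)
  then have "bipoly (M + N) (\<lambda>x y. (c * d) * x ^ (i + i') * y ^ (j + j'))"
    by (intro bipoly.bipoly_monom) auto
  then show ?case by (simp add: power_add mult_ac)
next
  case (bipoly_add N F G)
  then have "bipoly (M + N) (\<lambda>x y. (c * x ^ i * y ^ j) * F x y + (c * x ^ i * y ^ j) * G x y)"
    by (intro bipoly.bipoly_add) auto
  then show ?case by (simp add: distrib_left)
qed

lemma bipoly_mult:
  assumes "bipoly M F" "bipoly N G"
  shows "bipoly (M + N) (\<lambda>x y. F x y * G x y)"
  using assms
proof (induction rule: bipoly.induct)
  case (bipoly_monom i j M c)
  then show ?case by (intro bipoly_monom_mult)
next
  case (bipoly_add M F1 F2)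
  then have "bipoly (M + N) (\<lambda>x y. F1 x y * G x y + F2 x y * G x y)"
    by (intro bipoly.bipoly_add) auto
  then show ?case by (simp add: distrib_right)
qed

lemma bipoly_cmult: "bipoly M F \<Longrightarrow> bipoly M (\<lambda>x y. c * F x y)"
  using bipoly_mult[OF bipoly_const[of 0 c], of M F] by simp

lemma bipoly_diff: "bipoly M F \<Longrightarrow> bipoly M G \<Longrightarrow> bipoly M (\<lambda>x y. F x y - G x y)"
  using bipoly_add[of M F "\<lambda>x y. (-1) * G x y"] bipoly_cmult[of M G "-1"] by simp

lemma bipoly_power: "bipoly M F \<Longrightarrow> bipoly (M * r) (\<lambda>x y. F x y ^ r)"
proof (induction r)
  case (Suc r)
  then show ?case using bipoly_mult[of M F "M * r" "\<lambda>x y. F x y ^ r"] by simp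
qed (use bipoly_const[of 0 1] in simp)

lemma bipoly_sum:
  "(\<And>i. i \<in> I \<Longrightarrow> bipoly M (F i)) \<Longrightarrow> bipoly M (\<lambda>x y. \<Sum>i\<in>I. F i x y)"
proof (induction I rule: infinite_finite_induct)
  case (insert i I)
  then show ?case using bipoly_add[of M "F i" "\<lambda>x y. \<Sum>i\<in>I. F i x y"] by simp
qed (use bipoly_const[of M 0] in simp_all)

lemma walsh_coeff2_add:
  "walsh_coeff2 b n (\<lambda>x y. F x y + G x y) k l = walsh_coeff2 b n F k l + walsh_coeff2 b n G k l"
  by (simp add: walsh_coeff2_def distrib_right sum.distrib add_divide_distrib)

lemma walsh_coeff2_cmult:
  "walsh_coeff2 b n (\<lambda>x y. c * F x y) k l = of_real c * walsh_coeff2 b n F k l"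
  by (simp add: walsh_coeff2_def sum_distrib_left mult.assoc)

lemma walsh_coeff2_prod:
  "walsh_coeff2 b n (\<lambda>x y. F x * G y) k l = walsh_coeff b n F k * cnj (walsh_coeff b n G l)"
proof -
  have "walsh_coeff b n F k * cnj (walsh_coeff b n G l)
    = (\<Sum>a\<in>digit_vecs b n. \<Sum>c\<in>digit_vecs b n. (of_real (F (radix_val b n a)) * cnj (walsh b n k a)) *
         (of_real (G (radix_val b n c)) * walsh b n l c)) / (of_nat b ^ n * of_nat b ^ n)"
    by (simp add: walsh_coeff_def flip: sum_product)
  then show ?thesis
    by (simp add: walsh_coeff2_def mult_2_right power_add mult_ac)
qed

lemma walsh_coeff2_monom:
  "walsh_coeff2 b n (\<lambda>x y. c * x ^ i * y ^ j) k l
     = of_real c * walsh_coeff b n (\<lambda>x. x ^ i) k * cnj (walsh_coeff b n (\<lambda>x. x ^ j) l)"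
  using walsh_coeff2_cmult[of b n c "\<lambda>x y. x ^ i * y ^ j" k l]
    walsh_coeff2_prod[of b n "\<lambda>x. x ^ i" "\<lambda>x. x ^ j" k l]
  by (simp add: mult.assoc)

text \<open>In a monomial x^i y^j with i + j \<le> M one of the exponents is below the number of
  nonzero digits of its frequency.\<close>

lemma walsh_coeff2_bipoly_eq_0:
  assumes "bipoly M F" "b > 0" "k \<in> digit_vecs b n" "l \<in> digit_vecs b n"
    and "M < card (digit_supp k) + card (digit_supp l)"
  shows "walsh_coeff2 b n F k l = 0"
  using assms
proof (induction rule: bipoly.induct)
  case (bipoly_monom i j M c)
  then have "i < card (digit_supp k) \<or> j < card (digit_supp l)" by linarith
  then show ?case
    using bipoly_monom.prems walsh_coeff_monom_eq_0[of b k n i] walsh_coeff_monom_eq_0[of b l n j]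
    by (auto simp: walsh_coeff2_monom)
qed (simp add: walsh_coeff2_add)

lemma walsh_coeff2_bipoly_bound:
  assumes "bipoly M F" "b \<ge> 2"
  shows "\<exists>C\<ge>0. \<forall>n. \<forall>k\<in>digit_vecs b n. \<forall>l\<in>digit_vecs b n.
    norm (walsh_coeff2 b n F k l) \<le> C / real b ^ (pos_sum (digit_supp k) + pos_sum (digit_supp l))"
  using assms
proof (induction rule: bipoly.induct)
  case (bipoly_monom i j M c)
  obtain C1 where C1: "C1 \<ge> 0" "\<And>n k. k \<in> digit_vecs b n \<Longrightarrow>
    norm (walsh_coeff b n (\<lambda>x. x ^ i) k) \<le> C1 / real b ^ pos_sum (digit_supp k)"
    using walsh_coeff_monom_bound[OF \<open>b \<ge> 2\<close>, of i] by blast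
  obtain C2 where C2: "C2 \<ge> 0" "\<And>n k. k \<in> digit_vecs b n \<Longrightarrow>
    norm (walsh_coeff b n (\<lambda>x. x ^ j) k) \<le> C2 / real b ^ pos_sum (digit_supp k)"
    using walsh_coeff_monom_bound[OF \<open>b \<ge> 2\<close>, of j] by blast
  have "norm (walsh_coeff2 b n (\<lambda>x y. c * x ^ i * y ^ j) k l)
     \<le> \<bar>c\<bar> * C1 * C2 / real b ^ (pos_sum (digit_supp k) + pos_sum (digit_supp l))"
    if "k \<in> digit_vecs b n" "l \<in> digit_vecs b n" for n k l
  proof -
    have "norm (walsh_coeff2 b n (\<lambda>x y. c * x ^ i * y ^ j) k l)
      \<le> \<bar>c\<bar> * (C1 / real b ^ pos_sum (digit_supp k)) * (C2 / real b ^ pos_sum (digit_supp l))"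
      unfolding walsh_coeff2_monom norm_mult complex_mod_cnj
      using C1 C2 that by (intro mult_mono) auto
    then show ?thesis by (simp add: power_add)
  qed
  then show ?case using C1(1) C2(1) by (intro exI[of _ "\<bar>c\<bar> * C1 * C2"]) auto
next
  case (bipoly_add M F G)
  then obtain C1 C2 where C: "C1 \<ge> 0" "C2 \<ge> 0"
    "\<And>n k l. k\<in>digit_vecs b n \<Longrightarrow> l\<in>digit_vecs b n \<Longrightarrow>
    norm (walsh_coeff2 b n F k l) \<le> C1 / real b ^ (pos_sum (digit_supp k) + pos_sum (digit_supp l))"
    "\<And>n k l. k\<in>digit_vecs b n \<Longrightarrow> l\<in>digit_vecs b n \<Longrightarrow>
    norm (walsh_coeff2 b n G k l) \<le> C2 / real b ^ (pos_sum (digit_supp k) + pos_sum (digit_supp l))"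
    by blast
  then show ?case
    unfolding walsh_coeff2_add
    by (intro exI[of _ "C1 + C2"])
       (auto simp: add_divide_distrib intro!: norm_triangle_le add_mono)
qed

subsection \<open>Walsh coefficients of a kink along the diagonal\<close>

text \<open>Distinct integer parts differ by at least 1 while x and y lie in [0,1), so the sign of
  the difference is fixed and the absolute value can be resolved.\<close>

lemma kink_piece:
  fixes p q m :: nat
  assumes "p \<noteq> q"
  shows "\<exists>G. bipoly m G \<and> (\<forall>x\<in>{0..<1}. \<forall>y\<in>{0..<1}. \<bar>(real p + x) - (real q + y)\<bar> ^ m = G x y)"
proof -
  have *: "bipoly m (\<lambda>x y. (c + (x - y)) ^ m)" "bipoly m (\<lambda>x y. (c + (y - x)) ^ m)" for c
    using bipoly_power[OF bipoly_add[OF bipoly_const[of 1 c] bipoly_diff[OF bipoly_fst[of 1] bipoly_snd[of 1]]], of m]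
      bipoly_power[OF bipoly_add[OF bipoly_const[of 1 c] bipoly_diff[OF bipoly_snd[of 1] bipoly_fst[of 1]]], of m]
    by simp_all
  show ?thesis
  proof (cases "p > q")
    case True
    have "\<bar>(real p + x) - (real q + y)\<bar> ^ m = ((real p - real q) + (x - y)) ^ m"
      if "x \<in> {0..<1}" "y \<in> {0..<1}" for x y
    proof -
      have "real p \<ge> real q + 1" using True by linarith
      then have "\<bar>(real p + x) - (real q + y)\<bar> = (real p - real q) + (x - y)" using that by auto
      then show ?thesis by simp
    qed
    then show ?thesis using *(1) by blast
  next
    case False
    have "\<bar>(real p + x) - (real q + y)\<bar> ^ m = ((real q - real p) + (y - x)) ^ m"
      if "x \<in> {0..<1}" "y \<in> {0..<1}" for x y
    proof -
      have "real q \<ge> real p + 1" using False assms by linarith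
      then have "\<bar>(real p + x) - (real q + y)\<bar> = (real q - real p) + (y - x)" using that by auto
      then show ?thesis by simp
    qed
    then show ?thesis using *(2) by blast
  qed
qed

lemma walsh_coeff2_cong:
  assumes "b > 0" "\<And>x y. x \<in> {0..<1} \<Longrightarrow> y \<in> {0..<1} \<Longrightarrow> F x y = G x y"
  shows "walsh_coeff2 b n F k l = walsh_coeff2 b n G k l"
  unfolding walsh_coeff2_def using assms
  by (intro arg_cong2[where f = "(/)"] sum.cong refl) (auto simp: radix_val_nonneg radix_val_less_1)

definition kink :: "nat \<Rightarrow> real \<Rightarrow> real \<Rightarrow> real" where
  "kink m x y = \<bar>x - y\<bar> ^ m"

text \<open>
  If the leading digits of \<open>x\<close> and \<open>y\<close> differ, then \<open>\<bar>x - y\<bar>\<^sup>m\<close> is a polynomial in the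
  remaining digits; if they agree, it is a scaled copy of itself.
\<close>

lemma walsh_coeff2_kink_Suc:
  assumes "b > 0" "k 0 < b" "l 0 < b"
    and G: "\<And>p q x y. p \<noteq> q \<Longrightarrow> x \<in> {0..<1} \<Longrightarrow> y \<in> {0..<1} \<Longrightarrow>
              \<bar>(real p + x) - (real q + y)\<bar> ^ m = G p q x y"
  shows "walsh_coeff2 b (Suc n) (kink m) k l =
    (if k 0 = l 0 then walsh_coeff2 b n (kink m) (k \<circ> Suc) (l \<circ> Suc) / of_nat b ^ (m + 1) else 0)
    + (\<Sum>p<b. \<Sum>q\<in>{..<b} - {p}. cnj (root1 b ^ (k 0 * p)) * root1 b ^ (l 0 * q) / of_nat b ^ (m + 2)
        * walsh_coeff2 b n (G p q) (k \<circ> Suc) (l \<circ> Suc))"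
proof -
  let ?k = "k \<circ> Suc" and ?l = "l \<circ> Suc"
  let ?c = "\<lambda>p q. cnj (root1 b ^ (k 0 * p)) * root1 b ^ (l 0 * q) :: complex"
  define W where "W p q = (if p = q then walsh_coeff2 b n (kink m) ?k ?l else walsh_coeff2 b n (G p q) ?k ?l)" for p q
  have W: "walsh_coeff2 b n (\<lambda>x y. kink m ((real p + x) / real b) ((real q + y) / real b)) ?k ?l
     = W p q / of_nat b ^ m" for p q
  proof -
    have 1: "kink m ((real p + x) / real b) ((real q + y) / real b)
      = (1 / real b ^ m) * \<bar>(real p + x) - (real q + y)\<bar> ^ m" for x y
      using assms(1) by (simp add: kink_def power_divide flip: diff_divide_distrib)
    have "walsh_coeff2 b n (\<lambda>x y. \<bar>(real p + x) - (real q + y)\<bar> ^ m) ?k ?l = W p q"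
    proof (cases "p = q")
      case True
      then show ?thesis by (simp add: W_def kink_def[abs_def])
    next
      case False
      have "walsh_coeff2 b n (\<lambda>x y. \<bar>(real p + x) - (real q + y)\<bar> ^ m) ?k ?l = walsh_coeff2 b n (G p q) ?k ?l"
        by (rule walsh_coeff2_cong[OF assms(1)]) (rule G[OF False])
      then show ?thesis using False by (simp add: W_def)
    qed
    then show ?thesis
      unfolding 1 walsh_coeff2_cmult by simp
  qed
  have "walsh_coeff2 b (Suc n) (kink m) k l = (\<Sum>p<b. \<Sum>q<b. ?c p q / of_nat b ^ 2 * (W p q / of_nat b ^ m))"
    unfolding walsh_coeff2_Suc[OF assms(1)] W ..
  also have "\<dots> = (\<Sum>p<b. \<Sum>q<b. ?c p q / of_nat b ^ (m + 2) * W p q)"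
    by (simp add: power_add power2_eq_square mult_ac)
  also have "\<dots> = (\<Sum>p<b. ?c p p / of_nat b ^ (m + 2) * W p p + (\<Sum>q\<in>{..<b} - {p}. ?c p q / of_nat b ^ (m + 2) * W p q))"
    by (intro sum.cong refl sum.remove) auto
  also have "\<dots> = (\<Sum>p<b. ?c p p) / of_nat b ^ (m + 2) * walsh_coeff2 b n (kink m) ?k ?l
     + (\<Sum>p<b. \<Sum>q\<in>{..<b} - {p}. ?c p q / of_nat b ^ (m + 2) * walsh_coeff2 b n (G p q) ?k ?l)"
    unfolding sum.distrib
    by (intro arg_cong2[where f = "(+)"] sum.cong refl)
       (auto simp: W_def sum_divide_distrib sum_distrib_right)
  \<comment> \<open>The character sum over equal leading digits of the points is b or 0; the factor
    b turns b^(-(m + 2)) into b^(-(m + 1)).\<close>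
  also have "(\<Sum>p<b. ?c p p) / of_nat b ^ (m + 2) * walsh_coeff2 b n (kink m) ?k ?l
    = (if k 0 = l 0 then walsh_coeff2 b n (kink m) ?k ?l / of_nat b ^ (m + 1) else 0)"
    using assms(1) by (subst sum_root1_cross[OF assms(1-3)]) (simp add: power_add)
  finally show ?thesis .
qed

definition digit_diff :: "(nat \<Rightarrow> nat) \<Rightarrow> (nat \<Rightarrow> nat) \<Rightarrow> nat set" where
  "digit_diff k l = {i. k i \<noteq> l i}"

lemma digit_diff_Suc:
  "digit_diff k l = (if k 0 = l 0 then {} else {0}) \<union> Suc ` digit_diff (k \<circ> Suc) (l \<circ> Suc)"
proof -
  have "i \<in> digit_diff k l \<longleftrightarrow> i \<in> (if k 0 = l 0 then {} else {0}) \<union> Suc ` digit_diff (k \<circ> Suc) (l \<circ> Suc)" for i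
    by (cases i) (auto simp: digit_diff_def)
  then show ?thesis by blast
qed

lemma digit_diff_subset: "digit_diff k l \<subseteq> digit_supp k \<union> digit_supp l"
  by (auto simp: digit_diff_def digit_supp_def)

lemma finite_digit_diff:
  "k \<in> digit_vecs b n \<Longrightarrow> l \<in> digit_vecs b n \<Longrightarrow> finite (digit_diff k l)"
  by (rule finite_subset[OF digit_diff_subset]) (auto intro: finite_digit_supp)

lemma card_digit_diff_le:
  assumes "k \<in> digit_vecs b n" "l \<in> digit_vecs b n"
  shows "card (digit_diff k l) \<le> card (digit_supp k) + card (digit_supp l)"
proof -
  have "card (digit_diff k l) \<le> card (digit_supp k \<union> digit_supp l)"
    using assms by (intro card_mono digit_diff_subset) (auto intro: finite_digit_supp)
  then show ?thesis using card_Un_le[of "digit_supp k" "digit_supp l"] by linarith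
qed

lemma card_digit_diff_Suc:
  assumes "finite (digit_diff (k \<circ> Suc) (l \<circ> Suc))"
  shows "card (digit_diff k l) = (if k 0 = l 0 then 0 else 1) + card (digit_diff (k \<circ> Suc) (l \<circ> Suc))"
  using assms by (subst digit_diff_Suc) (auto simp: card_image)

text \<open>The self-similar term survives only for k 0 = l 0, and then the tails still differ in as
  many places. The other terms are polynomials of degree m; their coefficients vanish since tails
  that differ in more than m places have more than m nonzero digits together.\<close>

lemma walsh_coeff2_kink_eq_0:
  assumes "b > 0" "k \<in> digit_vecs b n" "l \<in> digit_vecs b n" "m + 1 < card (digit_diff k l)"
  shows "walsh_coeff2 b n (kink m) k l = 0"
  using assms(2-4)
proof (induction n arbitrary: k l)
  case 0
  then show ?case by (simp add: digit_diff_def)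
next
  case (Suc n)
  note k' = comp_Suc_in_digit_vecs[OF Suc.prems(1)] and l' = comp_Suc_in_digit_vecs[OF Suc.prems(2)]
  note card = card_digit_diff_Suc[OF finite_digit_diff[OF k' l']]
  have 0: "k 0 < b" "l 0 < b" using Suc.prems by (auto simp: digit_vecs_def)
  obtain G where G: "\<And>p q. p \<noteq> q \<Longrightarrow> bipoly m (G p q)"
    "\<And>p q x y. p \<noteq> q \<Longrightarrow> x \<in> {0..<1} \<Longrightarrow> y \<in> {0..<1} \<Longrightarrow> \<bar>(real p + x) - (real q + y)\<bar> ^ m = G p q x y"
    using kink_piece[of _ _ m] by metis
  have "m < card (digit_supp (k \<circ> Suc)) + card (digit_supp (l \<circ> Suc))"
    using card card_digit_diff_le[OF k' l'] Suc.prems(3) by (auto split: if_splits)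
  then have "walsh_coeff2 b n (G p q) (k \<circ> Suc) (l \<circ> Suc) = 0" if "p \<noteq> q" for p q
    using walsh_coeff2_bipoly_eq_0[OF G(1)[OF that] assms(1) k' l'] by blast
  then have "(\<Sum>p<b. \<Sum>q\<in>{..<b} - {p}. cnj (root1 b ^ (k 0 * p)) * root1 b ^ (l 0 * q) / of_nat b ^ (m + 2)
        * walsh_coeff2 b n (G p q) (k \<circ> Suc) (l \<circ> Suc)) = 0"
    by (intro sum.neutral ballI) auto
  moreover have "walsh_coeff2 b n (kink m) (k \<circ> Suc) (l \<circ> Suc) = 0" if "k 0 = l 0"
  proof -
    have "m + 1 < card (digit_diff (k \<circ> Suc) (l \<circ> Suc))" using card that Suc.prems(3) by simp
    then show ?thesis by (rule Suc.IH[OF k' l'])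
  qed
  ultimately show ?case
    using walsh_coeff2_kink_Suc[of b k l m G n, OF assms(1) 0 G(2)] by simp
qed

text \<open>Stripping a digit gains the fixed factor b^(-2\<alpha>), which covers a shift of at most
  \<alpha> positions in both arguments; hence the limit on \<open>card T\<close>. Arbitrary T
  instead of the top \<alpha> positions makes the statement stable under stripping.\<close>

lemma walsh_coeff2_kink_diag_bound:
  assumes "b \<ge> 2" "\<alpha> \<ge> 1"
  shows "\<exists>C\<ge>0. \<forall>n. \<forall>k\<in>digit_vecs b n. \<forall>T. T \<subseteq> digit_supp k \<longrightarrow> card T \<le> \<alpha> \<longrightarrow>
    norm (walsh_coeff2 b n (kink (2 * \<alpha> - 1)) k k) \<le> C / real b ^ (2 * pos_sum T)"
proof -
  define m where "m = 2 * \<alpha> - 1"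
  have b: "b > 0" using assms by simp
  obtain G where G: "\<And>p q. p \<noteq> q \<Longrightarrow> bipoly m (G p q)"
    "\<And>p q x y. p \<noteq> q \<Longrightarrow> x \<in> {0..<1} \<Longrightarrow> y \<in> {0..<1} \<Longrightarrow> \<bar>(real p + x) - (real q + y)\<bar> ^ m = G p q x y"
    using kink_piece[of _ _ m] by metis
  have "\<forall>p q. \<exists>C. p \<noteq> q \<longrightarrow> C \<ge> 0 \<and> (\<forall>n. \<forall>k\<in>digit_vecs b n. \<forall>l\<in>digit_vecs b n.
    norm (walsh_coeff2 b n (G p q) k l) \<le> C / real b ^ (pos_sum (digit_supp k) + pos_sum (digit_supp l)))"
    using walsh_coeff2_bipoly_bound[OF G(1) assms(1)] by meson
  then obtain C where C0: "\<And>p q. p \<noteq> q \<Longrightarrow> C p q \<ge> 0"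
    and C: "\<And>p q n k l. p \<noteq> q \<Longrightarrow> k \<in> digit_vecs b n \<Longrightarrow> l \<in> digit_vecs b n \<Longrightarrow>
       norm (walsh_coeff2 b n (G p q) k l) \<le> C p q / real b ^ (pos_sum (digit_supp k) + pos_sum (digit_supp l))"
    by metis
  define D where "D = (\<Sum>p<b. \<Sum>q\<in>{..<b} - {p}. C p q) * real b ^ (2 * \<alpha>)"
  have D0: "D \<ge> 0" unfolding D_def by (intro mult_nonneg_nonneg sum_nonneg) (auto intro!: C0)
  \<comment> \<open>For card T < \<alpha> the recursion contracts by 1/4, and 2D/4 + D \<le> 2D. For
    card T = \<alpha> it does not contract, but the remainder D enters at most once: only when 0
    \<in> T, and then the smaller set has fewer than \<alpha> elements.\<close>
  have "norm (walsh_coeff2 b n (kink m) k k) \<le> (if card T < \<alpha> then 2 * D else 3 * D) / real b ^ (2 * pos_sum T)"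
    if "k \<in> digit_vecs b n" "T \<subseteq> digit_supp k" "card T \<le> \<alpha>" for n k T
    using that
  proof (induction n arbitrary: k T)
    case 0
    then have "digit_supp k = {}" by (simp add: digit_supp_def)
    then show ?case using D0 0 assms
      by (auto simp: walsh_coeff2_def kink_def radix_val_def m_def zero_power pos_sum_def)
  next
    case (Suc n)
    note k' = comp_Suc_in_digit_vecs[OF Suc.prems(1)]
    let ?k = "k \<circ> Suc"
    define T' where "T' = {i. Suc i \<in> T}"
    have finS: "finite (digit_supp k)" "finite (digit_supp ?k)"
      using finite_digit_supp Suc.prems(1) k' by blast+
    have T'sub: "T' \<subseteq> digit_supp ?k" using Suc.prems(2) by (auto simp: T'_def digit_supp_def)
    have finT: "finite T" "finite T'" using Suc.prems(2) T'sub finS finite_subset by blast+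
    have T_eq: "T = (if 0 \<in> T then {0} else {}) \<union> Suc ` T'"
    proof -
      have "i \<in> T \<longleftrightarrow> i \<in> (if 0 \<in> T then {0} else {}) \<union> Suc ` T'" for i
        by (cases i) (auto simp: T'_def)
      then show ?thesis by blast
    qed
    have cardT: "card T = (if 0 \<in> T then 1 else 0) + card T'"
      using finT by (subst T_eq) (auto simp: card_image)
    have posT: "pos_sum T = pos_sum T' + card T"
    proof (cases "0 \<in> T")
      case True
      then have "T = insert 0 (Suc ` T')" using T_eq by auto
      then have "pos_sum T = Suc (pos_sum (Suc ` T'))" using finT by (simp add: pos_sum_insert_0)
      then show ?thesis using cardT True by (simp add: pos_sum_Suc_image)
    next
      case False
      then have "T = Suc ` T'" using T_eq by simp
      then have "pos_sum T = pos_sum (Suc ` T')" by simp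
      then show ?thesis using cardT False by (simp add: pos_sum_Suc_image)
    qed
    have k0: "k 0 < b" using Suc.prems by (auto simp: digit_vecs_def)
    let ?P = "real b ^ (2 * pos_sum T)"
    have P: "?P > 0" using b by simp
    define R where "R = (\<Sum>p<b. \<Sum>q\<in>{..<b} - {p}. cnj (root1 b ^ (k 0 * p)) * root1 b ^ (k 0 * q) / of_nat b ^ (m + 2)
        * walsh_coeff2 b n (G p q) ?k ?k)"
    define Z where "Z = walsh_coeff2 b n (kink m) ?k ?k"
    have step: "walsh_coeff2 b (Suc n) (kink m) k k = Z / of_nat b ^ (2 * \<alpha>) + R"
      using walsh_coeff2_kink_Suc[of b k k m G n, OF b k0 k0 G(2)] assms(2)
      by (simp add: R_def Z_def m_def)
    have R_bound: "norm R \<le> D / ?P"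
    proof -
      have "norm R \<le> (\<Sum>p<b. \<Sum>q\<in>{..<b} - {p}. C p q * real b ^ (2 * \<alpha>) / ?P)"
        unfolding R_def
      proof (intro sum_norm_le)
        fix p q assume "q \<in> {..<b} - {p}"
        then have pq: "p \<noteq> q" by auto
        have "norm (cnj (root1 b ^ (k 0 * p)) * root1 b ^ (k 0 * q) / of_nat b ^ (m + 2) * walsh_coeff2 b n (G p q) ?k ?k)
           = norm (walsh_coeff2 b n (G p q) ?k ?k) / real b ^ (m + 2)"
          unfolding norm_mult norm_divide complex_mod_cnj norm_root1_power by (simp add: norm_mult norm_power)
        also have "\<dots> \<le> norm (walsh_coeff2 b n (G p q) ?k ?k)"
        proof -
          have "1 \<le> real b ^ (m + 2)" using b by (intro one_le_power) auto
          then show ?thesis by (simp add: divide_le_eq mult_le_cancel_left1)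
        qed
        also have "\<dots> \<le> C p q / real b ^ (2 * pos_sum (digit_supp ?k))"
          using C[OF pq k' k'] by (simp add: mult_2)
        also have "\<dots> \<le> C p q / real b ^ (2 * pos_sum T')"
          using C0[OF pq] b pos_sum_mono[OF finS(2) T'sub]
          by (intro divide_left_mono power_increasing) auto
        also have "\<dots> = C p q * real b ^ (2 * card T) / ?P"
          using b by (simp add: posT power_add distrib_left)
        also have "\<dots> \<le> C p q * real b ^ (2 * \<alpha>) / ?P"
          using C0[OF pq] b Suc.prems(3) by (intro divide_right_mono mult_left_mono power_increasing) auto
        finally show "norm (cnj (root1 b ^ (k 0 * p)) * root1 b ^ (k 0 * q) / of_nat b ^ (m + 2) * walsh_coeff2 b n (G p q) ?k ?k)
           \<le> C p q * real b ^ (2 * \<alpha>) / ?P" .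
      qed
      also have "\<dots> = D / ?P" by (simp add: D_def sum_divide_distrib sum_distrib_right)
      finally show ?thesis .
    qed
    have T'_le: "card T' \<le> \<alpha>" using cardT Suc.prems(3) by simp
    have Z_bound: "norm (Z / of_nat b ^ (2 * \<alpha>)) \<le> (if card T' < \<alpha> then 2 * D else 3 * D) * (real b ^ (2 * card T) / real b ^ (2 * \<alpha>)) / ?P"
    proof -
      have "norm (Z / of_nat b ^ (2 * \<alpha>)) = norm Z / real b ^ (2 * \<alpha>)"
        by (simp add: norm_divide norm_power)
      also have "\<dots> \<le> ((if card T' < \<alpha> then 2 * D else 3 * D) / real b ^ (2 * pos_sum T')) / real b ^ (2 * \<alpha>)"
        unfolding Z_def by (intro divide_right_mono Suc.IH[OF k' T'sub T'_le]) simp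
      also have "\<dots> = (if card T' < \<alpha> then 2 * D else 3 * D) * (real b ^ (2 * card T) / real b ^ (2 * \<alpha>)) / ?P"
        using b by (simp add: posT power_add distrib_left)
      finally show ?thesis .
    qed
    show ?case
    proof (cases "card T < \<alpha>")
      case True
      then have "real b ^ (2 * card T + 2) \<le> real b ^ (2 * \<alpha>)" using b by (intro power_increasing) auto
      moreover have "4 * real b ^ (2 * card T) \<le> real b ^ (2 * card T + 2)"
      proof -
        have "(2::real) ^ 2 \<le> real b ^ 2" using assms by (intro power_mono) auto
        then have "4 * real b ^ (2 * card T) \<le> real b ^ 2 * real b ^ (2 * card T)"
          by (intro mult_right_mono) auto
        then show ?thesis by (simp only: power_add mult.commute)
      qed
      ultimately have "4 * real b ^ (2 * card T) \<le> real b ^ (2 * \<alpha>)" by linarith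
      then have "real b ^ (2 * card T) / real b ^ (2 * \<alpha>) \<le> 1 / 4" using b by (simp add: pos_divide_le_eq)
      then have "2 * D * (real b ^ (2 * card T) / real b ^ (2 * \<alpha>)) / ?P \<le> 2 * D * (1 / 4) / ?P"
        using D0 by (intro divide_right_mono mult_left_mono) auto
      with Z_bound True cardT have "norm (Z / of_nat b ^ (2 * \<alpha>)) \<le> 2 * D * (1 / 4) / ?P" by auto
      then have "norm (walsh_coeff2 b (Suc n) (kink m) k k) \<le> 2 * D * (1 / 4) / ?P + D / ?P"
        unfolding step using R_bound by (intro norm_triangle_le add_mono)
      also have "\<dots> \<le> 2 * D / ?P"
        unfolding add_divide_distrib[symmetric] using D0 by (intro divide_right_mono) auto
      finally show ?thesis using True by simp
    next
      case False
      then have cT: "card T = \<alpha>" using Suc.prems(3) by simp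
      then have one: "real b ^ (2 * card T) / real b ^ (2 * \<alpha>) = 1" using b by simp
      show ?thesis
      proof (cases "0 \<in> T")
        case True
        then have "norm (Z / of_nat b ^ (2 * \<alpha>)) \<le> 2 * D / ?P"
          using Z_bound cardT cT unfolding one by simp
        then have "norm (walsh_coeff2 b (Suc n) (kink m) k k) \<le> 2 * D / ?P + D / ?P"
          unfolding step using R_bound by (intro norm_triangle_le add_mono)
        then show ?thesis using False by (simp add: add_divide_distrib[symmetric])
      next
        case F: False
        then have cT': "card T' = \<alpha>" using cardT cT by simp
        \<comment> \<open>With all of T in the tail, both arguments together have at least 2\<alpha>
          > m nonzero digits, so the polynomial remainder vanishes.\<close>
        have "\<alpha> \<le> card (digit_supp ?k)"
          using card_mono[OF finS(2) T'sub] cT' by simp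
        then have "m < card (digit_supp ?k) + card (digit_supp ?k)" using assms by (simp add: m_def)
        then have "walsh_coeff2 b n (G p q) ?k ?k = 0" if "p \<noteq> q" for p q
          using walsh_coeff2_bipoly_eq_0[OF G(1)[OF that] b k' k'] by blast
        then have "R = 0" unfolding R_def by (intro sum.neutral ballI) auto
        then show ?thesis
          using Z_bound False cT' unfolding step one by simp
      qed
    qed
  qed
  note main = this
  have "norm (walsh_coeff2 b n (kink m) k k) \<le> 3 * D / real b ^ (2 * pos_sum T)"
    if "k \<in> digit_vecs b n" "T \<subseteq> digit_supp k" "card T \<le> \<alpha>" for n k T
  proof -
    have "(if card T < \<alpha> then 2 * D else 3 * D) / real b ^ (2 * pos_sum T) \<le> 3 * D / real b ^ (2 * pos_sum T)"
      using D0 by (intro divide_right_mono) auto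
    with main[OF that] show ?thesis by (rule order_trans)
  qed
  then show ?thesis
    using D0 unfolding m_def by (intro exI[of _ "3 * D"] conjI allI ballI impI) simp_all
qed

subsection \<open>The Sobolev kernel\<close>

lemma bernoulli_number_sum: "(\<Sum>k\<le>Suc n. real ((n + 2) choose k) * bernoulli_number k) = 0"
  by (simp add: field_simps)

text \<open>Coefficientwise this is the recurrence of the Bernoulli numbers; the initial value 1
  gives the coefficient of z.\<close>

lemma fps_bernoulli:
  "Abs_fps (\<lambda>n. bernoulli_number n / fact n) * (fps_exp 1 - 1) = (fps_X :: real fps)"
proof (rule fps_ext)
  fix n
  show "fps_nth (Abs_fps (\<lambda>n. bernoulli_number n / fact n) * (fps_exp 1 - 1)) n = fps_nth (fps_X :: real fps) n"
  proof (cases n)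
    case (Suc n')
    have eq: "fps_nth (Abs_fps (\<lambda>n. bernoulli_number n / fact n) * (fps_exp 1 - 1)) n
      = (\<Sum>k\<le>n'. real (n choose k) * bernoulli_number k) / fact n"
    proof -
      have "fps_nth (Abs_fps (\<lambda>n. bernoulli_number n / fact n) * (fps_exp 1 - 1)) n
        = (\<Sum>k=0..n'. bernoulli_number k / fact k * (1 / fact (n - k)))"
        unfolding fps_mult_nth Suc by (simp add: Suc_diff_le mult_ac)
      also have "\<dots> = (\<Sum>k\<le>n'. real (n choose k) * bernoulli_number k / fact n)"
        unfolding atLeast0AtMost
        by (intro sum.cong refl) (simp add: Suc binomial_fact divide_simps mult_ac)
      finally show ?thesis by (simp add: sum_divide_distrib)
    qed
    show ?thesis
    proof (cases n')
      case 0
      then show ?thesis using eq Suc by simp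
    next
      case (Suc m)
      then show ?thesis using eq \<open>n = Suc n'\<close> bernoulli_number_sum[of m] by simp
    qed
  qed simp
qed

text \<open>\<open>z / (e\<^sup>z - 1) + z / 2\<close> is an even power series.\<close>

lemma bernoulli_number_odd:
  assumes "odd n" "n \<ge> 2"
  shows "bernoulli_number n = 0"
proof -
  let ?B = "Abs_fps (\<lambda>n. bernoulli_number n / fact n) :: real fps"
  let ?c = "fps_const (-1) * fps_X :: real fps" and ?E = "fps_exp 1 :: real fps"
  \<comment> \<open>Substituting -z gives B(-z) (e^(-z) - 1) = -z. Multiplied by e^z this reads
    B(-z) (e^z - 1) = z e^z, that is B(-z) = B(z) + z.\<close>
  have "(?B * (?E - 1)) oo ?c = fps_X oo ?c" by (simp only: fps_bernoulli)
  then have "(?B oo ?c) * (fps_exp (-1) - 1) = - fps_X"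
    by (simp add: fps_compose_mult_distrib fps_compose_sub_distrib fps_exp_compose_linear)
  then have "(?B oo ?c) * (fps_exp (-1) - 1) * ?E = - fps_X * ?E" by (simp only:)
  then have "(?B oo ?c) * (fps_exp (-1) * ?E - ?E) = - fps_X * ?E"
    by (simp only: mult.assoc left_diff_distrib mult_1_left)
  moreover have "fps_exp (-1) * ?E = 1"
    by (simp flip: fps_exp_add_mult)
  ultimately have "(?B oo ?c) * (1 - ?E) = - fps_X * ?E" by simp
  then have "(?B oo ?c) * (?E - 1) = fps_X * ?E"
    by (simp only: minus_diff_eq[of 1 ?E, symmetric] mult_minus_right minus_mult_left[symmetric] minus_minus)
  also have "\<dots> = (fps_X + ?B) * (?E - 1)"
    using fps_bernoulli by (simp add: algebra_simps)
  finally have "(?B oo ?c) * (?E - 1) = (fps_X + ?B) * (?E - 1)" .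
  moreover have "?E - 1 \<noteq> 0"
  proof
    assume "?E - 1 = 0"
    then have "fps_nth (?E - 1) 1 = fps_nth 0 1" by (rule arg_cong)
    then show False by simp
  qed
  ultimately have "?B oo ?c = fps_X + ?B" by simp
  then have "fps_nth (?B oo ?c) n = fps_nth (fps_X + ?B) n" by simp
  then have "- bernoulli_number n / fact n = bernoulli_number n / fact n"
    using assms by (simp add: fps_compose_linear)
  then show ?thesis by simp
qed

text \<open>Odd powers of |u| belong to odd k, and among these only k = 1 has a nonzero Bernoulli
  number; the value -1/2 yields -\<alpha> |u|^(2\<alpha> - 1). In even powers the absolute value
  disappears.\<close>

lemma bernoulli_poly_even_abs:
  assumes "\<alpha> \<ge> 1"
  shows "bernoulli_poly (2 * \<alpha>) \<bar>u\<bar>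
    = (\<Sum>k\<in>{..2 * \<alpha>} - {1}. real (2 * \<alpha> choose k) * bernoulli_number k * u ^ (2 * \<alpha> - k))
      - real \<alpha> * \<bar>u\<bar> ^ (2 * \<alpha> - 1)"
proof -
  have "bernoulli_poly (2 * \<alpha>) \<bar>u\<bar> = real (2 * \<alpha> choose 1) * bernoulli_number 1 * \<bar>u\<bar> ^ (2 * \<alpha> - 1)
    + (\<Sum>k\<in>{..2 * \<alpha>} - {1}. real (2 * \<alpha> choose k) * bernoulli_number k * \<bar>u\<bar> ^ (2 * \<alpha> - k))"
    unfolding bernoulli_poly_def using assms by (intro sum.remove) auto
  moreover have "(\<Sum>k\<in>{..2 * \<alpha>} - {1}. real (2 * \<alpha> choose k) * bernoulli_number k * \<bar>u\<bar> ^ (2 * \<alpha> - k))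
    = (\<Sum>k\<in>{..2 * \<alpha>} - {1}. real (2 * \<alpha> choose k) * bernoulli_number k * u ^ (2 * \<alpha> - k))"
  proof (intro sum.cong refl)
    fix k assume k: "k \<in> {..2 * \<alpha>} - {1}"
    show "real (2 * \<alpha> choose k) * bernoulli_number k * \<bar>u\<bar> ^ (2 * \<alpha> - k) = real (2 * \<alpha> choose k) * bernoulli_number k * u ^ (2 * \<alpha> - k)"
    proof (cases "even k")
      case True
      then have "even (2 * \<alpha> - k)" using k by simp
      then show ?thesis by (simp add: power_even_abs)
    next
      case False
      then have "k \<ge> 2" using k by (cases k) auto
      then show ?thesis using False by (simp add: bernoulli_number_odd)
    qed
  qed
  moreover have "bernoulli_number 1 = - 1 / 2" by simp
  ultimately show ?thesis by (simp del: bernoulli_number.simps)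
qed

lemma bipoly_bernoulli_poly: "bipoly r (\<lambda>x y. bernoulli_poly r x)" "bipoly r (\<lambda>x y. bernoulli_poly r y)"
proof -
  have "bipoly r (\<lambda>x y. real (r choose k) * bernoulli_number k * x ^ (r - k) * y ^ 0)"
    "bipoly r (\<lambda>x y. real (r choose k) * bernoulli_number k * x ^ 0 * y ^ (r - k))" for k
    by (intro bipoly_monom; simp)+
  then show "bipoly r (\<lambda>x y. bernoulli_poly r x)" "bipoly r (\<lambda>x y. bernoulli_poly r y)"
    unfolding bernoulli_poly_def by (auto intro!: bipoly_sum)
qed

lemma sobolev_kernel_decomp:
  assumes "\<alpha> \<ge> 1"
  obtains Q c where "bipoly (2 * \<alpha>) Q"
    "\<And>x y. sobolev_kernel \<alpha> x y = Q x y + c * kink (2 * \<alpha> - 1) x y"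
proof -
  let ?d = "(-1) ^ (\<alpha> + 1) / fact (2 * \<alpha>) :: real"
  define Q where "Q x y = (\<Sum>r=0..\<alpha>. (1 / (fact r)\<^sup>2) * (bernoulli_poly r x * bernoulli_poly r y))
     + (\<Sum>k\<in>{..2 * \<alpha>} - {1}. (?d * (real (2 * \<alpha> choose k) * bernoulli_number k)) * (x - y) ^ (2 * \<alpha> - k))" for x y
  have 1: "bipoly (2 * \<alpha>) (\<lambda>x y. bernoulli_poly r x * bernoulli_poly r y)" if "r \<le> \<alpha>" for r
    using bipoly_mono[OF bipoly_mult[OF bipoly_bernoulli_poly[of r]], of "2 * \<alpha>"] that by simp
  have 2: "bipoly (2 * \<alpha>) (\<lambda>x y. (x - y) ^ (2 * \<alpha> - k))" for k
    using bipoly_mono[OF bipoly_power[OF bipoly_diff[OF bipoly_fst[of 1] bipoly_snd[of 1]], of "2 * \<alpha> - k"], of "2 * \<alpha>"] by simp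
  have "bipoly (2 * \<alpha>) Q"
    unfolding Q_def[abs_def]
    by (intro bipoly_add bipoly_sum bipoly_cmult 1 2) auto
  moreover have "sobolev_kernel \<alpha> x y = Q x y + (- ?d * real \<alpha>) * kink (2 * \<alpha> - 1) x y" for x y
    unfolding sobolev_kernel_def bernoulli_poly_even_abs[OF assms] Q_def kink_def
    by (simp add: right_diff_distrib add_divide_distrib diff_divide_distrib sum_distrib_left sum_divide_distrib mult.assoc)
  ultimately show ?thesis using that by blast
qed

text \<open>Both parts share the threshold 2\<alpha>: it is the degree bound of the polynomial part
  and one more than the exponent of the kink.\<close>

lemma walsh_coeff2_sobolev_kernel_eq_0:
  assumes "\<alpha> \<ge> 1" "b > 0" "k \<in> digit_vecs b n" "l \<in> digit_vecs b n" "2 * \<alpha> < card (digit_diff k l)"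
  shows "walsh_coeff2 b n (sobolev_kernel \<alpha>) k l = 0"
proof -
  obtain Q c where Q: "bipoly (2 * \<alpha>) Q"
    "\<And>x y. sobolev_kernel \<alpha> x y = Q x y + c * kink (2 * \<alpha> - 1) x y"
    using sobolev_kernel_decomp[OF assms(1)] by blast
  have "walsh_coeff2 b n (sobolev_kernel \<alpha>) k l = walsh_coeff2 b n (\<lambda>x y. Q x y + c * kink (2 * \<alpha> - 1) x y) k l"
    using Q(2) by presburger
  also have "\<dots> = 0"
    unfolding walsh_coeff2_add walsh_coeff2_cmult
    using walsh_coeff2_bipoly_eq_0[OF Q(1) assms(2-4)] walsh_coeff2_kink_eq_0[OF assms(2-4), of "2 * \<alpha> - 1"]
      card_digit_diff_le[OF assms(3,4)] assms(1,5) by simp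
  finally show ?thesis .
qed

lemma walsh_coeff2_sobolev_kernel_diag_bound:
  assumes "\<alpha> \<ge> 1" "b \<ge> 2"
  shows "\<exists>C\<ge>0. \<forall>n. \<forall>k\<in>digit_vecs b n. \<forall>T. T \<subseteq> digit_supp k \<longrightarrow> card T \<le> \<alpha> \<longrightarrow>
    norm (walsh_coeff2 b n (sobolev_kernel \<alpha>) k k) \<le> C / real b ^ (2 * pos_sum T)"
proof -
  obtain Q c where Q: "bipoly (2 * \<alpha>) Q"
    "\<And>x y. sobolev_kernel \<alpha> x y = Q x y + c * kink (2 * \<alpha> - 1) x y"
    using sobolev_kernel_decomp[OF assms(1)] by blast
  obtain C1 where C1: "C1 \<ge> 0" "\<And>n k l. k \<in> digit_vecs b n \<Longrightarrow> l \<in> digit_vecs b n \<Longrightarrow>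
    norm (walsh_coeff2 b n Q k l) \<le> C1 / real b ^ (pos_sum (digit_supp k) + pos_sum (digit_supp l))"
    using walsh_coeff2_bipoly_bound[OF Q(1) assms(2)] by blast
  obtain C2 where C2: "C2 \<ge> 0" "\<And>n k T. k \<in> digit_vecs b n \<Longrightarrow> T \<subseteq> digit_supp k \<Longrightarrow> card T \<le> \<alpha> \<Longrightarrow>
    norm (walsh_coeff2 b n (kink (2 * \<alpha> - 1)) k k) \<le> C2 / real b ^ (2 * pos_sum T)"
    using walsh_coeff2_kink_diag_bound[OF assms(2,1)] by blast
  have "norm (walsh_coeff2 b n (sobolev_kernel \<alpha>) k k) \<le> (C1 + \<bar>c\<bar> * C2) / real b ^ (2 * pos_sum T)"
    if k: "k \<in> digit_vecs b n" and T: "T \<subseteq> digit_supp k" "card T \<le> \<alpha>" for n k T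
  proof -
    have "walsh_coeff2 b n (sobolev_kernel \<alpha>) k k = walsh_coeff2 b n (\<lambda>x y. Q x y + c * kink (2 * \<alpha> - 1) x y) k k"
      using Q(2) by presburger
    then have "norm (walsh_coeff2 b n (sobolev_kernel \<alpha>) k k)
      \<le> norm (walsh_coeff2 b n Q k k) + \<bar>c\<bar> * norm (walsh_coeff2 b n (kink (2 * \<alpha> - 1)) k k)"
      unfolding walsh_coeff2_add walsh_coeff2_cmult
      by (metis norm_triangle_ineq norm_mult norm_of_real)
    moreover have "norm (walsh_coeff2 b n Q k k) \<le> C1 / real b ^ (2 * pos_sum (digit_supp k))"
      using C1(2)[OF k k] by (simp add: mult_2)
    moreover have "C1 / real b ^ (2 * pos_sum (digit_supp k)) \<le> C1 / real b ^ (2 * pos_sum T)"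
      using C1(1) assms(2) pos_sum_mono[OF finite_digit_supp[OF k] T(1)]
      by (intro divide_left_mono power_increasing) auto
    moreover have "\<bar>c\<bar> * norm (walsh_coeff2 b n (kink (2 * \<alpha> - 1)) k k) \<le> \<bar>c\<bar> * (C2 / real b ^ (2 * pos_sum T))"
      by (intro mult_left_mono C2(2) k T) auto
    ultimately show ?thesis by (simp add: add_divide_distrib)
  qed
  then show ?thesis using C1(1) C2(1) by (intro exI[of _ "C1 + \<bar>c\<bar> * C2"]) auto
qed

section \<open>Boundedness and Lipschitz continuity of the kernel\<close>

lemma bipoly_bounded_lipschitz:
  "bipoly M F \<Longrightarrow> \<exists>L\<ge>0. \<forall>x\<in>{0..<1}. \<forall>y\<in>{0..<1}. \<bar>F x y\<bar> \<le> L \<and> (\<forall>y'\<in>{0..<1}. \<bar>F x y - F x y'\<bar> \<le> L * \<bar>y - y'\<bar>)"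
proof (induction rule: bipoly.induct)
  case (bipoly_monom i j M c)
  \<comment> \<open>\<open>Suc j\<close> rather than j lets one constant bound both the value and
    the Lipschitz quotient, also for j = 0.\<close>
  have "\<bar>c * x ^ i * y ^ j\<bar> \<le> \<bar>c\<bar> * real (Suc j)"
    "\<bar>c * x ^ i * y ^ j - c * x ^ i * y' ^ j\<bar> \<le> \<bar>c\<bar> * real (Suc j) * \<bar>y - y'\<bar>"
    if "x \<in> {0..<1}" "y \<in> {0..<1}" "y' \<in> {0..<1}" for x y y' :: real
  proof -
    have pw: "\<bar>x ^ i\<bar> \<le> 1" "\<bar>y ^ j\<bar> \<le> 1" using that by (auto simp: power_le_one)
    have "\<bar>x ^ i\<bar> * \<bar>y ^ j\<bar> \<le> 1 * real (Suc j)"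
      using pw by (intro mult_mono) auto
    then have "\<bar>c\<bar> * (\<bar>x ^ i\<bar> * \<bar>y ^ j\<bar>) \<le> \<bar>c\<bar> * (1 * real (Suc j))"
      by (intro mult_left_mono) auto
    then show "\<bar>c * x ^ i * y ^ j\<bar> \<le> \<bar>c\<bar> * real (Suc j)" by (simp add: abs_mult mult.assoc)
    have "\<bar>y ^ j - y' ^ j\<bar> \<le> real j * \<bar>y - y'\<bar>"
      using norm_power_diff[of y y' j] that by simp
    also have "\<dots> \<le> real (Suc j) * \<bar>y - y'\<bar>" by (intro mult_right_mono) auto
    finally have "\<bar>x ^ i\<bar> * \<bar>y ^ j - y' ^ j\<bar> \<le> 1 * (real (Suc j) * \<bar>y - y'\<bar>)"
      using pw by (intro mult_mono) auto
    then have "\<bar>c\<bar> * (\<bar>x ^ i\<bar> * \<bar>y ^ j - y' ^ j\<bar>) \<le> \<bar>c\<bar> * (1 * (real (Suc j) * \<bar>y - y'\<bar>))"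
      by (intro mult_left_mono) auto
    then show "\<bar>c * x ^ i * y ^ j - c * x ^ i * y' ^ j\<bar> \<le> \<bar>c\<bar> * real (Suc j) * \<bar>y - y'\<bar>"
      by (simp add: abs_mult mult.assoc flip: right_diff_distrib)
  qed
  then show ?case by (intro exI[of _ "\<bar>c\<bar> * real (Suc j)"]) auto
next
  case (bipoly_add M F G)
  then obtain L1 L2 where L: "L1 \<ge> 0" "L2 \<ge> 0"
    "\<forall>x\<in>{0..<1}. \<forall>y\<in>{0..<1}. \<bar>F x y\<bar> \<le> L1 \<and> (\<forall>y'\<in>{0..<1}. \<bar>F x y - F x y'\<bar> \<le> L1 * \<bar>y - y'\<bar>)"
    "\<forall>x\<in>{0..<1}. \<forall>y\<in>{0..<1}. \<bar>G x y\<bar> \<le> L2 \<and> (\<forall>y'\<in>{0..<1}. \<bar>G x y - G x y'\<bar> \<le> L2 * \<bar>y - y'\<bar>)"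
    by blast
  have "\<bar>F x y + G x y\<bar> \<le> L1 + L2"
    "\<bar>F x y + G x y - (F x y' + G x y')\<bar> \<le> (L1 + L2) * \<bar>y - y'\<bar>"
    if "x \<in> {0..<1}" "y \<in> {0..<1}" "y' \<in> {0..<1}" for x y y' :: real
  proof -
    have *: "\<bar>F x y\<bar> \<le> L1" "\<bar>G x y\<bar> \<le> L2" "\<bar>F x y - F x y'\<bar> \<le> L1 * \<bar>y - y'\<bar>" "\<bar>G x y - G x y'\<bar> \<le> L2 * \<bar>y - y'\<bar>"
      using L that by auto
    show "\<bar>F x y + G x y\<bar> \<le> L1 + L2" using * by linarith
    show "\<bar>F x y + G x y - (F x y' + G x y')\<bar> \<le> (L1 + L2) * \<bar>y - y'\<bar>"
      using *(3,4) unfolding distrib_right by linarith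
  qed
  then show ?case using L(1,2) by (intro exI[of _ "L1 + L2"]) auto
qed

lemma sobolev_kernel_bounded_lipschitz:
  assumes "\<alpha> \<ge> 1"
  shows "\<exists>L\<ge>1. \<forall>x\<in>{0..<1}. \<forall>y\<in>{0..<1}. \<bar>sobolev_kernel \<alpha> x y\<bar> \<le> L \<and>
    (\<forall>y'\<in>{0..<1}. \<bar>sobolev_kernel \<alpha> x y - sobolev_kernel \<alpha> x y'\<bar> \<le> L * \<bar>y - y'\<bar>)"
proof -
  define m where "m = 2 * \<alpha> - 1"
  obtain Q c where Q: "bipoly (2 * \<alpha>) Q"
    "\<And>x y. sobolev_kernel \<alpha> x y = Q x y + c * kink m x y"
    using sobolev_kernel_decomp[OF assms] unfolding m_def by blast
  obtain L where L: "L \<ge> 0"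
    "\<forall>x\<in>{0..<1}. \<forall>y\<in>{0..<1}. \<bar>Q x y\<bar> \<le> L \<and> (\<forall>y'\<in>{0..<1}. \<bar>Q x y - Q x y'\<bar> \<le> L * \<bar>y - y'\<bar>)"
    using bipoly_bounded_lipschitz[OF Q(1)] by blast
  let ?L = "1 + L + \<bar>c\<bar> * real (Suc m)"
  have "\<bar>sobolev_kernel \<alpha> x y\<bar> \<le> ?L"
    "\<bar>sobolev_kernel \<alpha> x y - sobolev_kernel \<alpha> x y'\<bar> \<le> ?L * \<bar>y - y'\<bar>"
    if xy: "x \<in> {0..<1}" "y \<in> {0..<1}" "y' \<in> {0..<1}" for x y y' :: real
  proof -
    have d: "\<bar>x - y\<bar> \<le> 1" "\<bar>x - y'\<bar> \<le> 1" using xy by auto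
    have *: "\<bar>Q x y\<bar> \<le> L" "\<bar>Q x y - Q x y'\<bar> \<le> L * \<bar>y - y'\<bar>" using L xy by auto
    have "\<bar>kink m x y\<bar> \<le> real (Suc m)"
      using power_le_one[of "\<bar>x - y\<bar>" m] d by (simp add: kink_def)
    then have k1: "\<bar>c * kink m x y\<bar> \<le> \<bar>c\<bar> * real (Suc m)"
      unfolding abs_mult by (intro mult_left_mono) auto
    have "\<bar>kink m x y - kink m x y'\<bar> \<le> real m * \<bar>\<bar>x - y\<bar> - \<bar>x - y'\<bar>\<bar>"
      using norm_power_diff[of "\<bar>x - y\<bar>" "\<bar>x - y'\<bar>" m] d by (simp add: kink_def)
    also have "\<dots> \<le> real (Suc m) * \<bar>y - y'\<bar>"
      by (intro mult_mono) auto
    finally have "\<bar>c\<bar> * \<bar>kink m x y - kink m x y'\<bar> \<le> \<bar>c\<bar> * (real (Suc m) * \<bar>y - y'\<bar>)"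
      by (intro mult_left_mono) auto
    then have k2: "\<bar>c * kink m x y - c * kink m x y'\<bar> \<le> \<bar>c\<bar> * real (Suc m) * \<bar>y - y'\<bar>"
      by (simp add: abs_mult mult.assoc flip: right_diff_distrib)
    show "\<bar>sobolev_kernel \<alpha> x y\<bar> \<le> ?L" unfolding Q(2) using *(1) k1 by linarith
    have "\<bar>sobolev_kernel \<alpha> x y - sobolev_kernel \<alpha> x y'\<bar> \<le> L * \<bar>y - y'\<bar> + \<bar>c\<bar> * real (Suc m) * \<bar>y - y'\<bar>"
      unfolding Q(2) using *(2) k2 by linarith
    also have "\<dots> \<le> ?L * \<bar>y - y'\<bar>" by (simp add: distrib_right)
    finally show "\<bar>sobolev_kernel \<alpha> x y - sobolev_kernel \<alpha> x y'\<bar> \<le> ?L * \<bar>y - y'\<bar>" .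
  qed
  then show ?thesis using L(1) by (intro exI[of _ ?L]) auto
qed

subsection \<open>Duality for the interlaced Chen--Skriganov matrices\<close>

text \<open>The i-th coefficient of f(X + a) is the i-th Hasse derivative of f at a. On monomials
  these derivatives are the binomial entries of the Chen--Skriganov matrices, so the rows are
  interpolation functionals.\<close>

lemma coeff_pcompose_shift:
  fixes f :: "'a::comm_ring_1 poly"
  assumes "degree f < m"
  shows "coeff (f \<circ>\<^sub>p [:a, 1:]) i = (\<Sum>v<m. coeff f v * of_nat (v choose i) * a ^ (v - i))"
proof -
  have lin: "coeff ([:a, 1:] ^ v) i = of_nat (v choose i) * a ^ (v - i)" for v
  proof (cases "i \<le> v")
    case True
    then show ?thesis by (simp add: coeff_linear_poly_power)
  next
    case False
    have "degree ([:a, 1:] ^ v) \<le> v"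
      using degree_power_le[of "[:a, 1:]" v] by (auto intro: order_trans)
    with False show ?thesis by (simp add: coeff_eq_0 binomial_eq_0)
  qed
  have "f \<circ>\<^sub>p [:a, 1:] = (\<Sum>v\<le>degree f. smult (coeff f v) ([:a, 1:] ^ v))"
    by (simp add: pcompose_altdef poly_altdef coeff_map_poly degree_map_poly)
  then have "coeff (f \<circ>\<^sub>p [:a, 1:]) i = (\<Sum>v\<le>degree f. coeff f v * of_nat (v choose i) * a ^ (v - i))"
    by (simp add: coeff_sum lin mult.assoc)
  also have "\<dots> = (\<Sum>v<m. coeff f v * of_nat (v choose i) * a ^ (v - i))"
    using assms by (intro sum.mono_neutral_left) (auto simp: coeff_eq_0)
  finally show ?thesis .
qed

lemma pcompose_power: "(p ^ n) \<circ>\<^sub>p q = (p \<circ>\<^sub>p q) ^ n" for p :: "'a::comm_ring_1 poly"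
  by (induction n) (simp_all add: pcompose_mult pcompose_1)

text \<open>The shift by a turns (X - a)^d into X^d, so the derivatives at a of order below d
  vanish.\<close>

lemma coeff_pcompose_root_power:
  fixes g :: "'a::comm_ring_1 poly"
  shows "coeff (([:-a, 1:] ^ d * g) \<circ>\<^sub>p [:a, 1:]) i = (if i < d then 0 else coeff (g \<circ>\<^sub>p [:a, 1:]) (i - d))"
proof -
  have "[:-a, 1:] \<circ>\<^sub>p [:a, 1:] = [:0, 1:]" by (simp add: pcompose_pCons)
  then have "([:-a, 1:] ^ d * g) \<circ>\<^sub>p [:a, 1:] = monom 1 d * (g \<circ>\<^sub>p [:a, 1:])"
    by (simp add: pcompose_mult pcompose_power monom_altdef)
  then show ?thesis by (simp add: coeff_monom_mult)
qed

text \<open>Hermite interpolation modulo a prime, in dual form.\<close>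

lemma hermite_functionals_independent:
  fixes a :: "'q \<Rightarrow> int" and c :: "'q \<Rightarrow> nat \<Rightarrow> int" and d :: "'q \<Rightarrow> nat" and b :: nat
  assumes "prime b" "finite Q"
    and distinct: "\<And>q q'. q \<in> Q \<Longrightarrow> q' \<in> Q \<Longrightarrow> q \<noteq> q' \<Longrightarrow> \<not> int b dvd a q - a q'"
    and dual: "\<And>v. v < m \<Longrightarrow> int b dvd (\<Sum>q\<in>Q. \<Sum>i<w. c q i * (int (v choose i) * a q ^ (v - i)))"
    and supp: "\<And>q i. q \<in> Q \<Longrightarrow> i < w \<Longrightarrow> d q \<le> i \<Longrightarrow> int b dvd c q i"
    and card: "(\<Sum>q\<in>Q. d q) \<le> m"
    and "q0 \<in> Q" "i1 < w"
  shows "int b dvd c q0 i1"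
proof (rule ccontr)
  assume nd: "\<not> int b dvd c q0 i1"
  let ?S = "{i. i < w \<and> \<not> int b dvd c q0 i}"
  define i0 where "i0 = Max ?S"
  have "finite ?S" "?S \<noteq> {}" using nd \<open>i1 < w\<close> by auto
  then have i0: "i0 < w" "\<not> int b dvd c q0 i0" and i0_max: "\<And>i. i < w \<Longrightarrow> i0 < i \<Longrightarrow> int b dvd c q0 i"
    using Max_in[of ?S] Max_ge[of ?S] unfolding i0_def[symmetric] by (auto simp: not_le[symmetric])
  have i0_less: "i0 < d q0" using supp[OF \<open>q0 \<in> Q\<close> i0(1)] i0(2) by (meson not_le)
  \<comment> \<open>The test polynomial \<open>f\<close> vanishes to order \<open>d q\<close> at
    every other node and to order \<open>i0\<close> at \<open>a q0\<close>. At \<open>a q0\<close>,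
    orders below \<open>i0\<close> give 0 and orders above it have coefficients divisible by b, so
    the single term of order \<open>i0\<close> is left modulo b.\<close>
  define g where "g = (\<Prod>q\<in>Q - {q0}. [:- a q, 1:] ^ d q)"
  define f where "f = [:- a q0, 1:] ^ i0 * g"
  have "degree g \<le> (\<Sum>q\<in>Q - {q0}. d q)"
    unfolding g_def using assms(2)
    by (intro order_trans[OF degree_prod_sum_le] sum_mono) (auto simp: degree_linear_power)
  moreover have "degree ([:- a q0, 1:] ^ i0) \<le> i0"
    by (rule order_trans[OF degree_power_le]) simp
  moreover have "(\<Sum>q\<in>Q. d q) = d q0 + (\<Sum>q\<in>Q - {q0}. d q)"
    using assms(2) \<open>q0 \<in> Q\<close> by (rule sum.remove)
  ultimately have deg: "degree f < m"
    unfolding f_def using degree_mult_le[of "[:- a q0, 1:] ^ i0" g] i0_less card by linarith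
  define H where "H q i = coeff (f \<circ>\<^sub>p [:a q, 1:]) i" for q i
  have "int b dvd (\<Sum>v<m. coeff f v * (\<Sum>q\<in>Q. \<Sum>i<w. c q i * (int (v choose i) * a q ^ (v - i))))"
    by (intro dvd_sum dvd_mult dual) auto
  also have "(\<Sum>v<m. coeff f v * (\<Sum>q\<in>Q. \<Sum>i<w. c q i * (int (v choose i) * a q ^ (v - i))))
     = (\<Sum>q\<in>Q. \<Sum>i<w. c q i * H q i)"
    unfolding H_def coeff_pcompose_shift[OF deg] sum_distrib_left
    by (subst sum.swap, rule sum.cong[OF refl], subst sum.swap) (simp add: mult_ac)
  also have "\<dots> = (\<Sum>i<w. c q0 i * H q0 i) + (\<Sum>q\<in>Q - {q0}. \<Sum>i<w. c q i * H q i)"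
    using assms(2) \<open>q0 \<in> Q\<close> by (rule sum.remove)
  also have "(\<Sum>i<w. c q0 i * H q0 i) = c q0 i0 * H q0 i0 + (\<Sum>i\<in>{..<w} - {i0}. c q0 i * H q0 i)"
    using i0(1) by (intro sum.remove) auto
  finally have sum_dvd: "int b dvd c q0 i0 * H q0 i0 + (\<Sum>i\<in>{..<w} - {i0}. c q0 i * H q0 i)
      + (\<Sum>q\<in>Q - {q0}. \<Sum>i<w. c q i * H q i)" .
  have "int b dvd (\<Sum>i\<in>{..<w} - {i0}. c q0 i * H q0 i)"
  proof (rule dvd_sum)
    fix i assume i: "i \<in> {..<w} - {i0}"
    show "int b dvd c q0 i * H q0 i"
    proof (cases "i < i0")
      case True
      then show ?thesis by (simp add: H_def f_def coeff_pcompose_root_power)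
    next
      case False
      then show ?thesis using i0_max[of i] i by auto
    qed
  qed
  moreover have "int b dvd (\<Sum>q\<in>Q - {q0}. \<Sum>i<w. c q i * H q i)"
  proof (intro dvd_sum)
    fix q i assume q: "q \<in> Q - {q0}" and i: "i \<in> {..<w}"
    show "int b dvd c q i * H q i"
    proof (cases "i < d q")
      case True
      have "f = [:- a q, 1:] ^ d q * ([:- a q0, 1:] ^ i0 * (\<Prod>q\<in>Q - {q0} - {q}. [:- a q, 1:] ^ d q))"
        unfolding f_def g_def using assms(2) q by (subst prod.remove[of _ q]) (auto simp: mult_ac)
      then have "H q i = 0" unfolding H_def using True by (simp add: coeff_pcompose_root_power)
      then show ?thesis by simp
    next
      case False
      then show ?thesis using supp[of q i] q i by auto
    qed
  qed
  ultimately have "int b dvd c q0 i0 * H q0 i0"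
    using sum_dvd by (simp add: dvd_add_left_iff)
  moreover have "prime (int b)" using assms(1) by simp
  ultimately have "int b dvd H q0 i0"
    using i0(2) by (simp add: prime_dvd_mult_iff)
  \<comment> \<open>The surviving derivative is the value of \<open>g\<close> at
    \<open>a q0\<close>, a product of powers of node differences.\<close>
  moreover have "H q0 i0 = (\<Prod>q\<in>Q - {q0}. (a q0 - a q) ^ d q)"
    by (simp add: H_def f_def coeff_pcompose_root_power coeff_pcompose_0 g_def poly_prod)
  ultimately have "\<exists>q\<in>Q - {q0}. int b dvd (a q0 - a q) ^ d q"
    using \<open>prime (int b)\<close> assms(2) by (simp add: prime_dvd_prod_iff)
  then obtain q where "q \<in> Q - {q0}" "int b dvd a q0 - a q"
    using \<open>prime (int b)\<close> prime_dvd_power by blast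
  then show False using distinct[of q0 q] \<open>q0 \<in> Q\<close> by auto
qed

lemma sum_lessThan_times:
  "(\<Sum>p<a * c. F p) = (\<Sum>h<a. \<Sum>i<c. F (c * h + i))" for a c :: nat
proof -
  have "(\<Sum>h<a. \<Sum>i<c. F (c * h + i)) = (\<Sum>x\<in>{..<a} \<times> {..<c}. F (c * fst x + snd x))"
    by (simp add: sum.cartesian_product case_prod_beta)
  also have "\<dots> = (\<Sum>p<a * c. F p)"
  proof (rule sum.reindex_bij_witness[of _ "\<lambda>p. (p div c, p mod c)" "\<lambda>x. c * fst x + snd x"])
    fix x assume x: "x \<in> {..<a} \<times> {..<c}"
    then have "c * fst x + snd x < c * fst x + c" by auto
    also have "\<dots> = c * (fst x + 1)" by simp
    also have "\<dots> \<le> c * a" using x by (intro mult_le_mono) auto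
    finally show "c * fst x + snd x \<in> {..<a * c}" by (simp add: mult.commute)
  next
    fix p assume "p \<in> {..<a * c}"
    then have "p < a * c" by simp
    moreover from this have "c > 0" by (cases c) auto
    ultimately show "(p div c, p mod c) \<in> {..<a} \<times> {..<c}"
      by (auto simp: less_mult_imp_div_less)
  qed auto
  finally show ?thesis by simp
qed

section \<open>Digit positions, interpolation nodes and the dual net\<close>

context
  fixes b s \<beta> g w :: nat and B :: "nat \<Rightarrow> nat \<Rightarrow> nat"
  assumes b: "prime b"
    and B_less: "\<And>j l. j \<in> {1..\<beta> * s} \<Longrightarrow> l \<in> {1..g} \<Longrightarrow> B j l < b"
    and B_inj: "inj_on (\<lambda>(j, l). B j l) ({1..\<beta> * s} \<times> {1..g})"
begin

text \<open>Zero-based position, within one coordinate, of the row of derivative order i at node l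
  of interlaced component r: a node occupies w consecutive rows, which interlacing spreads by the
  factor \<beta>.\<close>

definition net_pos :: "nat \<Rightarrow> nat \<Rightarrow> nat \<Rightarrow> nat" where
  "net_pos r l i = \<beta> * (w * l + i) + r"

abbreviation net_matrix :: "nat \<Rightarrow> nat \<Rightarrow> nat \<Rightarrow> nat" where
  "net_matrix \<equiv> interlace \<beta> (chen_skriganov_matrix b w B)"

lemma net_matrix_entry:
  assumes "r < \<beta>" "i < w"
  shows "net_matrix j (Suc (net_pos r l i)) (Suc v) = (v choose i) * B (\<beta> * (j - 1) + r + 1) (l + 1) ^ (v - i) mod b"
  using interlace_row[of "Suc r" \<beta> "Suc (w * l + i)" "chen_skriganov_matrix b w B" j] assms
    chen_skriganov_matrix_entry[of "Suc i" w "Suc l" b B "\<beta> * (j - 1) + r + 1" "Suc v"]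
  by (simp add: net_pos_def mult.commute)

lemma sum_positions:
  "(\<Sum>p<\<beta> * g * w. F p) = (\<Sum>r<\<beta>. \<Sum>l<g. \<Sum>i<w. F (net_pos r l i))"
proof -
  have "(\<Sum>p<\<beta> * g * w. F p) = (\<Sum>p<(g * w) * \<beta>. F p)" by (simp add: mult_ac)
  also have "\<dots> = (\<Sum>l<g. \<Sum>i<w. \<Sum>r<\<beta>. F (net_pos r l i))"
    unfolding sum_lessThan_times net_pos_def ..
  also have "\<dots> = (\<Sum>l<g. \<Sum>r<\<beta>. \<Sum>i<w. F (net_pos r l i))"
    by (intro sum.cong refl sum.swap)
  also have "\<dots> = (\<Sum>r<\<beta>. \<Sum>l<g. \<Sum>i<w. F (net_pos r l i))"
    by (rule sum.swap)
  finally show ?thesis .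
qed

lemma position_decomp:
  assumes "p < \<beta> * g * w"
  obtains r l i where "r < \<beta>" "l < g" "i < w" "p = net_pos r l i"
proof
  have pos: "\<beta> > 0" "w > 0" using assms by (auto intro!: gr0I)
  show "p mod \<beta> < \<beta>" "p div \<beta> mod w < w" using pos by auto
  have "p div \<beta> < g * w" using assms pos by (simp add: less_mult_imp_div_less mult_ac)
  then show "p div \<beta> div w < g" by (simp add: less_mult_imp_div_less)
  show "p = net_pos (p mod \<beta>) (p div \<beta> div w) (p div \<beta> mod w)"
    by (simp add: net_pos_def)
qed

lemma net_pos_less:
  assumes "r < \<beta>" "l < g" "i < w"
  shows "net_pos r l i < \<beta> * g * w"
proof -
  have "w * l + i < w * (l + 1)" using assms by simp
  also have "\<dots> \<le> w * g" using assms by (intro mult_le_mono) auto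
  finally have "w * l + i + 1 \<le> w * g" by simp
  then have "\<beta> * (w * l + i + 1) \<le> \<beta> * (w * g)" by (rule mult_le_mono2)
  then show ?thesis using assms by (simp add: net_pos_def mult_ac)
qed

lemma net_pos_inj:
  assumes "r < \<beta>" "r' < \<beta>" "i < w" "i' < w" "net_pos r l i = net_pos r' l' i'"
  shows "r = r'" "l = l'" "i = i'"
proof -
  have "net_pos r l i mod \<beta> = r" "net_pos r' l' i' mod \<beta> = r'"
    "net_pos r l i div \<beta> = w * l + i" "net_pos r' l' i' div \<beta> = w * l' + i'"
    using assms(1-4) by (auto simp: net_pos_def)
  then have "r = r'" and *: "w * l + i = w * l' + i'" using assms(5) by metis+
  then show "r = r'" by simp
  have "(w * l + i) div w = l" "(w * l' + i') div w = l'" "(w * l + i) mod w = i" "(w * l' + i') mod w = i'"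
    using assms by auto
  then show "l = l'" "i = i'" using * by auto
qed

text \<open>Each (j, r, l) is a node carrying the functionals of order i < w. By \<open>down\<close>
  the orders allowed at a node form an initial segment, so its length can serve as the multiplicity
  in Hermite interpolation; the multiplicities add up to at most \<open>card U\<close>.\<close>

lemma dual_functional_eq_0:
  fixes c :: "nat \<Rightarrow> nat \<Rightarrow> int"
  assumes dual: "\<And>v. v \<in> {1..g * w} \<Longrightarrow>
      int b dvd (\<Sum>j=1..s. \<Sum>p<\<beta> * g * w. c j p * int (net_matrix j (Suc p) v))"
    and supp: "\<And>j p. j \<in> {1..s} \<Longrightarrow> p < \<beta> * g * w \<Longrightarrow> (j, p) \<notin> U \<Longrightarrow> int b dvd c j p"
    and down: "\<And>j r l i i'. r < \<beta> \<Longrightarrow> l < g \<Longrightarrow> i < w \<Longrightarrow> i' < i \<Longrightarrow> (j, net_pos r l i) \<in> U \<Longrightarrow> (j, net_pos r l i') \<in> U"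
    and U: "finite U" "card U \<le> g * w"
    and "j0 \<in> {1..s}" "p0 < \<beta> * g * w"
  shows "int b dvd c j0 p0"
proof -
  define Q where "Q = {1..s} \<times> {..<\<beta>} \<times> {..<g}"
  define a where "a = (\<lambda>(j, r, l). int (B (\<beta> * (j - 1) + r + 1) (l + 1)))"
  define c' where "c' = (\<lambda>(j, r, l) i. c j (net_pos r l i))"
  define d where "d = (\<lambda>(j, r, l). card {i. i < w \<and> (j, net_pos r l i) \<in> U})"
  have idx: "\<beta> * (j - 1) + r + 1 \<in> {1..\<beta> * s}" if "j \<in> {1..s}" "r < \<beta>" for j r
  proof -
    have "\<beta> * (j - 1) + r + 1 \<le> \<beta> * (j - 1) + \<beta>" using that by simp
    also have "\<dots> = \<beta> * j" using that by (cases j) auto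
    also have "\<dots> \<le> \<beta> * s" using that by simp
    finally show ?thesis by simp
  qed
  have distinct: "\<not> int b dvd a q - a q'" if "q \<in> Q" "q' \<in> Q" "q \<noteq> q'" for q q'
  proof
    assume dvd: "int b dvd a q - a q'"
    obtain j r l where q: "q = (j, r, l)" by (cases q)
    obtain j' r' l' where q': "q' = (j', r', l')" by (cases q')
    let ?J = "\<beta> * (j - 1) + r + 1" and ?J' = "\<beta> * (j' - 1) + r' + 1"
    have in1: "?J \<in> {1..\<beta> * s}" "l + 1 \<in> {1..g}" "?J' \<in> {1..\<beta> * s}" "l' + 1 \<in> {1..g}"
      using idx[of j r] idx[of j' r'] that by (auto simp: Q_def q q')
    have "B ?J (l + 1) < b" "B ?J' (l' + 1) < b"
      by (rule B_less[OF in1(1,2)], rule B_less[OF in1(3,4)])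
    moreover have "int (B ?J (l + 1)) mod int b = int (B ?J' (l' + 1)) mod int b"
      using dvd by (simp add: a_def q q' mod_eq_dvd_iff)
    ultimately have "B ?J (l + 1) = B ?J' (l' + 1)" by simp
    then have eq: "(?J, l + 1) = (?J', l' + 1)"
      using inj_onD[OF B_inj, of "(?J, l + 1)" "(?J', l' + 1)"] in1 by auto
    have "r < \<beta>" "r' < \<beta>" "j \<ge> 1" "j' \<ge> 1" using that by (auto simp: Q_def q q')
    have e: "\<beta> * (j - 1) + r = \<beta> * (j' - 1) + r'" using eq by simp
    have "(\<beta> * (j - 1) + r) mod \<beta> = r" "(\<beta> * (j' - 1) + r') mod \<beta> = r'"
      "(\<beta> * (j - 1) + r) div \<beta> = j - 1" "(\<beta> * (j' - 1) + r') div \<beta> = j' - 1"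
      using \<open>r < \<beta>\<close> \<open>r' < \<beta>\<close> by auto
    with e have "r = r'" "j - 1 = j' - 1" by auto
    then have "j = j'" using \<open>j \<ge> 1\<close> \<open>j' \<ge> 1\<close> by simp
    with \<open>r = r'\<close> eq that(3) q q' show False by simp
  qed
  have dual': "int b dvd (\<Sum>q\<in>Q. \<Sum>i<w. c' q i * (int (v choose i) * a q ^ (v - i)))" if v: "v < g * w" for v
  proof -
    have "(\<Sum>j=1..s. \<Sum>p<\<beta> * g * w. c j p * int (net_matrix j (Suc p) (Suc v)))
      = (\<Sum>q\<in>Q. \<Sum>i<w. c' q i * ((int (v choose i) * a q ^ (v - i)) mod int b))"
      unfolding sum_positions Q_def sum.cartesian_product'
      by (intro sum.cong refl) (simp add: net_matrix_entry c'_def a_def zmod_int)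
    then have "int b dvd (\<Sum>q\<in>Q. \<Sum>i<w. c' q i * ((int (v choose i) * a q ^ (v - i)) mod int b))"
      using dual[of "Suc v"] v by simp
    \<comment> \<open>Matrix entries are reduced modulo b; undoing the reduction changes the sum by
      a multiple of b.\<close>
    moreover have "int b dvd (\<Sum>q\<in>Q. \<Sum>i<w. c' q i * (int (v choose i) * a q ^ (v - i)))
      - (\<Sum>q\<in>Q. \<Sum>i<w. c' q i * ((int (v choose i) * a q ^ (v - i)) mod int b))"
      unfolding sum_subtractf[symmetric] right_diff_distrib[symmetric]
      by (intro dvd_sum dvd_mult dvd_minus_mod)
    ultimately show ?thesis by (simp add: dvd_diff_right_iff dvd_diff_left_iff)
  qed
  have supp': "int b dvd c' q i" if "q \<in> Q" "i < w" "d q \<le> i" for q i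
  proof -
    obtain j r l where q: "q = (j, r, l)" by (cases q)
    have jrl: "j \<in> {1..s}" "r < \<beta>" "l < g" using that(1) by (auto simp: Q_def q)
    have "(j, net_pos r l i) \<notin> U"
    proof
      assume inU: "(j, net_pos r l i) \<in> U"
      have "{..i} \<subseteq> {i. i < w \<and> (j, net_pos r l i) \<in> U}"
      proof
        fix i' assume "i' \<in> {..i}"
        then show "i' \<in> {i. i < w \<and> (j, net_pos r l i) \<in> U}"
          using down[OF jrl(2,3) that(2) _ inU, of i'] inU that(2) by (cases "i' = i") auto
      qed
      then have "card {..i} \<le> d q" unfolding d_def q prod.case by (intro card_mono) auto
      then show False using that(3) by simp
    qed
    then show ?thesis using supp[OF jrl(1) net_pos_less[OF jrl(2,3) that(2)]] by (simp add: c'_def q)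
  qed
  have card': "(\<Sum>q\<in>Q. d q) \<le> g * w"
  proof -
    let ?X = "SIGMA q:Q. {i. i < w \<and> (case q of (j, r, l) \<Rightarrow> (j, net_pos r l i) \<in> U)}"
    let ?h = "\<lambda>(q, i). case q of (j, r, l) \<Rightarrow> (j, net_pos r l i)"
    have "(\<Sum>q\<in>Q. d q) = card ?X"
      by (subst card_SigmaI) (auto simp: Q_def d_def intro!: sum.cong)
    also have "\<dots> = card (?h ` ?X)"
    proof (rule card_image[symmetric], rule inj_onI)
      fix x y assume xy: "x \<in> ?X" "y \<in> ?X" "?h x = ?h y"
      obtain j r l i where x: "x = ((j, r, l), i)" by (metis prod.exhaust)
      obtain j' r' l' i' where y: "y = ((j', r', l'), i')" by (metis prod.exhaust)
      have "r < \<beta>" "r' < \<beta>" "i < w" "i' < w" "net_pos r l i = net_pos r' l' i'" "j = j'"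
        using xy unfolding x y by (auto simp: Q_def)
      then show "x = y" using net_pos_inj[of r r' i i' l l'] by (simp add: x y)
    qed
    also have "\<dots> \<le> card U" by (intro card_mono U) auto
    finally show ?thesis using U by simp
  qed
  obtain r l i where rli: "r < \<beta>" "l < g" "i < w" "p0 = net_pos r l i"
    using position_decomp[OF \<open>p0 < _\<close>] by blast
  have "int b dvd c' (j0, r, l) i"
    using rli assms(6)
    by (intro hermite_functionals_independent[OF b _ distinct dual' supp' card', of "(j0, r, l)" i]) (auto simp: Q_def)
  then show ?thesis by (simp add: c'_def rli)
qed

text \<open>These are the frequencies whose Walsh sum over the net does not vanish, by
  \<open>multi_walsh_net\<close>.\<close>

definition dual_net :: "(nat \<Rightarrow> nat \<Rightarrow> nat) set" where
  "dual_net = {\<kappa> \<in> {1..s} \<rightarrow>\<^sub>E digit_vecs b (\<beta> * g * w).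
     \<forall>v\<in>{1..g * w}. b dvd (\<Sum>j=1..s. \<Sum>p<\<beta> * g * w. \<kappa> j p * net_matrix j (Suc p) v)}"

text \<open>Digit vectors are not closed under subtraction, so digitwise differences are taken as
  integers. Once divisible by b they are zero, since digits lie in {0..<b}.\<close>

lemma dual_net_separation:
  assumes "\<kappa> \<in> dual_net" "\<mu> \<in> dual_net"
    and supp: "\<And>j p. j \<in> {1..s} \<Longrightarrow> \<kappa> j p \<noteq> \<mu> j p \<Longrightarrow> (j, p) \<in> U"
    and down: "\<And>j r l i i'. r < \<beta> \<Longrightarrow> l < g \<Longrightarrow> i < w \<Longrightarrow> i' < i \<Longrightarrow> (j, net_pos r l i) \<in> U \<Longrightarrow> (j, net_pos r l i') \<in> U"
    and U: "finite U" "card U \<le> g * w"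
  shows "\<kappa> = \<mu>"
proof -
  define c where "c j p = int (\<kappa> j p) - int (\<mu> j p)" for j p
  have vecs: "\<kappa> j \<in> digit_vecs b (\<beta> * g * w)" "\<mu> j \<in> digit_vecs b (\<beta> * g * w)" if "j \<in> {1..s}" for j
    using assms(1,2) that by (auto simp: dual_net_def)
  have dual: "int b dvd (\<Sum>j=1..s. \<Sum>p<\<beta> * g * w. c j p * int (net_matrix j (Suc p) v))" if "v \<in> {1..g * w}" for v
  proof -
    have "int b dvd int (\<Sum>j=1..s. \<Sum>p<\<beta> * g * w. \<kappa> j p * net_matrix j (Suc p) v)"
      "int b dvd int (\<Sum>j=1..s. \<Sum>p<\<beta> * g * w. \<mu> j p * net_matrix j (Suc p) v)"
      unfolding int_dvd_int_iff using assms(1,2) that by (auto simp: dual_net_def)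
    then have "int b dvd int (\<Sum>j=1..s. \<Sum>p<\<beta> * g * w. \<kappa> j p * net_matrix j (Suc p) v) - int (\<Sum>j=1..s. \<Sum>p<\<beta> * g * w. \<mu> j p * net_matrix j (Suc p) v)"
      by (rule dvd_diff)
    then show ?thesis by (simp add: c_def left_diff_distrib sum_subtractf)
  qed
  have "\<kappa> j p = \<mu> j p" if j: "j \<in> {1..s}" for j p
  proof (cases "p < \<beta> * g * w")
    case True
    have "int b dvd c j p"
    proof (rule dual_functional_eq_0[OF dual _ down U j True])
      fix j p assume "j \<in> {1..s}" "(j, p) \<notin> U"
      then have "\<kappa> j p = \<mu> j p" using supp by blast
      then show "int b dvd c j p" by (simp add: c_def)
    qed
    then have "int (\<kappa> j p) mod int b = int (\<mu> j p) mod int b"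
      by (simp add: c_def mod_eq_dvd_iff)
    moreover have "\<kappa> j p < b" "\<mu> j p < b" using vecs[OF j] True by (auto simp: digit_vecs_def)
    ultimately show ?thesis by simp
  next
    case False
    then show ?thesis using vecs[OF j] by (auto simp: digit_vecs_def)
  qed
  then show ?thesis
    using assms(1,2) by (intro PiE_ext[of \<kappa> "{1..s}" _ \<mu>]) (auto simp: dual_net_def)
qed

text \<open>
  Every derivative functional at a node that occurs is allowed here, so what counts is only
  the number of nodes, that is, of blocks of positions.
\<close>

lemma dual_net_hamming:
  assumes "\<kappa> \<in> dual_net" "\<mu> \<in> dual_net"
    and "(\<Sum>j=1..s. card {p. \<kappa> j p \<noteq> \<mu> j p}) \<le> g"
  shows "\<kappa> = \<mu>"
proof -
  let ?n = "\<beta> * g * w"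
  define E where "E = (SIGMA j:{1..s}. {p. \<kappa> j p \<noteq> \<mu> j p})"
  define blk where "blk = (\<lambda>(j::nat, p). (j, p mod \<beta>, p div \<beta> div w))"
  \<comment> \<open>\<open>U\<close> fills up every block that contains a differing position. At
    most g blocks of w positions give \<open>card U\<close> \<le> g w, and whole blocks are closed
    downwards.\<close>
  define U where "U = {(j, p) |j p. p < ?n \<and> blk (j, p) \<in> blk ` E}"
  have sub: "{p. \<kappa> j p \<noteq> \<mu> j p} \<subseteq> {..<?n}" if "j \<in> {1..s}" for j
  proof -
    have "\<kappa> j \<in> digit_vecs b ?n" "\<mu> j \<in> digit_vecs b ?n"
      using assms(1,2) that by (auto simp: dual_net_def)
    then have "p < ?n" if "\<kappa> j p \<noteq> \<mu> j p" for p
      using that unfolding digit_vecs_def by (cases "p < ?n") auto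
    then show ?thesis by auto
  qed
  have fin_diff: "finite {p. \<kappa> j p \<noteq> \<mu> j p}" if "j \<in> {1..s}" for j
    using finite_subset[OF sub[OF that]] by simp
  have finE: "finite E" unfolding E_def
    using fin_diff by (intro finite_SigmaI) auto
  have "card E = (\<Sum>j=1..s. card {p. \<kappa> j p \<noteq> \<mu> j p})"
    unfolding E_def using fin_diff by (intro card_SigmaI) auto
  then have cardE: "card (blk ` E) \<le> g" using assms(3) card_image_le[OF finE, of blk] by simp
  have "U \<subseteq> (\<lambda>((j, r, l), i). (j, net_pos r l i)) ` (blk ` E \<times> {..<w})"
  proof
    fix x assume "x \<in> U"
    then obtain j p where x: "x = (j, p)" and p: "p < ?n" "blk (j, p) \<in> blk ` E"
      by (auto simp: U_def)
    obtain r l i where rli: "r < \<beta>" "l < g" "i < w" "p = net_pos r l i"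
      using position_decomp[OF p(1)] by blast
    then have "blk (j, p) = (j, r, l)" by (simp add: blk_def net_pos_def)
    with p(2) rli show "x \<in> (\<lambda>((j, r, l), i). (j, net_pos r l i)) ` (blk ` E \<times> {..<w})"
      by (intro image_eqI[of _ _ "((j, r, l), i)"]) (auto simp: x)
  qed
  moreover have fin: "finite (blk ` E \<times> {..<w})" using finE by simp
  ultimately have finU: "finite U" and "card U \<le> card (blk ` E \<times> {..<w})"
    by (auto intro: finite_subset surj_card_le)
  then have cardU: "card U \<le> g * w"
    using cardE by (auto simp: card_cartesian_product intro: order_trans mult_le_mono1)
  show ?thesis
  proof (rule dual_net_separation[OF assms(1,2) _ _ finU cardU])
    fix j p assume "j \<in> {1..s}" "\<kappa> j p \<noteq> \<mu> j p"
    then show "(j, p) \<in> U" using sub[of j] by (auto simp: U_def E_def)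
  next
    fix j r l i i' assume *: "r < \<beta>" "l < g" "i < w" "i' < i" "(j, net_pos r l i) \<in> U"
    have "blk (j, net_pos r l i') = blk (j, net_pos r l i)"
      using * by (simp add: blk_def net_pos_def)
    then show "(j, net_pos r l i') \<in> U"
      using * net_pos_less[of r l i'] by (auto simp: U_def)
  qed
qed

text \<open>Rows of consecutive orders at one node lie \<beta> positions apart, so closure under
  subtracting \<beta> yields closure in the order.\<close>

lemma dual_net_box:
  assumes "\<kappa> \<in> dual_net" "\<mu> \<in> dual_net"
    and supp: "\<And>j p. j \<in> {1..s} \<Longrightarrow> \<kappa> j p \<noteq> \<mu> j p \<Longrightarrow> (j, p) \<in> U"
    and down: "\<And>j p. (j, p + \<beta>) \<in> U \<Longrightarrow> (j, p) \<in> U"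
    and U: "finite U" "card U \<le> g * w"
  shows "\<kappa> = \<mu>"
proof (rule dual_net_separation[OF assms(1,2) supp _ U])
  fix j r l i i' assume *: "i' < i" "(j, net_pos r l i) \<in> U"
  have step: "(j, net_pos r l i') \<in> U" if "(j, net_pos r l (Suc i')) \<in> U" for i'
    using down[of j "net_pos r l i'"] that by (simp add: net_pos_def algebra_simps)
  from *(1) have "i' \<le> i" by simp
  then show "(j, net_pos r l i') \<in> U"
    using *(2) by (induction i' rule: inc_induct) (auto intro: step)
qed

end

subsection \<open>Summation over the dual net\<close>

text \<open>
  \<open>T\<close> consists of the \<open>\<alpha>\<close> largest elements of \<open>S\<close> (all of \<open>S\<close> if there are fewer), and
  \<open>A\<close> is the \<open>\<alpha>\<close>-th largest position counted from 1, or 0 if there is none.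
\<close>

definition is_top_part :: "nat \<Rightarrow> nat set \<Rightarrow> nat set \<Rightarrow> nat \<Rightarrow> bool" where
  "is_top_part \<alpha> S T A \<longleftrightarrow> T \<subseteq> S
     \<and> (card T = \<alpha> \<and> A \<in> Suc ` S \<or> card T < \<alpha> \<and> A = 0)
     \<and> (\<forall>p\<in>T. A \<le> Suc p) \<and> (\<forall>p\<in>S - T. Suc p < A)"

text \<open>While more than \<alpha> elements are left, the least one is removed; it lies strictly
  below the \<alpha>-th largest of the rest.\<close>

lemma top_part_exists:
  assumes "finite S" "\<alpha> \<ge> 1"
  shows "\<exists>T A. is_top_part \<alpha> S T A"
  using assms(1)
proof (induction "card S" arbitrary: S rule: less_induct)
  case less
  consider "card S < \<alpha>" | "card S = \<alpha>" | "card S > \<alpha>" by linarith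
  then show ?case
  proof cases
    case 1
    then have "is_top_part \<alpha> S S 0" by (auto simp: is_top_part_def)
    then show ?thesis by blast
  next
    case 2
    then have "S \<noteq> {}" using assms(2) by auto
    then have "is_top_part \<alpha> S S (Suc (Min S))" using 2 less.prems by (auto simp: is_top_part_def)
    then show ?thesis by blast
  next
    case 3
    then have ne: "S \<noteq> {}" by auto
    let ?S = "S - {Min S}"
    have "Min S \<in> S" using ne less.prems by (rule Min_in[rotated])
    then have "card ?S < card S" using less.prems by (intro card_Diff1_less)
    then obtain T A where TA: "is_top_part \<alpha> ?S T A" using less.hyps[of ?S] less.prems by blast
    have cardS: "card ?S = card S - 1" using \<open>Min S \<in> S\<close> by (rule card_Diff_singleton)
    have "A \<noteq> 0"
    proof
      assume "A = 0"
      then have "T = ?S" "card T < \<alpha>" using TA by (auto simp: is_top_part_def)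
      then show False using cardS 3 by simp
    qed
    then have A: "card T = \<alpha>" "A \<in> Suc ` ?S" using TA by (auto simp: is_top_part_def)
    then obtain p where p: "A = Suc p" "p \<in> S" "p \<noteq> Min S" by auto
    then have "Min S \<le> p" using less.prems by simp
    then have "Suc (Min S) < A" using p by simp
    then have "is_top_part \<alpha> S T A" using TA A by (auto simp: is_top_part_def)
    then show ?thesis by blast
  qed
qed

text \<open>Either card T = \<alpha> or A = 0, so \<open>card T * A\<close> equals \<alpha> A in
  both cases.\<close>

lemma pos_sum_top_part:
  assumes "is_top_part \<alpha> S T A"
  shows "pos_sum T = \<alpha> * A + (\<Sum>p\<in>T. Suc p - A)"
proof -
  have "pos_sum T = (\<Sum>p\<in>T. A + (Suc p - A))"
    unfolding pos_sum_def using assms by (intro sum.cong) (auto simp: is_top_part_def)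
  also have "\<dots> = card T * A + (\<Sum>p\<in>T. Suc p - A)" by (simp add: sum.distrib)
  finally show ?thesis using assms by (auto simp: is_top_part_def)
qed

lemma exists_sum_le:
  fixes a :: "'a \<Rightarrow> nat"
  assumes "finite J" "k \<le> sum a J"
  shows "\<exists>a'. (\<forall>j. a' j \<le> a j) \<and> sum a' J = k"
  using assms
proof (induction J arbitrary: k)
  case empty
  then show ?case by (intro exI[of _ "\<lambda>_. 0"]) auto
next
  case (insert x J)
  show ?case
  proof (cases "k \<le> sum a J")
    case True
    then obtain a' where "\<forall>j. a' j \<le> a j" "sum a' J = k" using insert.IH by blast
    moreover have "sum (a'(x := 0)) J = sum a' J" using insert by (intro sum.cong) auto
    ultimately show ?thesis using insert by (intro exI[of _ "a'(x := 0)"]) auto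
  next
    case False
    have "sum (a(x := k - sum a J)) J = sum a J" using insert by (intro sum.cong) auto
    then show ?thesis using False insert by (intro exI[of _ "a(x := k - sum a J)"]) auto
  qed
qed

lemma sum_power_le_2:
  fixes x :: real
  assumes "0 \<le> x" "x \<le> 1 / 2"
  shows "(\<Sum>i<n. x ^ i) \<le> 2"
proof -
  have "(\<Sum>i<n. x ^ i) \<le> (\<Sum>i. x ^ i)"
    using assms by (intro sum_le_suminf summable_geometric) auto
  also have "\<dots> = 1 / (1 - x)" using assms by (intro suminf_geometric) auto
  also have "\<dots> \<le> 2" using assms by (simp add: divide_simps)
  finally show ?thesis .
qed

text \<open>With truncated subtraction (t - m) + (m - t) is the distance |t - m|; either side of m
  is a geometric series of sum at most 2.\<close>

lemma sum_power_dist_le_4: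
  fixes x :: real
  assumes "0 \<le> x" "x \<le> 1 / 2"
  shows "(\<Sum>t<M. x ^ ((t - m) + (m - t))) \<le> 4"
proof -
  have "(\<Sum>t<M. x ^ ((t - m) + (m - t))) \<le> (\<Sum>t\<in>{..<m} \<union> {m..<m + M}. x ^ ((t - m) + (m - t)))"
    using assms by (intro sum_mono2) auto
  also have "\<dots> = (\<Sum>t<m. x ^ ((t - m) + (m - t))) + (\<Sum>t=m..<m + M. x ^ ((t - m) + (m - t)))"
    by (intro sum.union_disjoint) auto
  also have "(\<Sum>t<m. x ^ ((t - m) + (m - t))) = (\<Sum>i<m. x ^ Suc i)"
    by (rule sum.reindex_bij_witness[of _ "\<lambda>i. m - Suc i" "\<lambda>t. m - Suc t"]) (auto simp: Suc_diff_Suc)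
  also have "\<dots> = x * (\<Sum>i<m. x ^ i)" by (simp add: sum_distrib_left)
  also have "(\<Sum>t=m..<m + M. x ^ ((t - m) + (m - t))) = (\<Sum>i<M. x ^ i)"
    by (rule sum.reindex_bij_witness[of _ "\<lambda>i. i + m" "\<lambda>t. t - m"]) auto
  finally have "(\<Sum>t<M. x ^ ((t - m) + (m - t))) \<le> x * (\<Sum>i<m. x ^ i) + (\<Sum>i<M. x ^ i)" .
  moreover have "x * (\<Sum>i<m. x ^ i) \<le> 1 * 2"
    using assms sum_power_le_2[OF assms, of m] by (intro mult_mono sum_nonneg) auto
  moreover have "(\<Sum>i<M. x ^ i) \<le> 2" by (rule sum_power_le_2[OF assms])
  ultimately show ?thesis by linarith
qed

text \<open>One of the \<open>s\<close> summation indices may be replaced by the total.\<close>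

lemma sum_tuples_le:
  fixes h :: "nat \<Rightarrow> real"
  assumes "s \<ge> 1" and h: "\<And>t. h t \<ge> 0" and bound: "\<And>M. (\<Sum>t<M. h t) \<le> c"
  shows "(\<Sum>A\<in>{1..s} \<rightarrow>\<^sub>E {..n}. h (\<Sum>j=1..s. A j)) \<le> real (n + 1) ^ (s - 1) * c"
proof -
  let ?I = "{1..s} \<rightarrow>\<^sub>E {..n}" and ?J = "{1..s - 1} \<rightarrow>\<^sub>E {..n}"
  \<comment> \<open>The dropped entry is recovered from the total, so this map is injective.\<close>
  let ?f = "\<lambda>A. (restrict A {1..s - 1}, \<Sum>j=1..s. A j)"
  have split: "(\<Sum>j=1..s. A j) = A s + (\<Sum>j=1..s - 1. A j)" for A :: "nat \<Rightarrow> nat"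
    using assms(1) by (cases s) auto
  have inj: "inj_on ?f ?I"
  proof (rule inj_onI)
    fix A A' assume A: "A \<in> ?I" "A' \<in> ?I" and eq: "?f A = ?f A'"
    have *: "A j = A' j" if "j \<in> {1..s - 1}" for j
      using eq that by (metis (mono_tags, lifting) prod.inject restrict_apply')
    then have "(\<Sum>j=1..s - 1. A j) = (\<Sum>j=1..s - 1. A' j)" by (intro sum.cong) auto
    moreover have "(\<Sum>j=1..s. A j) = (\<Sum>j=1..s. A' j)" using eq by simp
    ultimately have "A s = A' s" using split[of A] split[of A'] by linarith
    have "A j = A' j" if "j \<in> {1..s}" for j
      using *[of j] \<open>A s = A' s\<close> that by (cases "j = s") auto
    then show "A = A'" using A by (intro PiE_ext[of A "{1..s}" _ A']) auto
  qed
  have img: "?f ` ?I \<subseteq> ?J \<times> {..<s * n + 1}"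
  proof (intro image_subsetI SigmaI)
    fix A assume A: "A \<in> ?I"
    show "restrict A {1..s - 1} \<in> ?J" using A by auto
    have "(\<Sum>j=1..s. A j) \<le> (\<Sum>j=1..s. n)" using A by (intro sum_mono) auto
    then show "(\<Sum>j=1..s. A j) \<in> {..<s * n + 1}" by simp
  qed
  have "(\<Sum>A\<in>?I. h (\<Sum>j=1..s. A j)) = (\<Sum>x\<in>?f ` ?I. h (snd x))"
    by (subst sum.reindex[OF inj]) simp
  also have "\<dots> \<le> (\<Sum>x\<in>?J \<times> {..<s * n + 1}. h (snd x))"
    by (intro sum_mono2 img) (auto intro!: finite_cartesian_product finite_PiE h)
  also have "\<dots> = real (card ?J) * (\<Sum>t<s * n + 1. h t)"
    unfolding sum.cartesian_product' by simp
  also have "\<dots> \<le> real (card ?J) * c" by (intro mult_left_mono bound) auto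
  also have "card ?J = (n + 1) ^ (s - 1)" by (simp add: card_PiE)
  finally show ?thesis by simp
qed

text \<open>The sum factors over positions. From A on, a position contributes 1 for digit 0 and a
  power of x for each other digit, at most exp(b x^(p + 1 - A)). The exponents form a geometric
  series, so the bound is free of n and A.\<close>

lemma sum_heads_le:
  fixes x :: real
  assumes "b > 0" "0 \<le> x" "x < 1"
  shows "(\<Sum>\<theta>\<in>digit_vecs b n. \<Prod>p<n. if \<theta> p = 0 then 1 else if A \<le> Suc p then x ^ (Suc p - A) else 0)
    \<le> exp (real b * (1 / (1 - x)))"
proof -
  let ?e = "\<lambda>p. if A \<le> Suc p then x ^ (Suc p - A) else 0"
  have e0: "?e p \<ge> 0" for p using assms by simp
  have inner: "(\<Sum>d<b. if d = 0 then 1 else ?e p) \<le> exp (real b * ?e p)" for p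
  proof -
    have "(\<Sum>d<b. if d = 0 then 1 else ?e p) = 1 + (\<Sum>d\<in>{..<b} - {0}. if d = 0 then 1 else ?e p)"
      using assms(1) by (subst sum.remove[of _ 0]) auto
    also have "(\<Sum>d\<in>{..<b} - {0}. if d = 0 then 1 else ?e p) = (\<Sum>d\<in>{..<b} - {0}. ?e p)"
      by (intro sum.cong) auto
    also have "\<dots> = real (b - 1) * ?e p" using assms(1) by simp
    also have "1 + real (b - 1) * ?e p \<le> 1 + real b * ?e p"
      using e0[of p] by (intro add_left_mono mult_right_mono) auto
    also have "\<dots> \<le> exp (real b * ?e p)" by (rule exp_ge_add_one_self)
    finally show ?thesis .
  qed
  have S: "(\<Sum>p<n. ?e p) \<le> 1 / (1 - x)"
  proof -
    have "(\<Sum>p<n. ?e p) = (\<Sum>p\<in>{p. p < n \<and> A \<le> Suc p}. x ^ (Suc p - A))"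
      by (rule sum.mono_neutral_cong_right) auto
    also have "\<dots> = (\<Sum>i\<in>(\<lambda>p. Suc p - A) ` {p. p < n \<and> A \<le> Suc p}. x ^ i)"
      by (subst sum.reindex) (auto intro!: inj_onI)
    also have "\<dots> \<le> (\<Sum>i. x ^ i)"
      using assms by (intro sum_le_suminf summable_geometric) auto
    also have "\<dots> = 1 / (1 - x)" using assms by (intro suminf_geometric) auto
    finally show ?thesis .
  qed
  have "(\<Sum>\<theta>\<in>digit_vecs b n. \<Prod>p<n. if \<theta> p = 0 then 1 else ?e p) = (\<Prod>p<n. \<Sum>d<b. if d = 0 then 1 else ?e p)"
    by (rule sum_digit_vecs_prod)
  also have "\<dots> \<le> (\<Prod>p<n. exp (real b * ?e p))"
    using inner assms(2) by (intro prod_mono) (auto intro!: sum_nonneg)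
  also have "\<dots> = exp (real b * (\<Sum>p<n. ?e p))" by (simp add: exp_sum sum_distrib_left)
  also have "\<dots> \<le> exp (real b * (1 / (1 - x)))"
    using mult_left_mono[OF S, of "real b"] by simp
  finally show ?thesis .
qed

section \<open>Leading positions, weights and group sizes for a set separated by boxes\<close>

context
  fixes b s \<alpha> \<beta> m n :: nat and D :: "(nat \<Rightarrow> nat \<Rightarrow> nat) set"
    and T :: "nat set \<Rightarrow> nat set" and A :: "nat set \<Rightarrow> nat"
  assumes b: "b \<ge> 2" and s: "s \<ge> 1" and \<alpha>: "\<alpha> \<ge> 1" and \<beta>: "\<beta> \<ge> 2 * \<alpha>"
    and D_sub: "D \<subseteq> {1..s} \<rightarrow>\<^sub>E digit_vecs b n"
    and zero_in: "(\<lambda>j\<in>{1..s}. \<lambda>_. 0) \<in> D"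
    and box: "\<And>\<kappa> \<mu> U. \<kappa> \<in> D \<Longrightarrow> \<mu> \<in> D \<Longrightarrow> (\<And>j p. j \<in> {1..s} \<Longrightarrow> \<kappa> j p \<noteq> \<mu> j p \<Longrightarrow> (j, p) \<in> U)
       \<Longrightarrow> (\<And>j p. (j, p + \<beta>) \<in> U \<Longrightarrow> (j, p) \<in> U) \<Longrightarrow> finite U \<Longrightarrow> card U \<le> m \<Longrightarrow> \<kappa> = \<mu>"
    and TA: "\<And>S. finite S \<Longrightarrow> is_top_part \<alpha> S (T S) (A S)"
begin

definition lead :: "(nat \<Rightarrow> nat \<Rightarrow> nat) \<Rightarrow> nat \<Rightarrow> nat" where
  "lead \<kappa> = (\<lambda>j\<in>{1..s}. A (digit_supp (\<kappa> j)))"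

text \<open>If a component has fewer than \<alpha> nonzero digits, its lead is 0 and its head is the
  whole component.\<close>

definition head :: "(nat \<Rightarrow> nat \<Rightarrow> nat) \<Rightarrow> nat \<Rightarrow> nat \<Rightarrow> nat" where
  "head \<kappa> = (\<lambda>j\<in>{1..s}. \<lambda>p. if lead \<kappa> j \<le> Suc p then \<kappa> j p else 0)"

text \<open>The part of the weight beyond \<alpha> times the sum of the leads. It depends on lead
  and head only, so the weight is constant on a group.\<close>

definition excess :: "(nat \<Rightarrow> nat) \<Rightarrow> (nat \<Rightarrow> nat \<Rightarrow> nat) \<Rightarrow> nat" where
  "excess L \<theta> = (\<Sum>j=1..s. \<Sum>p\<in>digit_supp (\<theta> j). Suc p - L j)"

lemma dual_digit_vecs: "\<kappa> \<in> D \<Longrightarrow> j \<in> {1..s} \<Longrightarrow> \<kappa> j \<in> digit_vecs b n"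
  using D_sub by (meson PiE_mem subsetD)

lemma top_part_lead: "\<kappa> \<in> D \<Longrightarrow> j \<in> {1..s} \<Longrightarrow> is_top_part \<alpha> (digit_supp (\<kappa> j)) (T (digit_supp (\<kappa> j))) (lead \<kappa> j)"
  using TA[OF finite_digit_supp[OF dual_digit_vecs]] by (simp add: lead_def)

lemma digit_supp_head:
  assumes "\<kappa> \<in> D" "j \<in> {1..s}"
  shows "digit_supp (head \<kappa> j) = T (digit_supp (\<kappa> j))"
proof -
  have "digit_supp (head \<kappa> j) = {p \<in> digit_supp (\<kappa> j). lead \<kappa> j \<le> Suc p}"
    using assms by (auto simp: head_def digit_supp_def)
  also have "\<dots> = T (digit_supp (\<kappa> j))"
    using top_part_lead[OF assms] unfolding is_top_part_def by (auto simp: not_le[symmetric])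
  finally show ?thesis .
qed

lemma lead_in: "\<kappa> \<in> D \<Longrightarrow> lead \<kappa> \<in> {1..s} \<rightarrow>\<^sub>E {..n}"
proof (intro PiE_I)
  fix j assume \<kappa>: "\<kappa> \<in> D" and j: "j \<in> {1..s}"
  show "lead \<kappa> j \<in> {..n}"
    using top_part_lead[OF \<kappa> j] digit_supp_subset[OF dual_digit_vecs[OF \<kappa> j]] by (auto simp: is_top_part_def)
qed (auto simp: lead_def)

lemma head_in: "\<kappa> \<in> D \<Longrightarrow> head \<kappa> \<in> {1..s} \<rightarrow>\<^sub>E digit_vecs b n"
proof (intro PiE_I)
  fix j assume \<kappa>: "\<kappa> \<in> D" and j: "j \<in> {1..s}"
  show "head \<kappa> j \<in> digit_vecs b n"
    using dual_digit_vecs[OF \<kappa> j] b j by (auto simp: digit_vecs_def head_def)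
qed (auto simp: head_def)

lemma sum_pos_sum_top:
  assumes "\<kappa> \<in> D"
  shows "(\<Sum>j=1..s. pos_sum (T (digit_supp (\<kappa> j)))) = \<alpha> * (\<Sum>j=1..s. lead \<kappa> j) + excess (lead \<kappa>) (head \<kappa>)"
proof -
  have "(\<Sum>j=1..s. pos_sum (T (digit_supp (\<kappa> j))))
    = (\<Sum>j=1..s. \<alpha> * lead \<kappa> j + (\<Sum>p\<in>digit_supp (head \<kappa> j). Suc p - lead \<kappa> j))"
    using assms by (intro sum.cong refl) (simp add: pos_sum_top_part[OF top_part_lead] digit_supp_head)
  then show ?thesis by (simp add: sum.distrib sum_distrib_left excess_def)
qed

text \<open>
  The support of a dual element is contained in a box together with, for each of the leading
  positions, the positions below it in steps of \<open>\<beta>\<close>.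
\<close>

lemma excess_large:
  assumes "\<kappa> \<in> D" "\<kappa> \<noteq> (\<lambda>j\<in>{1..s}. \<lambda>_. 0)"
  shows "\<beta> * m \<le> \<beta> * (\<Sum>j=1..s. lead \<kappa> j) + excess (lead \<kappa>) (head \<kappa>) + s * \<alpha> * \<beta>"
proof -
  have \<beta>0: "\<beta> > 0" using \<alpha> \<beta> by simp
  let ?T = "\<lambda>j. digit_supp (head \<kappa> j)" and ?L = "lead \<kappa>"
  \<comment> \<open>\<open>V j q\<close> is the chain q, q - \<beta>, q - 2\<beta>, ... down to the
    box. Below that the box contains everything, so \<open>U\<close> is closed under subtracting
    \<beta>.\<close>
  define V where "V j q = {p. p \<le> q \<and> p mod \<beta> = q mod \<beta> \<and> ?L j \<le> p}" for j q
  define U where "U = (SIGMA j:{1..s}. {..<?L j} \<union> (\<Union>q\<in>?T j. V j q))"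
  have finT: "finite (?T j)" if "j \<in> {1..s}" for j
    using head_in[OF assms(1)] that by (intro finite_digit_supp) auto
  have finV: "finite (V j q)" for j q by (rule finite_subset[of _ "{..q}"]) (auto simp: V_def)
  \<comment> \<open>A chain has at most (q - L) / \<beta> + 1 members, where L is the lead. The
    extra member costs \<beta>, in total s \<alpha> \<beta> for at most \<alpha> chains per
    coordinate.\<close>
  have cardV: "\<beta> * card (V j q) \<le> (Suc q - ?L j) + \<beta>" for j q
  proof -
    have "V j q \<subseteq> (\<lambda>t. q - \<beta> * t) ` {..(q - ?L j) div \<beta>}"
    proof
      fix p assume p: "p \<in> V j q"
      then have "p \<le> q" "q mod \<beta> = p mod \<beta>" by (auto simp: V_def)
      then have "\<beta> dvd q - p" by (simp add: mod_eq_dvd_iff_nat)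
      then obtain t where t: "q - p = \<beta> * t" by (auto elim: dvdE)
      then have "\<beta> * t \<le> q - ?L j" using p by (auto simp: V_def)
      then have "t \<le> (q - ?L j) div \<beta>" using \<beta>0 by (simp add: less_eq_div_iff_mult_less_eq mult.commute)
      moreover have "p = q - \<beta> * t" using \<open>p \<le> q\<close> by (simp flip: t)
      ultimately show "p \<in> (\<lambda>t. q - \<beta> * t) ` {..(q - ?L j) div \<beta>}" by auto
    qed
    then have "card (V j q) \<le> card {..(q - ?L j) div \<beta>}"
      by (intro surj_card_le) auto
    then have "\<beta> * card (V j q) \<le> \<beta> * ((q - ?L j) div \<beta> + 1)" by (intro mult_le_mono2) simp
    also have "\<dots> = \<beta> * ((q - ?L j) div \<beta>) + \<beta>" by simp
    also have "\<beta> * ((q - ?L j) div \<beta>) \<le> q - ?L j" by simp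
    finally show ?thesis by linarith
  qed
  have finU: "finite U" unfolding U_def using finT finV by auto
  have inU: "(j, p) \<in> U" if j: "j \<in> {1..s}" and p: "\<kappa> j p \<noteq> (\<lambda>j\<in>{1..s}. \<lambda>_. 0) j p" for j p
  proof -
    have "p \<in> digit_supp (\<kappa> j)" using p j by (simp add: digit_supp_def)
    then have "p \<in> ?T j \<or> p < ?L j"
      using top_part_lead[OF assms(1) j] unfolding is_top_part_def digit_supp_head[OF assms(1) j]
      by (meson DiffI Suc_lessD)
    moreover have "p < ?L j \<or> p \<in> V j p" by (auto simp: V_def)
    ultimately have "p \<in> {..<?L j} \<union> (\<Union>q\<in>?T j. V j q)" by blast
    then show ?thesis using j unfolding U_def by blast
  qed
  \<comment> \<open>Otherwise separation from the zero element would make \<kappa> zero.\<close>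
  have "\<not> card U \<le> m"
  proof
    assume le: "card U \<le> m"
    have "\<kappa> = (\<lambda>j\<in>{1..s}. \<lambda>_. 0)"
    proof (rule box[OF assms(1) zero_in inU _ finU le])
      fix j p assume *: "(j, p + \<beta>) \<in> U"
      have "p \<in> V j q" if "p + \<beta> \<in> V j q" "\<not> p < ?L j" for q
        using that by (simp add: V_def)
      then show "(j, p) \<in> U" using * unfolding U_def by auto
    qed
    with assms(2) show False by simp
  qed
  then have "m \<le> card U" by simp
  also have "card U \<le> (\<Sum>j=1..s. ?L j + (\<Sum>q\<in>?T j. card (V j q)))"
  proof -
    have "card U = (\<Sum>j=1..s. card ({..<?L j} \<union> (\<Union>q\<in>?T j. V j q)))"
      unfolding U_def using finT finV by (intro card_SigmaI) auto
    also have "\<dots> \<le> (\<Sum>j=1..s. ?L j + (\<Sum>q\<in>?T j. card (V j q)))"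
    proof (rule sum_mono)
      fix j assume "j \<in> {1..s}"
      then have "card (\<Union>q\<in>?T j. V j q) \<le> (\<Sum>q\<in>?T j. card (V j q))" by (intro card_UN_le finT)
      then show "card ({..<?L j} \<union> (\<Union>q\<in>?T j. V j q)) \<le> ?L j + (\<Sum>q\<in>?T j. card (V j q))"
        using card_Un_le[of "{..<?L j}" "\<Union>q\<in>?T j. V j q"] by simp
    qed
    finally show ?thesis .
  qed
  finally have "\<beta> * m \<le> \<beta> * (\<Sum>j=1..s. ?L j + (\<Sum>q\<in>?T j. card (V j q)))" by (rule mult_le_mono2)
  also have "\<dots> = \<beta> * (\<Sum>j=1..s. ?L j) + (\<Sum>j=1..s. \<Sum>q\<in>?T j. \<beta> * card (V j q))"
    by (simp add: sum.distrib sum_distrib_left distrib_left)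
  also have "(\<Sum>j=1..s. \<Sum>q\<in>?T j. \<beta> * card (V j q)) \<le> (\<Sum>j=1..s. \<Sum>q\<in>?T j. (Suc q - ?L j) + \<beta>)"
    by (intro sum_mono cardV)
  also have "\<dots> = excess ?L (head \<kappa>) + (\<Sum>j=1..s. card (?T j) * \<beta>)"
    by (simp add: sum.distrib excess_def)
  also have "(\<Sum>j=1..s. card (?T j) * \<beta>) \<le> (\<Sum>j=1..s. \<alpha> * \<beta>)"
  proof (intro sum_mono mult_le_mono1)
    fix j assume j: "j \<in> {1..s}"
    show "card (?T j) \<le> \<alpha>"
      using top_part_lead[OF assms(1) j] unfolding digit_supp_head[OF assms(1) j] is_top_part_def by auto
  qed
  finally show ?thesis by (simp add: add_ac mult.assoc)
qed

text \<open>Within a group only digits below the leads are free. The box is cut down to at most m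
  positions, where an element is determined by its other digits; so only the digits in the part cut
  off, \<open>V\<close>, have to be counted.\<close>

lemma card_same_head:
  "card {\<kappa> \<in> D. lead \<kappa> = L \<and> head \<kappa> = \<theta>} \<le> b ^ ((\<Sum>j=1..s. L j) - m)"
proof -
  let ?F = "{\<kappa> \<in> D. lead \<kappa> = L \<and> head \<kappa> = \<theta>}"
  obtain L' where L': "\<And>j. L' j \<le> L j" "(\<Sum>j=1..s. L' j) = min m (\<Sum>j=1..s. L j)"
    using exists_sum_le[of "{1..s}" "min m (\<Sum>j=1..s. L j)" L] by auto
  define U where "U = (SIGMA j:{1..s}. {..<L' j})"
  define V where "V = (SIGMA j:{1..s}. {L' j..<L j})"
  let ?\<psi> = "\<lambda>\<kappa>. restrict (\<lambda>(j, p). \<kappa> j p) V"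
  have cardU: "card U \<le> m" unfolding U_def using L'(2) by simp
  have finV: "finite V" by (simp add: V_def)
  have "card V = (\<Sum>j=1..s. L j - L' j)" unfolding V_def by simp
  also have "\<dots> = (\<Sum>j=1..s. L j) - (\<Sum>j=1..s. L' j)" using L'(1) by (intro sum_subtractf_nat) auto
  finally have cardV: "card V = (\<Sum>j=1..s. L j) - m" using L'(2) by simp
  have "inj_on ?\<psi> ?F"
  proof (rule inj_onI)
    fix \<kappa> \<mu> assume \<kappa>: "\<kappa> \<in> ?F" and \<mu>: "\<mu> \<in> ?F" and eq: "?\<psi> \<kappa> = ?\<psi> \<mu>"
    show "\<kappa> = \<mu>"
    proof (rule box[of \<kappa> \<mu> U])
      fix j p assume j: "j \<in> {1..s}" and ne: "\<kappa> j p \<noteq> \<mu> j p"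
      have "(j, p) \<notin> V"
      proof
        assume "(j, p) \<in> V"
        then show False using fun_cong[OF eq, of "(j, p)"] ne by simp
      qed
      moreover have "\<not> L j \<le> Suc p"
      proof
        assume "L j \<le> Suc p"
        then have "head \<kappa> j p = \<kappa> j p" "head \<mu> j p = \<mu> j p" using \<kappa> \<mu> j by (auto simp: head_def)
        moreover have "head \<kappa> j p = head \<mu> j p" using \<kappa> \<mu> by simp
        ultimately show False using ne by simp
      qed
      ultimately show "(j, p) \<in> U" using j by (auto simp: U_def V_def)
    qed (use \<kappa> \<mu> cardU in \<open>auto simp: U_def\<close>)
  qed
  moreover have "?\<psi> ` ?F \<subseteq> V \<rightarrow>\<^sub>E {..<b}"
  proof (intro image_subsetI PiE_I)
    fix \<kappa> x assume "\<kappa> \<in> ?F" "x \<in> V"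
    then have "fst x \<in> {1..s}" "\<kappa> (fst x) \<in> digit_vecs b n" using dual_digit_vecs[of \<kappa> "fst x"] by (auto simp: V_def)
    then have "\<kappa> (fst x) (snd x) < b" using b by (cases "snd x < n") (auto simp: digit_vecs_def)
    then show "?\<psi> \<kappa> x \<in> {..<b}" using \<open>x \<in> V\<close> by (simp add: case_prod_beta)
  qed simp
  moreover have "finite (V \<rightarrow>\<^sub>E {..<b})" using finV by (intro finite_PiE) auto
  ultimately have "card ?F \<le> card (V \<rightarrow>\<^sub>E {..<b})" by (rule card_inj_on_le)
  also have "\<dots> = b ^ card V" using finV by (simp add: card_PiE)
  finally show ?thesis by (simp add: cardV)
qed

text \<open>Group size times weight. For a \<ge> m, \<alpha> \<ge> 1 suffices. For a < m,
  \<open>excess_large\<close> bounds 2\<alpha>(m - a) by y and m - a by y/2, up to constants; so of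
  the exponent 2y a share y/2 is left, which becomes b^(-y/2).\<close>

lemma dual_weight_bound:
  assumes "\<kappa> \<in> D" "\<kappa> \<noteq> (\<lambda>j\<in>{1..s}. \<lambda>_. 0)"
  defines "a \<equiv> \<Sum>j=1..s. lead \<kappa> j" and "y \<equiv> excess (lead \<kappa>) (head \<kappa>)"
  shows "real b ^ (a - m) / real b ^ (2 * (\<alpha> * a + y))
    \<le> real b ^ (2 * s * \<alpha> * \<beta>) / real b ^ (2 * \<alpha> * m)
        * ((1 / real b) ^ ((a - m) + (m - a)) * (real b powr (-1/2)) ^ y)"
proof -
  have B: "real b > 1" using b by simp
  have "real \<beta> * real m \<le> real \<beta> * real a + real y + real s * real \<alpha> * real \<beta>"
    using excess_large[OF assms(1,2)] unfolding a_def y_def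
    by (simp only: of_nat_mult[symmetric] of_nat_add[symmetric] of_nat_le_iff)
  then have Y: "real \<beta> * (real m - real a) \<le> real y + real s * real \<alpha> * real \<beta>"
    by (simp add: right_diff_distrib)
  \<comment> \<open>Twice the slack s \<alpha> \<beta> of \<open>excess_large\<close>, enough for
    both uses of it in the case a < m.\<close>
  define E where "E = 2 * real s * real \<alpha> * real \<beta>"
  have E: "E \<ge> 0" by (simp add: E_def)
  have main: "real (a - m) - 2 * (real \<alpha> * real a + real y)
    \<le> E - 2 * real \<alpha> * real m - (real (a - m) + real (m - a)) - real y / 2"
  proof (cases "m \<le> a")
    case True
    have "1 * (real a - real m) \<le> real \<alpha> * (real a - real m)"
      using True \<alpha> by (intro mult_right_mono) auto
    then have "2 * (real a - real m) \<le> 2 * real \<alpha> * real a - 2 * real \<alpha> * real m"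
      by (simp add: algebra_simps)
    then show ?thesis using True E by (simp add: of_nat_diff)
  next
    case False
    have "(2 * real \<alpha>) * (real m - real a) \<le> real \<beta> * (real m - real a)"
    proof (rule mult_right_mono)
      have "real (2 * \<alpha>) \<le> real \<beta>" using \<beta> by (simp only: of_nat_le_iff)
      then show "2 * real \<alpha> \<le> real \<beta>" by simp
    qed (use False in simp)
    then have 1: "2 * (real \<alpha> * (real m - real a)) \<le> real \<beta> * (real m - real a)" by simp
    have "1 * (real m - real a) \<le> real \<alpha> * (real m - real a)"
      using False \<alpha> by (intro mult_right_mono) auto
    then have 2: "real m - real a \<le> real \<alpha> * (real m - real a)" by simp
    have 3: "real \<beta> * (real m - real a) \<le> real y + E / 2" using Y by (simp add: E_def)
    have 4: "real \<alpha> * (real m - real a) = real \<alpha> * real m - real \<alpha> * real a" by (rule right_diff_distrib)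
    have 5: "real (a - m) = 0" "real (m - a) = real m - real a" using False by (auto simp: of_nat_diff)
    have 6: "2 * real \<alpha> * real m = 2 * (real \<alpha> * real m)" by simp
    show ?thesis unfolding 5 6 using 1 2 3 4 E by argo
  qed
  have B0: "0 < real b" using B by simp
  have e1: "real (a - m) - 2 * (real \<alpha> * real a + real y) = real (a - m) - real (2 * (\<alpha> * a + y))"
    by simp
  have e2: "E - 2 * real \<alpha> * real m - (real (a - m) + real (m - a)) - real y / 2
     = real (2 * s * \<alpha> * \<beta>) - real (2 * \<alpha> * m) - real ((a - m) + (m - a)) + real y * (-1/2)"
    by (simp add: E_def)
  have root: "real b powr (real y * (-1/2)) = (real b powr (-1/2)) ^ y"
    using B0 powr_power[of "real b" "-1/2" y] by (simp add: mult.commute)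
  have "real b ^ (a - m) / real b ^ (2 * (\<alpha> * a + y)) = real b powr (real (a - m) - 2 * (real \<alpha> * real a + real y))"
    unfolding e1 powr_diff powr_realpow[OF B0] ..
  also have "\<dots> \<le> real b powr (E - 2 * real \<alpha> * real m - (real (a - m) + real (m - a)) - real y / 2)"
    using main B by (intro powr_mono) auto
  also have "\<dots> = real b ^ (2 * s * \<alpha> * \<beta>) / real b ^ (2 * \<alpha> * m) / real b ^ ((a - m) + (m - a)) * (real b powr (-1/2)) ^ y"
    unfolding e2 powr_add powr_diff powr_realpow[OF B0] root ..
  finally show ?thesis by (simp only: power_one_over times_divide_eq_left times_divide_eq_right mult_1_left divide_divide_eq_left)
qed

lemma sum_dual_le:
  "(\<Sum>\<kappa>\<in>D - {\<lambda>j\<in>{1..s}. \<lambda>_. 0}. \<Prod>j=1..s. 1 / real b ^ (2 * pos_sum (T (digit_supp (\<kappa> j)))))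
    \<le> real b ^ (2 * s * \<alpha> * \<beta>) * exp (real b * (1 / (1 - real b powr (-1/2)))) ^ s * 4
        * real (n + 1) ^ (s - 1) / real b ^ (2 * \<alpha> * m)"
proof -
  let ?D = "D - {\<lambda>j\<in>{1..s}. \<lambda>_. 0}"
  let ?I = "{1..s} \<rightarrow>\<^sub>E {..n}" and ?H = "{1..s} \<rightarrow>\<^sub>E digit_vecs b n"
  let ?x = "real b powr (-1/2)"
  let ?c = "real b ^ (2 * s * \<alpha> * \<beta>) / real b ^ (2 * \<alpha> * m)"
  let ?E = "exp (real b * (1 / (1 - ?x)))"
  let ?f = "\<lambda>L \<theta> p. if \<theta> p = 0 then 1 else if L \<le> Suc p then ?x ^ (Suc p - L) else 0"
  define h where "h t = (1 / real b) ^ ((t - m) + (m - t))" for t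
  have x: "0 \<le> ?x" "?x < 1" using b powr_less_cancel_iff[of "real b" "-1/2" 0] by auto
  have finD: "finite ?D" by (rule finite_subset[OF _ finite_PiE[of "{1..s}" "\<lambda>_. digit_vecs b n"]]) (use D_sub in auto)
  have finIH: "finite (?I \<times> ?H)" by (intro finite_cartesian_product finite_PiE) auto
  have term_eq: "(\<Prod>j=1..s. 1 / real b ^ (2 * pos_sum (T (digit_supp (\<kappa> j)))))
     = 1 / real b ^ (2 * (\<alpha> * (\<Sum>j=1..s. lead \<kappa> j) + excess (lead \<kappa>) (head \<kappa>)))" if "\<kappa> \<in> D" for \<kappa>
    unfolding sum_pos_sum_top[OF that, symmetric]
    by (simp add: prod_dividef power_sum[symmetric] sum_distrib_left)
  have "(\<Sum>\<kappa>\<in>?D. \<Prod>j=1..s. 1 / real b ^ (2 * pos_sum (T (digit_supp (\<kappa> j)))))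
    = (\<Sum>\<kappa>\<in>?D. 1 / real b ^ (2 * (\<alpha> * (\<Sum>j=1..s. lead \<kappa> j) + excess (lead \<kappa>) (head \<kappa>))))"
    by (intro sum.cong refl term_eq) auto
  also have "\<dots> = (\<Sum>z\<in>?I \<times> ?H. \<Sum>\<kappa>\<in>{\<kappa> \<in> ?D. (lead \<kappa>, head \<kappa>) = z}.
       1 / real b ^ (2 * (\<alpha> * (\<Sum>j=1..s. lead \<kappa> j) + excess (lead \<kappa>) (head \<kappa>))))"
    using lead_in head_in by (intro sum.group[symmetric] finD finIH) blast
  \<comment> \<open>The bound is summed over all pairs of lead and head, attained or not, so that
    the sum factors over the coordinates. \<open>?f\<close> is zero at a nonzero digit below the
    lead.\<close>
  also have "\<dots> \<le> (\<Sum>z\<in>?I \<times> ?H. ?c * (h (\<Sum>j=1..s. fst z j) * (\<Prod>j=1..s. \<Prod>p<n. ?f (fst z j) (snd z j) p)))"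
  proof (rule sum_mono)
    fix z assume z: "z \<in> ?I \<times> ?H"
    let ?F = "{\<kappa> \<in> ?D. (lead \<kappa>, head \<kappa>) = z}"
    let ?a = "\<Sum>j=1..s. fst z j" and ?y = "excess (fst z) (snd z)"
    have rhs0: "0 \<le> ?c * (h ?a * (\<Prod>j=1..s. \<Prod>p<n. ?f (fst z j) (snd z j) p))"
      unfolding h_def using x by (intro mult_nonneg_nonneg prod_nonneg) auto
    show "(\<Sum>\<kappa>\<in>?F. 1 / real b ^ (2 * (\<alpha> * (\<Sum>j=1..s. lead \<kappa> j) + excess (lead \<kappa>) (head \<kappa>))))
       \<le> ?c * (h ?a * (\<Prod>j=1..s. \<Prod>p<n. ?f (fst z j) (snd z j) p))"
    proof (cases "?F = {}")
      case True
      then show ?thesis using rhs0 by (simp only: sum.empty)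
    next
      case False
      then obtain \<kappa> where \<kappa>: "\<kappa> \<in> D" "\<kappa> \<noteq> (\<lambda>j\<in>{1..s}. \<lambda>_. 0)" and z_eq: "z = (lead \<kappa>, head \<kappa>)" by auto
      have "(\<Sum>\<kappa>\<in>?F. 1 / real b ^ (2 * (\<alpha> * (\<Sum>j=1..s. lead \<kappa> j) + excess (lead \<kappa>) (head \<kappa>))))
        = (\<Sum>\<kappa>\<in>?F. 1 / real b ^ (2 * (\<alpha> * ?a + ?y)))"
        by (intro sum.cong refl) auto
      also have "\<dots> = real (card ?F) * (1 / real b ^ (2 * (\<alpha> * ?a + ?y)))" by simp
      also have "\<dots> \<le> real b ^ (?a - m) * (1 / real b ^ (2 * (\<alpha> * ?a + ?y)))"
      proof (intro mult_right_mono)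
        have "finite D" by (rule finite_subset[OF D_sub]) (intro finite_PiE; simp)
        then have "card ?F \<le> card {\<kappa> \<in> D. lead \<kappa> = fst z \<and> head \<kappa> = snd z}" by (intro card_mono) auto
        also have "\<dots> \<le> b ^ (?a - m)" by (rule card_same_head)
        finally show "real (card ?F) \<le> real b ^ (?a - m)" unfolding of_nat_power[symmetric] of_nat_le_iff .
      qed simp
      also have "\<dots> \<le> ?c * (h ?a * ?x ^ ?y)"
        unfolding z_eq h_def fst_conv snd_conv times_divide_eq_right mult_1_right
        by (rule dual_weight_bound[OF \<kappa>, unfolded times_divide_eq_right])
      also have "?x ^ ?y = (\<Prod>j=1..s. \<Prod>p\<in>digit_supp (snd z j). ?x ^ (Suc p - fst z j))"
        by (simp add: excess_def power_sum)
      also have "\<dots> = (\<Prod>j=1..s. \<Prod>p<n. ?f (fst z j) (snd z j) p)"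
      proof (rule prod.cong[OF refl])
        fix j assume j: "j \<in> {1..s}"
        have v: "head \<kappa> j \<in> digit_vecs b n" using head_in[OF \<kappa>(1)] j by (rule PiE_mem)
        have le: "lead \<kappa> j \<le> Suc p" if "p \<in> digit_supp (head \<kappa> j)" for p
          using that j by (auto simp: digit_supp_def head_def split: if_splits)
        have "(\<Prod>p<n. ?f (lead \<kappa> j) (head \<kappa> j) p) = (\<Prod>p\<in>digit_supp (head \<kappa> j). ?f (lead \<kappa> j) (head \<kappa> j) p)"
          using digit_supp_subset[OF v] by (intro prod.mono_neutral_right) (auto simp: digit_supp_def)
        also have "\<dots> = (\<Prod>p\<in>digit_supp (head \<kappa> j). ?x ^ (Suc p - lead \<kappa> j))"
          using le by (intro prod.cong refl) (auto simp: digit_supp_def)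
        finally show "(\<Prod>p\<in>digit_supp (snd z j). ?x ^ (Suc p - fst z j)) = (\<Prod>p<n. ?f (fst z j) (snd z j) p)"
          unfolding z_eq fst_conv snd_conv by (rule sym)
      qed
      finally show ?thesis .
    qed
  qed
  also have "\<dots> = ?c * (\<Sum>L\<in>?I. h (\<Sum>j=1..s. L j) * (\<Sum>\<theta>\<in>?H. \<Prod>j=1..s. \<Prod>p<n. ?f (L j) (\<theta> j) p))"
    unfolding sum.cartesian_product' fst_conv snd_conv sum_distrib_left[symmetric] ..
  also have "\<dots> = ?c * (\<Sum>L\<in>?I. h (\<Sum>j=1..s. L j) * (\<Prod>j=1..s. \<Sum>\<theta>\<in>digit_vecs b n. \<Prod>p<n. ?f (L j) \<theta> p))"
    by (subst prod_sum_PiE) auto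
  also have "\<dots> \<le> ?c * (\<Sum>L\<in>?I. h (\<Sum>j=1..s. L j) * (\<Prod>j=1..s. ?E))"
    using b x by (intro mult_left_mono sum_mono prod_mono conjI sum_heads_le sum_nonneg prod_nonneg) (auto simp: h_def)
  also have "\<dots> = ?c * ?E ^ s * (\<Sum>L\<in>?I. h (\<Sum>j=1..s. L j))"
    by (simp add: sum_distrib_right[symmetric] mult_ac)
  \<comment> \<open>Each of s - 1 leads has n + 1 possible values, and 4 bounds the sum of b^(-|t -
    m|) over the total t.\<close>
  also have "\<dots> \<le> ?c * ?E ^ s * (real (n + 1) ^ (s - 1) * 4)"
  proof (intro mult_left_mono sum_tuples_le s)
    show "(\<Sum>t<M. h t) \<le> 4" for M
      unfolding h_def using b by (intro sum_power_dist_le_4) (auto simp: divide_simps)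
  qed (auto simp: h_def)
  finally show ?thesis by (simp add: mult_ac)
qed

end

subsection \<open>Point evaluations in a reproducing kernel Hilbert space\<close>

context hilbert_function_space
begin

lemma ip_add_right: "f \<in> V \<Longrightarrow> g \<in> V \<Longrightarrow> h \<in> V \<Longrightarrow> ip h (\<lambda>x. f x + g x) = ip h f + ip h g"
  using ip_add[of f g h] ip_commute add_closed by metis

lemma ip_scale_right: "f \<in> V \<Longrightarrow> h \<in> V \<Longrightarrow> ip h (\<lambda>x. c * f x) = c * ip h f"
  using ip_scale[of f h c] ip_commute scale_closed by metis

lemma ip_zero_right: "f \<in> V \<Longrightarrow> ip f (\<lambda>x. 0) = 0"
  using ip_scale_right[of f f 0] by simp

lemma cauchy_schwarz:
  assumes "f \<in> V" "u \<in> V"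
  shows "(ip f u)\<^sup>2 \<le> ip f f * ip u u"
proof (cases "ip u u = 0")
  case True
  then have "u = (\<lambda>x. 0)" using ip_definite assms by blast
  then show ?thesis using ip_zero_right[OF assms(1)] True by simp
next
  case False
  then have pos: "ip u u > 0" using ip_nonneg[OF assms(2)] by simp
  define t where "t = - ip f u / ip u u"
  have tu: "(\<lambda>x. t * u x) \<in> V" using assms scale_closed by blast
  then have v: "(\<lambda>x. f x + t * u x) \<in> V" using assms add_closed by blast
  have "0 \<le> ip (\<lambda>x. f x + t * u x) (\<lambda>x. f x + t * u x)" using ip_nonneg[OF v] .
  also have "\<dots> = ip f f + 2 * t * ip f u + t\<^sup>2 * ip u u"
    using assms tu v
    by (simp add: ip_add ip_add_right ip_scale ip_scale_right ip_commute[of u f] power2_eq_square algebra_simps)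
  also have "\<dots> = ip f f - (ip f u)\<^sup>2 / ip u u"
    using pos by (simp add: t_def power2_eq_square field_simps)
  finally show ?thesis using pos by (simp add: field_simps)
qed

end

context reproducing_kernel_hilbert_space
begin

text \<open>The representer is the combination of kernel sections with the same coefficients; its
  values are recorded on X only, where the sections agree with the kernel.\<close>

lemma point_functional_representer:
  assumes "finite I" "\<And>i. i \<in> I \<Longrightarrow> x i \<in> X"
  shows "\<exists>u\<in>V. (\<forall>h\<in>V. ip h u = (\<Sum>i\<in>I. c i * h (x i))) \<and> (\<forall>z\<in>X. u z = (\<Sum>i\<in>I. c i * K z (x i)))"
  using assms
proof (induction I)
  case empty
  then show ?case using zero_closed ip_zero_right by (intro bexI[of _ "\<lambda>x. 0"]) auto
next
  case (insert i I)
  then obtain u where u: "u \<in> V" "\<forall>h\<in>V. ip h u = (\<Sum>i\<in>I. c i * h (x i))"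
    "\<forall>z\<in>X. u z = (\<Sum>i\<in>I. c i * K z (x i))" by auto
  let ?k = "\<lambda>z. if z \<in> X then K z (x i) else 0"
  have k: "?k \<in> V" using kernel_section insert by blast
  then have ck: "(\<lambda>z. c i * ?k z) \<in> V" by (rule scale_closed)
  have "ip h (\<lambda>z. c i * ?k z + u z) = (\<Sum>i\<in>insert i I. c i * h (x i))" if "h \<in> V" for h
    using ip_add_right[OF ck u(1) that] ip_scale_right[OF k that] reproducing[OF that, of "x i"] u(2) that insert by simp
  moreover have "c i * ?k z + u z = (\<Sum>i\<in>insert i I. c i * K z (x i))" if "z \<in> X" for z
    using that u(3) insert by simp
  moreover have "(\<lambda>z. c i * ?k z + u z) \<in> V" using add_closed[OF ck u(1)] .
  ultimately show ?case by blast
qed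

text \<open>Cauchy--Schwarz: the squared norm of the representer is the functional applied to it,
  which is the quadratic form of the kernel.\<close>

lemma point_functional_bound:
  assumes "finite I" "\<And>i. i \<in> I \<Longrightarrow> x i \<in> X" "f \<in> V"
  shows "(\<Sum>i\<in>I. c i * f (x i))\<^sup>2 \<le> ip f f * (\<Sum>i\<in>I. \<Sum>j\<in>I. c i * c j * K (x i) (x j))"
proof -
  obtain u where u: "u \<in> V" "\<forall>h\<in>V. ip h u = (\<Sum>i\<in>I. c i * h (x i))"
    "\<forall>z\<in>X. u z = (\<Sum>i\<in>I. c i * K z (x i))"
    using point_functional_representer[of I x c, OF assms(1,2)] by blast
  have "ip u u = (\<Sum>i\<in>I. c i * u (x i))" using u by blast
  also have "\<dots> = (\<Sum>i\<in>I. \<Sum>j\<in>I. c i * c j * K (x i) (x j))"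
    using u(3) assms(2) by (intro sum.cong refl) (simp add: sum_distrib_left mult.assoc)
  finally show ?thesis using cauchy_schwarz[OF assms(3) u(1)] u(2) assms(3) by simp
qed

lemma point_difference_bound:
  assumes "x \<in> X" "y \<in> X" "f \<in> V"
  shows "(f x - f y)\<^sup>2 \<le> ip f f * ((K x x - K x y) + (K y y - K y x))"
  \<comment> \<open>Indexing by \<open>bool\<close> keeps the two terms apart even when x =
    y.\<close>
  using point_functional_bound[of "UNIV :: bool set" "\<lambda>i. if i then x else y" f "\<lambda>i. if i then 1 else -1"] assms
  by (simp add: UNIV_bool algebra_simps)

end

subsection \<open>Integration against a grid\<close>

definition grid_point :: "nat \<Rightarrow> nat \<Rightarrow> nat \<Rightarrow> (nat \<Rightarrow> nat \<Rightarrow> nat) \<Rightarrow> nat \<Rightarrow> real" where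
  "grid_point b n s a = (\<lambda>j\<in>{1..s}. radix_val b n (a j))"

definition radix_cell :: "nat \<Rightarrow> nat \<Rightarrow> (nat \<Rightarrow> nat) \<Rightarrow> real set" where
  "radix_cell b n a = {radix_val b n a..<radix_val b n a + 1 / real b ^ n}"

lemma radix_cell_subset:
  assumes "b > 0" "a \<in> digit_vecs b n"
  shows "radix_cell b n a \<subseteq> {0..<1}"
  using radix_val_upper[OF assms] radix_val_nonneg[of b n a] by (auto simp: radix_cell_def)

text \<open>The leading digit of x is the integer part of b x; removing it maps the cells with this
  leading digit onto the cells with one digit less.\<close>

lemma sum_indicator_radix_cell:
  assumes "b > 0" "x \<in> {0..<1}"
  shows "(\<Sum>a\<in>digit_vecs b n. indicator (radix_cell b n a) x) = (1 :: real)"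
  using assms(2)
proof (induction n arbitrary: x)
  case 0
  then show ?case by (simp add: radix_cell_def radix_val_def)
next
  case (Suc n)
  define q where "q = nat \<lfloor>real b * x\<rfloor>"
  have bx: "0 \<le> real b * x" "real b * x < real b" using Suc.prems assms(1) by auto
  have q: "real q \<le> real b * x" "real b * x < real q + 1"
    unfolding q_def using bx by linarith+
  then have qb: "q < b" using bx by linarith
  have cell: "indicator (radix_cell b (Suc n) (case_nat p a)) x = (indicator (radix_cell b n a) (real b * x - real p) :: real)" for p a
    using assms(1) by (auto simp: indicator_def radix_cell_def radix_val_Suc field_simps)
  have out: "(\<Sum>a\<in>digit_vecs b n. indicator (radix_cell b n a) (real b * x - real p)) = (0::real)" if "p \<noteq> q" for p
  proof (rule sum.neutral, intro ballI)
    fix a assume a: "a \<in> digit_vecs b n"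
    have "real b * x - real p \<notin> {0..<1}"
    proof
      assume "real b * x - real p \<in> {0..<1}"
      then have "real p < real q + 1" "real q < real p + 1" using q by auto
      then show False using that by linarith
    qed
    then show "indicator (radix_cell b n a) (real b * x - real p) = (0::real)"
      using radix_cell_subset[OF assms(1) a] by (auto simp: indicator_def)
  qed
  have "(\<Sum>a\<in>digit_vecs b (Suc n). indicator (radix_cell b (Suc n) a) x)
    = (\<Sum>p<b. \<Sum>a\<in>digit_vecs b n. indicator (radix_cell b n a) (real b * x - real p) :: real)"
    unfolding sum_digit_vecs_Suc cell ..
  also have "\<dots> = (\<Sum>p<b. if p = q then 1 else 0)"
    using Suc.IH[of "real b * x - real q"] q out by (intro sum.cong) auto
  also have "\<dots> = 1" using qb by simp
  finally show ?case .
qed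

section \<open>Cells of the unit cube and the error of the grid rule\<close>

context
  fixes s :: nat
begin

abbreviation unit_interval_measure :: "real measure" where
  "unit_interval_measure \<equiv> restrict_space lborel {0..<1}"

lemma product_sigma_finite_unit: "product_sigma_finite (\<lambda>_::nat. unit_interval_measure)"
proof (rule product_sigma_finite.intro)
  show "sigma_finite_measure unit_interval_measure"
    by (intro sigma_finite_measure_restrict_space lborel.sigma_finite_measure_axioms) simp
qed

lemma box_in_sets:
  assumes "\<And>j. j \<in> {1..s} \<Longrightarrow> J j \<subseteq> {0..<1}" "\<And>j. j \<in> {1..s} \<Longrightarrow> J j \<in> sets lborel"
  shows "Pi\<^sub>E {1..s} J \<in> sets (unit_cube_measure s)"
  unfolding unit_cube_measure_def using assms
  by (intro sets_PiM_I_finite) (auto simp: sets_restrict_space_iff)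

lemma emeasure_box:
  assumes "\<And>j. j \<in> {1..s} \<Longrightarrow> J j \<subseteq> {0..<1}" "\<And>j. j \<in> {1..s} \<Longrightarrow> J j \<in> sets lborel"
  shows "emeasure (unit_cube_measure s) (Pi\<^sub>E {1..s} J) = (\<Prod>j=1..s. emeasure lborel (J j))"
proof -
  interpret product_sigma_finite "\<lambda>_::nat. unit_interval_measure" by (rule product_sigma_finite_unit)
  have "emeasure (unit_cube_measure s) (Pi\<^sub>E {1..s} J) = (\<Prod>j=1..s. emeasure unit_interval_measure (J j))"
    unfolding unit_cube_measure_def using assms
    by (intro emeasure_PiM) (auto simp: sets_restrict_space_iff)
  also have "\<dots> = (\<Prod>j=1..s. emeasure lborel (J j))"
    using assms by (intro prod.cong refl emeasure_restrict_space) auto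
  finally show ?thesis .
qed

lemma emeasure_unit_cube: "emeasure (unit_cube_measure s) (unit_cube s) = 1"
  unfolding unit_cube_def by (subst emeasure_box) auto

lemma finite_measure_unit_cube: "finite_measure (unit_cube_measure s)"
  by (rule finite_measureI) (simp add: space_unit_cube_measure emeasure_unit_cube)

text \<open>Measurability of f has to be derived: the Hoelder bound makes f the uniform limit of its
  step functions on ever finer grids. This is why the auxiliary objects are indexed by every n
  although the estimate concerns a single grid.\<close>

lemma grid_error:
  fixes f :: "(nat \<Rightarrow> real) \<Rightarrow> real"
  assumes b: "b \<ge> 2" and C: "C \<ge> 0"
    and hoelder: "\<And>x y. x \<in> unit_cube s \<Longrightarrow> y \<in> unit_cube s \<Longrightarrow> (f x - f y)\<^sup>2 \<le> C * (\<Sum>j=1..s. \<bar>x j - y j\<bar>)"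
  shows "\<bar>(\<Sum>a\<in>{1..s} \<rightarrow>\<^sub>E digit_vecs b n. f (grid_point b n s a)) / real b ^ (n * s) - (LINT x|unit_cube_measure s. f x)\<bar>
     \<le> sqrt (C * real s / real b ^ n)"
proof -
  let ?M = "unit_cube_measure s"
  interpret M: finite_measure ?M by (rule finite_measure_unit_cube)
  have b0: "b > 0" using b by simp
  define V where "V n = ({1..s} \<rightarrow>\<^sub>E digit_vecs b n)" for n
  define cell where "cell n a = (\<Pi>\<^sub>E j\<in>{1..s}. radix_cell b n (a j))" for n a
  define stp where "stp n x = (\<Sum>a\<in>V n. f (grid_point b n s a) * indicator (cell n a) x)" for n x
  define \<delta> where "\<delta> n = sqrt (C * real s / real b ^ n)" for n
  have \<delta>0: "\<delta> n \<ge> 0" for n using C by (simp add: \<delta>_def)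
  have finV: "finite (V n)" for n unfolding V_def by (intro finite_PiE) auto
  have vec: "a j \<in> digit_vecs b n" if "a \<in> V n" "j \<in> {1..s}" for a j n
    using that unfolding V_def by (rule PiE_mem)
  have cell_sets: "cell n a \<in> sets ?M" if "a \<in> V n" for n a
    unfolding cell_def using radix_cell_subset[OF b0 vec[OF that]]
    by (intro box_in_sets) (auto simp: radix_cell_def)
  have cell_measure: "measure ?M (cell n a) = 1 / real b ^ (n * s)" if "a \<in> V n" for n a
  proof -
    have "emeasure ?M (cell n a) = (\<Prod>j=1..s. emeasure lborel (radix_cell b n (a j)))"
      unfolding cell_def using radix_cell_subset[OF b0 vec[OF that]]
      by (intro emeasure_box) (auto simp: radix_cell_def)
    also have "\<dots> = (\<Prod>j=1..s. ennreal (1 / real b ^ n))"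
      by (intro prod.cong refl) (simp add: radix_cell_def)
    also have "\<dots> = ennreal ((1 / real b ^ n) ^ s)" by (simp add: ennreal_power)
    finally show ?thesis by (simp add: measure_def power_mult power_one_over)
  qed
  have partition: "(\<Sum>a\<in>V n. indicator (cell n a) x) = (1::real)" if x: "x \<in> unit_cube s" for n x
  proof -
    have "indicator (cell n a) x = (\<Prod>j=1..s. indicator (radix_cell b n (a j)) (x j) :: real)" for a
    proof (cases "x \<in> cell n a")
      case True
      then have "indicator (radix_cell b n (a j)) (x j) = (1::real)" if "j \<in> {1..s}" for j
        using that by (auto simp: cell_def PiE_iff)
      then show ?thesis using True by simp
    next
      case False
      then obtain j where "j \<in> {1..s}" "x j \<notin> radix_cell b n (a j)"
        using x by (auto simp: cell_def unit_cube_def PiE_iff)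
      then have "(\<Prod>j=1..s. indicator (radix_cell b n (a j)) (x j) :: real) = 0"
        by (intro prod_zero bexI[of _ j]) auto
      then show ?thesis using False by simp
    qed
    then have "(\<Sum>a\<in>V n. indicator (cell n a) x) = (\<Sum>a\<in>V n. \<Prod>j=1..s. indicator (radix_cell b n (a j)) (x j) :: real)"
      by simp
    also have "\<dots> = (\<Prod>j=1..s. \<Sum>a\<in>digit_vecs b n. indicator (radix_cell b n a) (x j))"
      unfolding V_def by (subst prod_sum_PiE) auto
    also have "\<dots> = 1"
      using x b0 by (intro prod.neutral ballI sum_indicator_radix_cell) (auto simp: unit_cube_def)
    finally show ?thesis .
  qed
  have close: "\<bar>f x - f (grid_point b n s a)\<bar> \<le> \<delta> n" if a: "a \<in> V n" and x: "x \<in> cell n a" for n a x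
  proof -
    have x': "x \<in> unit_cube s"
      using x radix_cell_subset[OF b0 vec[OF a]] unfolding cell_def unit_cube_def
      by (meson PiE_mono subsetD)
    have g: "grid_point b n s a \<in> unit_cube s"
      using radix_val_nonneg radix_val_less_1[OF b0 vec[OF a]] by (auto simp: grid_point_def unit_cube_def)
    have "(f x - f (grid_point b n s a))\<^sup>2 \<le> C * (\<Sum>j=1..s. \<bar>x j - grid_point b n s a j\<bar>)"
      by (rule hoelder[OF x' g])
    also have "\<dots> \<le> C * (\<Sum>j=1..s. 1 / real b ^ n)"
    proof (intro mult_left_mono sum_mono C)
      fix j assume j: "j \<in> {1..s}"
      then have "x j \<in> radix_cell b n (a j)" using x by (auto simp: cell_def)
      then show "\<bar>x j - grid_point b n s a j\<bar> \<le> 1 / real b ^ n" using j by (auto simp: grid_point_def radix_cell_def)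
    qed
    finally have "(f x - f (grid_point b n s a))\<^sup>2 \<le> C * real s / real b ^ n" by simp
    then show ?thesis unfolding \<delta>_def by (intro real_le_rsqrt) simp
  qed
  have approx: "\<bar>f x - stp n x\<bar> \<le> \<delta> n" if x: "x \<in> unit_cube s" for n x
  proof -
    have "f x - stp n x = (\<Sum>a\<in>V n. (f x - f (grid_point b n s a)) * indicator (cell n a) x)"
      using partition[OF x, of n]
      by (simp add: stp_def left_diff_distrib sum_subtractf flip: sum_distrib_left)
    also have "\<bar>\<dots>\<bar> \<le> (\<Sum>a\<in>V n. \<delta> n * indicator (cell n a) x)"
      using close by (intro order_trans[OF sum_abs] sum_mono) (auto simp: indicator_def)
    also have "\<dots> = \<delta> n" using partition[OF x, of n] by (simp flip: sum_distrib_left)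
    finally show ?thesis .
  qed
  have stp_meas: "stp n \<in> borel_measurable ?M" for n
    unfolding stp_def[abs_def] using cell_sets
    by (intro borel_measurable_sum borel_measurable_times borel_measurable_const borel_measurable_indicator) auto
  have \<delta>_lim: "\<delta> \<longlonglongrightarrow> 0"
  proof -
    have "(\<lambda>n. C * real s * (1 / real b) ^ n) \<longlonglongrightarrow> C * real s * 0"
      using b by (intro tendsto_mult tendsto_const LIMSEQ_realpow_zero) auto
    then have "(\<lambda>n. sqrt (C * real s * (1 / real b) ^ n)) \<longlonglongrightarrow> sqrt (C * real s * 0)"
      by (rule tendsto_real_sqrt)
    then show ?thesis by (simp add: \<delta>_def[abs_def] power_one_over)
  qed
  have f_meas: "f \<in> borel_measurable ?M"
  proof (rule borel_measurable_LIMSEQ_real[OF _ stp_meas])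
    fix x assume "x \<in> space ?M"
    then have x: "x \<in> unit_cube s" by (simp add: space_unit_cube_measure)
    have "(\<lambda>n. stp n x - f x) \<longlonglongrightarrow> 0"
      by (rule Lim_null_comparison[OF _ \<delta>_lim]) (use approx[OF x] in \<open>simp add: abs_minus_commute\<close>)
    then show "(\<lambda>n. stp n x) \<longlonglongrightarrow> f x" by (simp add: LIM_zero_iff)
  qed
  have int_cell: "integrable ?M (\<lambda>x. c * indicator (cell n a) x)" if "a \<in> V n" for a n and c :: real
    using cell_sets[OF that] M.emeasure_finite by (intro integrable_mult_right integrable_real_indicator) (auto simp flip: less_top)
  then have int_stp: "integrable ?M (stp n)" for n
    unfolding stp_def[abs_def] by (intro Bochner_Integration.integrable_sum) auto
  have int_diff: "integrable ?M (\<lambda>x. f x - stp n x)" for n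
    using approx f_meas stp_meas
    by (intro M.integrable_const_bound[of _ "\<delta> n"] AE_I2 borel_measurable_diff) (auto simp: space_unit_cube_measure)
  have int_f: "integrable ?M f"
    using Bochner_Integration.integrable_add[OF int_diff int_stp, of n n] by simp
  have "(LINT x|?M. stp n x) = (\<Sum>a\<in>V n. f (grid_point b n s a) * measure ?M (cell n a))"
    unfolding stp_def using int_cell cell_sets
    by (subst Bochner_Integration.integral_sum) (auto intro!: sum.cong simp: sets.Int_space_eq2)
  also have "\<dots> = (\<Sum>a\<in>V n. f (grid_point b n s a)) / real b ^ (n * s)"
    using cell_measure by (simp add: sum_divide_distrib)
  finally have int_eq: "(LINT x|?M. stp n x) = (\<Sum>a\<in>V n. f (grid_point b n s a)) / real b ^ (n * s)" .
  have "\<bar>(LINT x|?M. stp n x) - (LINT x|?M. f x)\<bar> = \<bar>LINT x|?M. f x - stp n x\<bar>"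
    using int_f int_stp by (simp add: abs_minus_commute)
  also have "\<dots> \<le> (LINT x|?M. \<bar>f x - stp n x\<bar>)" by (rule integral_abs_bound)
  also have "\<dots> \<le> (LINT x|?M. \<delta> n)"
    using int_diff approx by (intro integral_mono) (auto simp: space_unit_cube_measure)
  also have "\<dots> = \<delta> n"
    using emeasure_unit_cube by (simp add: space_unit_cube_measure measure_def)
  finally show ?thesis unfolding int_eq V_def \<delta>_def .
qed

end

subsection \<open>Walsh sums over nets and grids\<close>

lemma sum_digit_expansion_prod:
  fixes f :: "nat \<Rightarrow> nat \<Rightarrow> 'a::comm_semiring_1"
  assumes "b > 0"
  shows "(\<Sum>h<b ^ m. \<Prod>v<m. f v (h div b ^ v mod b)) = (\<Prod>v<m. \<Sum>d<b. f v d)"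
proof (induction m)
  case (Suc m)
  have "(\<Sum>h<b ^ Suc m. \<Prod>v<Suc m. f v (h div b ^ v mod b))
    = (\<Sum>x\<in>{..<b ^ m} \<times> {..<b}. (\<Prod>v<m. f v (fst x div b ^ v mod b)) * f m (snd x))"
  proof (rule sum.reindex_bij_witness[of _ "\<lambda>x. fst x + b ^ m * snd x" "\<lambda>h. (h mod b ^ m, h div b ^ m)"])
    fix h assume h: "h \<in> {..<b ^ Suc m}"
    show "(h mod b ^ m, h div b ^ m) \<in> {..<b ^ m} \<times> {..<b}"
      using h assms by (auto simp: less_mult_imp_div_less)
    have "h div b ^ v mod b = (h mod b ^ m) div b ^ v mod b" if "v < m" for v
    proof -
      have m: "b ^ m = b ^ v * (b * b ^ (m - Suc v))"
        using that by (simp flip: power_add power_Suc)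
      have "h mod b ^ m = b ^ v * (h div b ^ v mod (b * b ^ (m - Suc v))) + h mod b ^ v"
        unfolding m by (rule mod_mult2_eq)
      then have "(h mod b ^ m) div b ^ v = h div b ^ v mod (b * b ^ (m - Suc v))"
        using assms by simp
      then show ?thesis by (simp add: mod_mod_cancel)
    qed
    moreover have "h div b ^ m < b" using h by (simp add: less_mult_imp_div_less)
    ultimately show "(\<Prod>v<m. f v (fst (h mod b ^ m, h div b ^ m) div b ^ v mod b)) * f m (snd (h mod b ^ m, h div b ^ m))
       = (\<Prod>v<Suc m. f v (h div b ^ v mod b))"
      by simp
  next
    fix x assume x: "x \<in> {..<b ^ m} \<times> {..<b}"
    have "fst x + b ^ m * snd x < b ^ m * (snd x + 1)" using x by auto
    also have "\<dots> \<le> b ^ m * b" using x by (intro mult_le_mono) auto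
    finally show "fst x + b ^ m * snd x \<in> {..<b ^ Suc m}" by (simp add: mult.commute)
    show "((fst x + b ^ m * snd x) mod b ^ m, (fst x + b ^ m * snd x) div b ^ m) = x"
      using x assms by (auto simp: prod_eq_iff)
  qed auto
  also have "\<dots> = (\<Sum>h<b ^ m. \<Prod>v<m. f v (h div b ^ v mod b)) * (\<Sum>d<b. f m d)"
    unfolding sum.cartesian_product' by (simp add: sum_product)
  finally show ?case by (simp add: Suc.IH mult.commute)
qed simp

definition net_digits :: "nat \<Rightarrow> nat \<Rightarrow> nat \<Rightarrow> nat \<Rightarrow> (nat \<Rightarrow> nat \<Rightarrow> nat \<Rightarrow> nat) \<Rightarrow> nat \<Rightarrow> nat \<Rightarrow> nat \<Rightarrow> nat" where
  "net_digits b n m s C h = (\<lambda>j\<in>{1..s}. \<lambda>i. if i < n then net_digit b m C (Suc i) h j else 0)"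

lemma net_digits_in: "b > 0 \<Longrightarrow> net_digits b n m s C h \<in> {1..s} \<rightarrow>\<^sub>E digit_vecs b n"
  by (auto simp: net_digits_def digit_vecs_def net_digit_def)

definition multi_walsh :: "nat \<Rightarrow> nat \<Rightarrow> nat \<Rightarrow> (nat \<Rightarrow> nat \<Rightarrow> nat) \<Rightarrow> (nat \<Rightarrow> nat \<Rightarrow> nat) \<Rightarrow> complex" where
  "multi_walsh b n s \<kappa> a = (\<Prod>j=1..s. walsh b n (\<kappa> j) (a j))"

text \<open>The exponent is a linear form in the digits of h with coefficients \<open>c v\<close>,
  so the sum over h splits into one character sum per digit. Reducing the net digits modulo b is
  harmless since \<open>root1 b ^ b = 1\<close>.\<close>

lemma multi_walsh_net:
  assumes "b > 0"
  shows "(\<Sum>h<b ^ m. multi_walsh b n s \<kappa> (net_digits b n m s C h))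
    = (if \<forall>v\<in>{1..m}. b dvd (\<Sum>j=1..s. \<Sum>p<n. \<kappa> j p * C j (Suc p) v) then of_nat (b ^ m) else 0)"
proof -
  define c where "c v = (\<Sum>j=1..s. \<Sum>p<n. \<kappa> j p * C j (Suc p) (Suc v))" for v
  have "multi_walsh b n s \<kappa> (net_digits b n m s C h) = (\<Prod>v<m. root1 b ^ (c v * (h div b ^ v mod b)))" for h
  proof -
    have digit: "root1 b ^ (k * net_digit b m C i h j) = root1 b ^ (\<Sum>v<m. k * C j i (Suc v) * (h div b ^ v mod b))" for k i j
    proof -
      have "net_digit b m C i h j = (\<Sum>v<m. C j i (Suc v) * (h div b ^ v mod b)) mod b"
        unfolding net_digit_def
        by (intro arg_cong2[where f = "(mod)"] refl sum.reindex_bij_witness[of _ Suc "\<lambda>v. v - 1"]) auto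
      then have "root1 b ^ (k * net_digit b m C i h j) = root1 b ^ ((k * (\<Sum>v<m. C j i (Suc v) * (h div b ^ v mod b))) mod b)"
        by (metis assms mod_mult_right_eq root1_power_mod)
      then show ?thesis by (simp add: root1_power_mod[OF assms] sum_distrib_left mult.assoc)
    qed
    have "multi_walsh b n s \<kappa> (net_digits b n m s C h)
      = (\<Prod>j=1..s. \<Prod>p<n. root1 b ^ (\<kappa> j p * net_digit b m C (Suc p) h j))"
      by (simp add: multi_walsh_def net_digits_def walsh_prod)
    also have "\<dots> = root1 b ^ (\<Sum>j=1..s. \<Sum>p<n. \<Sum>v<m. \<kappa> j p * C j (Suc p) (Suc v) * (h div b ^ v mod b))"
      by (simp add: digit power_sum)
    also have "(\<Sum>j=1..s. \<Sum>p<n. \<Sum>v<m. \<kappa> j p * C j (Suc p) (Suc v) * (h div b ^ v mod b))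
      = (\<Sum>j=1..s. \<Sum>v<m. \<Sum>p<n. \<kappa> j p * C j (Suc p) (Suc v) * (h div b ^ v mod b))"
      by (intro sum.cong refl sum.swap)
    also have "\<dots> = (\<Sum>v<m. \<Sum>j=1..s. \<Sum>p<n. \<kappa> j p * C j (Suc p) (Suc v) * (h div b ^ v mod b))"
      by (rule sum.swap)
    also have "\<dots> = (\<Sum>v<m. c v * (h div b ^ v mod b))"
      by (simp add: c_def sum_distrib_right)
    finally show ?thesis by (simp add: power_sum)
  qed
  then have "(\<Sum>h<b ^ m. multi_walsh b n s \<kappa> (net_digits b n m s C h)) = (\<Prod>v<m. \<Sum>d<b. root1 b ^ (c v * d))"
    by (simp add: sum_digit_expansion_prod[OF assms, where f = "\<lambda>v d. root1 b ^ (c v * d)"])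
  also have "\<dots> = (\<Prod>v<m. if b dvd c v then of_nat b else 0)"
    by (intro prod.cong refl sum_root1_powers assms)
  also have "\<dots> = (if \<forall>v<m. b dvd c v then of_nat (b ^ m) else 0)"
    by (auto intro!: prod_zero)
  also have "(\<forall>v<m. b dvd c v) \<longleftrightarrow> (\<forall>v\<in>{1..m}. b dvd (\<Sum>j=1..s. \<Sum>p<n. \<kappa> j p * C j (Suc p) v))"
  proof
    assume *: "\<forall>v<m. b dvd c v"
    show "\<forall>v\<in>{1..m}. b dvd (\<Sum>j=1..s. \<Sum>p<n. \<kappa> j p * C j (Suc p) v)"
    proof
      fix v assume "v \<in> {1..m}"
      then obtain v' where "v = Suc v'" "v' < m" by (cases v) auto
      then show "b dvd (\<Sum>j=1..s. \<Sum>p<n. \<kappa> j p * C j (Suc p) v)" using * by (simp add: c_def)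
    qed
  next
    assume *: "\<forall>v\<in>{1..m}. b dvd (\<Sum>j=1..s. \<Sum>p<n. \<kappa> j p * C j (Suc p) v)"
    show "\<forall>v<m. b dvd c v"
    proof (intro allI impI)
      fix v assume "v < m"
      then have "Suc v \<in> {1..m}" by simp
      then show "b dvd c v" using * unfolding c_def by blast
    qed
  qed
  finally show ?thesis .
qed

lemma multi_walsh_grid:
  assumes "b > 0" "\<kappa> \<in> {1..s} \<rightarrow>\<^sub>E digit_vecs b n"
  shows "(\<Sum>a\<in>{1..s} \<rightarrow>\<^sub>E digit_vecs b n. multi_walsh b n s \<kappa> a)
    = (if \<kappa> = (\<lambda>j\<in>{1..s}. \<lambda>_. 0) then of_nat (b ^ (n * s)) else 0)"
proof -
  have "(\<Sum>a\<in>{1..s} \<rightarrow>\<^sub>E digit_vecs b n. multi_walsh b n s \<kappa> a)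
    = (\<Prod>j=1..s. \<Sum>a\<in>digit_vecs b n. walsh b n (\<kappa> j) a)"
    unfolding multi_walsh_def by (subst prod_sum_PiE) auto
  also have "\<dots> = (\<Prod>j=1..s. if \<kappa> j = (\<lambda>_. 0) then of_nat b ^ n else 0)"
  proof (rule prod.cong[OF refl])
    fix j assume "j \<in> {1..s}"
    then have "\<kappa> j \<in> digit_vecs b n" using assms(2) by (meson PiE_mem)
    moreover have "(\<lambda>_. 0) \<in> digit_vecs b n" using assms(1) by (simp add: digit_vecs_def)
    moreover have "walsh b n (\<lambda>_. 0) a = 1" for a by (simp add: walsh_def)
    ultimately show "(\<Sum>a\<in>digit_vecs b n. walsh b n (\<kappa> j) a) = (if \<kappa> j = (\<lambda>_. 0) then of_nat b ^ n else 0)"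
      using walsh_orthogonal[of b "\<lambda>_. 0" n "\<kappa> j"] assms(1) by auto
  qed
  also have "\<dots> = (if \<forall>j\<in>{1..s}. \<kappa> j = (\<lambda>_. 0) then of_nat (b ^ (n * s)) else 0)"
    by (auto intro!: prod_zero simp: power_mult)
  also have "(\<forall>j\<in>{1..s}. \<kappa> j = (\<lambda>_. 0)) \<longleftrightarrow> \<kappa> = (\<lambda>j\<in>{1..s}. \<lambda>_. 0)"
  proof
    assume "\<forall>j\<in>{1..s}. \<kappa> j = (\<lambda>_. 0)"
    then show "\<kappa> = (\<lambda>j\<in>{1..s}. \<lambda>_. 0)"
      using assms(2) by (intro PiE_ext[of \<kappa> "{1..s}" "\<lambda>_. digit_vecs b n"]) (auto simp: assms(1) digit_vecs_def)
  qed auto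
  finally show ?thesis .
qed

text \<open>Each kernel factor is replaced by its Walsh expansion. The sums over points then collect
  into \<open>\<phi>\<close>, the transform of the weights, and the form moves from points to
  frequencies.\<close>

lemma quadratic_form_walsh:
  fixes c :: "(nat \<Rightarrow> nat \<Rightarrow> nat) \<Rightarrow> real" and F :: "real \<Rightarrow> real \<Rightarrow> real" and b n s :: nat
  assumes "b > 0"
  defines "V \<equiv> {1..s} \<rightarrow>\<^sub>E digit_vecs b n"
  defines "\<phi> \<equiv> \<lambda>\<kappa>. \<Sum>a\<in>V. of_real (c a) * multi_walsh b n s \<kappa> a"
  shows "of_real (\<Sum>a\<in>V. \<Sum>a'\<in>V. c a * c a' * (\<Prod>j=1..s. F (radix_val b n (a j)) (radix_val b n (a' j))))
    = (\<Sum>\<kappa>\<in>V. \<Sum>\<mu>\<in>V. (\<Prod>j=1..s. walsh_coeff2 b n F (\<kappa> j) (\<mu> j)) * (\<phi> \<kappa> * cnj (\<phi> \<mu>)))"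
proof -
  let ?D = "digit_vecs b n" and ?w = "walsh b n" and ?W = "multi_walsh b n s"
  let ?K = "\<lambda>\<kappa> \<mu>. \<Prod>j=1..s. walsh_coeff2 b n F (\<kappa> j) (\<mu> j)"
  have expand: "of_real (\<Prod>j=1..s. F (radix_val b n (a j)) (radix_val b n (a' j)))
    = (\<Sum>\<kappa>\<in>V. \<Sum>\<mu>\<in>V. ?K \<kappa> \<mu> * (?W \<kappa> a * cnj (?W \<mu> a')))" if a: "a \<in> V" "a' \<in> V" for a a'
  proof -
    have "of_real (\<Prod>j=1..s. F (radix_val b n (a j)) (radix_val b n (a' j)))
      = (\<Prod>j=1..s. \<Sum>k\<in>?D. \<Sum>l\<in>?D. walsh_coeff2 b n F k l * (?w k (a j) * cnj (?w l (a' j))))"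
      unfolding of_real_prod
    proof (rule prod.cong[OF refl])
      fix j assume "j \<in> {1..s}"
      then have "a j \<in> ?D" "a' j \<in> ?D" using a unfolding V_def by (auto simp: PiE_iff)
      then show "of_real (F (radix_val b n (a j)) (radix_val b n (a' j)))
        = (\<Sum>k\<in>?D. \<Sum>l\<in>?D. walsh_coeff2 b n F k l * (?w k (a j) * cnj (?w l (a' j))))"
        by (rule walsh_coeff2_inversion[OF assms(1), where F = F])
    qed
    also have "\<dots> = (\<Sum>\<kappa>\<in>V. \<Prod>j=1..s. \<Sum>l\<in>?D. walsh_coeff2 b n F (\<kappa> j) l * (?w (\<kappa> j) (a j) * cnj (?w l (a' j))))"
      unfolding V_def by (subst prod_sum_PiE) auto
    also have "\<dots> = (\<Sum>\<kappa>\<in>V. \<Sum>\<mu>\<in>V. \<Prod>j=1..s. walsh_coeff2 b n F (\<kappa> j) (\<mu> j) * (?w (\<kappa> j) (a j) * cnj (?w (\<mu> j) (a' j))))"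
      unfolding V_def by (intro sum.cong refl, subst prod_sum_PiE) auto
    finally show ?thesis by (simp add: prod.distrib multi_walsh_def)
  qed
  have "of_real (\<Sum>a\<in>V. \<Sum>a'\<in>V. c a * c a' * (\<Prod>j=1..s. F (radix_val b n (a j)) (radix_val b n (a' j))))
    = (\<Sum>a\<in>V. \<Sum>a'\<in>V. \<Sum>\<kappa>\<in>V. \<Sum>\<mu>\<in>V. ?K \<kappa> \<mu> * ((of_real (c a) * ?W \<kappa> a) * cnj (of_real (c a') * ?W \<mu> a')))"
    unfolding of_real_sum
  proof (intro sum.cong refl)
    fix a a' assume "a \<in> V" "a' \<in> V"
    then show "of_real (c a * c a' * (\<Prod>j=1..s. F (radix_val b n (a j)) (radix_val b n (a' j))))
      = (\<Sum>\<kappa>\<in>V. \<Sum>\<mu>\<in>V. ?K \<kappa> \<mu> * ((of_real (c a) * ?W \<kappa> a) * cnj (of_real (c a') * ?W \<mu> a')))"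
      unfolding of_real_mult expand[OF \<open>a \<in> V\<close> \<open>a' \<in> V\<close>] sum_distrib_left
      by (intro sum.cong refl) (simp add: mult_ac)
  qed
  also have "\<dots> = (\<Sum>\<kappa>\<in>V. \<Sum>\<mu>\<in>V. \<Sum>a\<in>V. \<Sum>a'\<in>V. ?K \<kappa> \<mu> * ((of_real (c a) * ?W \<kappa> a) * cnj (of_real (c a') * ?W \<mu> a')))"
    by (rule sum_swap4)
  also have "\<dots> = (\<Sum>\<kappa>\<in>V. \<Sum>\<mu>\<in>V. ?K \<kappa> \<mu> * (\<phi> \<kappa> * cnj (\<phi> \<mu>)))"
  proof -
    have "\<phi> \<kappa> * cnj (\<phi> \<mu>) = (\<Sum>a\<in>V. \<Sum>a'\<in>V. (of_real (c a) * ?W \<kappa> a) * cnj (of_real (c a') * ?W \<mu> a'))" for \<kappa> \<mu>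
      unfolding \<phi>_def cnj_sum sum_product ..
    then show ?thesis by (simp only: sum_distrib_left)
  qed
  finally show ?thesis .
qed

subsection \<open>The worst-case error\<close>

lemma sobolev_kernel_prod_lipschitz:
  assumes "\<alpha> \<ge> 1"
  shows "\<exists>L\<ge>0. \<forall>x\<in>unit_cube s. \<forall>y\<in>unit_cube s. \<forall>z\<in>unit_cube s.
    \<bar>sobolev_kernel_prod \<alpha> s x y - sobolev_kernel_prod \<alpha> s x z\<bar> \<le> L * (\<Sum>j=1..s. \<bar>y j - z j\<bar>)"
proof -
  obtain L where L: "L \<ge> 1" "\<forall>x\<in>{0..<1}. \<forall>y\<in>{0..<1}. \<bar>sobolev_kernel \<alpha> x y\<bar> \<le> L \<and>
    (\<forall>y'\<in>{0..<1}. \<bar>sobolev_kernel \<alpha> x y - sobolev_kernel \<alpha> x y'\<bar> \<le> L * \<bar>y - y'\<bar>)"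
    using sobolev_kernel_bounded_lipschitz[OF assms] by blast
  have "\<bar>sobolev_kernel_prod \<alpha> s x y - sobolev_kernel_prod \<alpha> s x z\<bar> \<le> L ^ s * (\<Sum>j=1..s. \<bar>y j - z j\<bar>)"
    if "x \<in> unit_cube s" "y \<in> unit_cube s" "z \<in> unit_cube s" for x y z
  proof -
    have mem: "x j \<in> {0..<1}" "y j \<in> {0..<1}" "z j \<in> {0..<1}" if "j \<in> {1..s}" for j
      using \<open>x \<in> _\<close> \<open>y \<in> _\<close> \<open>z \<in> _\<close> that unfolding unit_cube_def by (auto simp: PiE_iff)
    \<comment> \<open>Division by L brings all factors into [-1,1], where a difference of products
      is at most the sum of the differences of the factors.\<close>
    let ?k = "\<lambda>y j. sobolev_kernel \<alpha> (x j) (y j) / L"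
    have scale: "sobolev_kernel_prod \<alpha> s x y = L ^ s * (\<Prod>j=1..s. ?k y j)" for y
      using L(1) by (simp add: sobolev_kernel_prod_def prod_dividef)
    have "\<bar>(\<Prod>j=1..s. ?k y j) - (\<Prod>j=1..s. ?k z j)\<bar> \<le> (\<Sum>j=1..s. \<bar>?k y j - ?k z j\<bar>)"
      using norm_prod_diff[of "{1..s}" "?k y" "?k z"] L mem by (simp add: divide_le_eq)
    also have "\<dots> \<le> (\<Sum>j=1..s. \<bar>y j - z j\<bar>)"
    proof (rule sum_mono)
      fix j assume j: "j \<in> {1..s}"
      have "\<bar>sobolev_kernel \<alpha> (x j) (y j) - sobolev_kernel \<alpha> (x j) (z j)\<bar> \<le> L * \<bar>y j - z j\<bar>"
        using L mem[OF j] by blast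
      then show "\<bar>?k y j - ?k z j\<bar> \<le> \<bar>y j - z j\<bar>"
        using L(1) by (simp add: divide_le_eq mult.commute flip: diff_divide_distrib)
    qed
    finally have "L ^ s * \<bar>(\<Prod>j=1..s. ?k y j) - (\<Prod>j=1..s. ?k z j)\<bar> \<le> L ^ s * (\<Sum>j=1..s. \<bar>y j - z j\<bar>)"
      using L(1) by (intro mult_left_mono) auto
    then show ?thesis
      unfolding scale using L(1) by (simp add: abs_mult flip: right_diff_distrib)
  qed
  then show ?thesis using L(1) by (intro exI[of _ "L ^ s"]) auto
qed

lemma net_point_eq_grid_point: "net_point b n m s C h = grid_point b n s (net_digits b n m s C h)"
proof -
  have "(\<Sum>i=1..n. real (net_digit b m C i h j) / real b ^ i) = (\<Sum>i<n. real (net_digit b m C (Suc i) h j) / real b ^ Suc i)" for j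
    by (rule sum.reindex_bij_witness[of _ Suc "\<lambda>i. i - 1"]) auto
  then show ?thesis
    by (auto simp: net_point_def grid_point_def net_digits_def radix_val_def fun_eq_iff)
qed

lemma grid_point_in_unit_cube:
  assumes "b > 0" "a \<in> {1..s} \<rightarrow>\<^sub>E digit_vecs b n"
  shows "grid_point b n s a \<in> unit_cube s"
proof -
  have "a j \<in> digit_vecs b n" if "j \<in> {1..s}" for j using assms(2) that by (rule PiE_mem)
  then show ?thesis
    using radix_val_nonneg radix_val_less_1[OF assms(1)] by (auto simp: grid_point_def unit_cube_def)
qed

text \<open>Net average minus grid average as one weighted sum over the grid, with repeated net
  points counted by the cardinality. A general normed field allows both complex characters and real
  function values for G.\<close>

lemma sum_weights:
  fixes nd :: "nat \<Rightarrow> 'a" and G :: "'a \<Rightarrow> 'b::real_normed_field"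
  assumes "finite V" "\<And>h. h < N \<Longrightarrow> nd h \<in> V"
  shows "(\<Sum>a\<in>V. of_real (real (card {h. h < N \<and> nd h = a}) / real N - 1 / real M) * G a)
    = (\<Sum>h<N. G (nd h)) / of_nat N - (\<Sum>a\<in>V. G a) / of_nat M"
proof -
  have "(\<Sum>h<N. G (nd h)) = (\<Sum>a\<in>V. \<Sum>h\<in>{h \<in> {..<N}. nd h = a}. G (nd h))"
    using assms by (intro sum.group[symmetric]) auto
  also have "\<dots> = (\<Sum>a\<in>V. of_nat (card {h. h < N \<and> nd h = a}) * G a)"
    by (intro sum.cong refl) simp
  finally show ?thesis
    by (simp add: left_diff_distrib sum_subtractf sum_divide_distrib)
qed

lemma net_grid_difference:
  fixes s \<alpha> \<beta> b :: nat
  assumes s: "s \<ge> 1" and \<alpha>: "\<alpha> \<ge> 1" and \<beta>: "\<beta> \<ge> 2 * \<alpha>" and b: "prime b"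
  shows "\<exists>C\<ge>0. \<forall>g w B V ip f. g \<ge> 2 * \<alpha> * s \<longrightarrow>
    (\<forall>j\<in>{1..\<beta> * s}. \<forall>l\<in>{1..g}. B j l < b) \<longrightarrow>
    inj_on (\<lambda>(j, l). B j l) ({1..\<beta> * s} \<times> {1..g}) \<longrightarrow>
    is_sobolev_space \<alpha> s V ip \<longrightarrow> f \<in> V \<longrightarrow> ip f f \<le> 1 \<longrightarrow>
    ((\<Sum>h<b ^ (g * w). f (net_point b (\<beta> * g * w) (g * w) s (interlace \<beta> (chen_skriganov_matrix b w B)) h)) / real (b ^ (g * w))
      - (\<Sum>a\<in>{1..s} \<rightarrow>\<^sub>E digit_vecs b (\<beta> * g * w). f (grid_point b (\<beta> * g * w) s a)) / real (b ^ (\<beta> * g * w * s)))\<^sup>2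
    \<le> C * real (\<beta> * g * w + 1) ^ (s - 1) / real b ^ (2 * \<alpha> * (g * w))"
proof -
  have b2: "b \<ge> 2" using b by (rule prime_ge_2_nat)
  then have b0: "b > 0" by simp
  have "\<forall>S. \<exists>T A. finite S \<longrightarrow> is_top_part \<alpha> S T A" using top_part_exists[OF _ \<alpha>] by blast
  then obtain T A where TA: "\<And>S. finite S \<Longrightarrow> is_top_part \<alpha> S (T S) (A S)" by metis
  obtain C0 where C0: "C0 \<ge> 0" "\<And>n k T. k \<in> digit_vecs b n \<Longrightarrow> T \<subseteq> digit_supp k \<Longrightarrow> card T \<le> \<alpha> \<Longrightarrow>
    norm (walsh_coeff2 b n (sobolev_kernel \<alpha>) k k) \<le> C0 / real b ^ (2 * pos_sum T)"
    using walsh_coeff2_sobolev_kernel_diag_bound[OF \<alpha> b2] by blast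
  define C1 where "C1 = real b ^ (2 * s * \<alpha> * \<beta>) * exp (real b * (1 / (1 - real b powr (-1/2)))) ^ s * 4"
  have C1: "C1 \<ge> 0" by (simp add: C1_def)
  have main: "((\<Sum>h<b ^ (g * w). f (net_point b (\<beta> * g * w) (g * w) s (interlace \<beta> (chen_skriganov_matrix b w B)) h)) / real (b ^ (g * w))
      - (\<Sum>a\<in>{1..s} \<rightarrow>\<^sub>E digit_vecs b (\<beta> * g * w). f (grid_point b (\<beta> * g * w) s a)) / real (b ^ (\<beta> * g * w * s)))\<^sup>2
    \<le> (C0 ^ s * C1) * real (\<beta> * g * w + 1) ^ (s - 1) / real b ^ (2 * \<alpha> * (g * w))"
    if g: "g \<ge> 2 * \<alpha> * s" and B: "\<forall>j\<in>{1..\<beta> * s}. \<forall>l\<in>{1..g}. B j l < b"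
      and inj: "inj_on (\<lambda>(j, l). B j l) ({1..\<beta> * s} \<times> {1..g})"
      and space: "is_sobolev_space \<alpha> s V ip" and f: "f \<in> V" "ip f f \<le> 1"
    for g w and B :: "nat \<Rightarrow> nat \<Rightarrow> nat" and V ip f
  proof -
    define n where "n = \<beta> * g * w"
    define m where "m = g * w"
    let ?D = "interlace \<beta> (chen_skriganov_matrix b w B)"
    define nd where "nd = net_digits b n m s ?D"
    define G where "G = {1..s} \<rightarrow>\<^sub>E digit_vecs b n"
    define zero :: "nat \<Rightarrow> nat \<Rightarrow> nat" where "zero = (\<lambda>j\<in>{1..s}. \<lambda>_. 0)"
    define dual where "dual = dual_net b s \<beta> g w B"
    define c where "c a = real (card {h. h < b ^ m \<and> nd h = a}) / real (b ^ m) - 1 / real (b ^ (n * s))" for a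
    define \<phi> where "\<phi> \<kappa> = (\<Sum>a\<in>G. of_real (c a) * multi_walsh b n s \<kappa> a)" for \<kappa>
    define Q where "Q = (\<Sum>a\<in>G. \<Sum>a'\<in>G. c a * c a' * (\<Prod>j=1..s. sobolev_kernel \<alpha> (radix_val b n (a j)) (radix_val b n (a' j))))"
    let ?W = "walsh_coeff2 b n (sobolev_kernel \<alpha>)"
    interpret R: reproducing_kernel_hilbert_space "unit_cube s" V ip "sobolev_kernel_prod \<alpha> s"
      by (rule space)
    have B': "\<And>j l. j \<in> {1..\<beta> * s} \<Longrightarrow> l \<in> {1..g} \<Longrightarrow> B j l < b" using B by blast
    have dual_def': "dual_net b s \<beta> g w B = {\<kappa> \<in> {1..s} \<rightarrow>\<^sub>E digit_vecs b (\<beta> * g * w).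
        \<forall>v\<in>{1..g * w}. b dvd (\<Sum>j=1..s. \<Sum>p<\<beta> * g * w. \<kappa> j p * ?D j (Suc p) v)}"
      using B' by (intro dual_net_def[OF b _ inj])
    have finG: "finite G" unfolding G_def by (intro finite_PiE) auto
    have nd_in: "nd h \<in> G" for h unfolding nd_def G_def by (rule net_digits_in[OF b0])
    have dual_sub: "dual \<subseteq> G"
      unfolding dual_def dual_def' G_def n_def by auto
    have zero_dual: "zero \<in> dual"
      unfolding dual_def dual_def' zero_def using b0 by (auto simp: digit_vecs_def)
    have dual_iff: "\<kappa> \<in> dual \<longleftrightarrow> (\<forall>v\<in>{1..m}. b dvd (\<Sum>j=1..s. \<Sum>p<n. \<kappa> j p * ?D j (Suc p) v))" if "\<kappa> \<in> G" for \<kappa>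
      using that unfolding dual_def dual_def' G_def n_def m_def by simp
    have weights: "(\<Sum>a\<in>G. of_real (c a) * H a) = (\<Sum>h<b ^ m. H (nd h)) / of_nat (b ^ m) - (\<Sum>a\<in>G. H a) / of_nat (b ^ (n * s))"
      for H :: "(nat \<Rightarrow> nat \<Rightarrow> nat) \<Rightarrow> 'c::real_normed_field"
      unfolding c_def by (rule sum_weights[OF finG nd_in])
    \<comment> \<open>The net average of a character is 1 on the dual net and 0 elsewhere, the grid
      average is 1 at zero only; the difference is the indicator of the nonzero dual
      elements.\<close>
    have \<phi>: "\<phi> \<kappa> = (if \<kappa> \<in> dual - {zero} then 1 else 0)" if \<kappa>: "\<kappa> \<in> G" for \<kappa>
    proof -
      have "\<phi> \<kappa> = (if \<kappa> \<in> dual then 1 else 0) - (if \<kappa> = zero then 1 else 0)"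
        unfolding \<phi>_def weights nd_def multi_walsh_net[OF b0] dual_iff[OF \<kappa>]
        using multi_walsh_grid[OF b0 \<kappa>[unfolded G_def]] b0 unfolding G_def[symmetric] zero_def[symmetric] by auto
      then show ?thesis using zero_dual by auto
    qed
    \<comment> \<open>A nonzero product allows at most 2\<alpha> differing digits per coordinate,
      hence at most 2\<alpha> s \<le> g in total, too few for distinct dual elements.\<close>
    have off: "(\<Prod>j=1..s. ?W (\<kappa> j) (\<mu> j)) = 0" if \<kappa>: "\<kappa> \<in> dual" and \<mu>: "\<mu> \<in> dual" and ne: "\<kappa> \<noteq> \<mu>" for \<kappa> \<mu>
    proof (rule ccontr)
      assume nz: "(\<Prod>j=1..s. ?W (\<kappa> j) (\<mu> j)) \<noteq> 0"
      have "card {p. \<kappa> j p \<noteq> \<mu> j p} \<le> 2 * \<alpha>" if j: "j \<in> {1..s}" for j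
      proof (rule ccontr)
        assume "\<not> card {p. \<kappa> j p \<noteq> \<mu> j p} \<le> 2 * \<alpha>"
        moreover have "\<kappa> j \<in> digit_vecs b n" "\<mu> j \<in> digit_vecs b n"
          using \<kappa> \<mu> dual_sub j unfolding G_def by (auto simp: PiE_iff)
        ultimately have "?W (\<kappa> j) (\<mu> j) = 0"
          by (intro walsh_coeff2_sobolev_kernel_eq_0[OF \<alpha> b0]) (auto simp: digit_diff_def)
        then show False using nz j by (simp add: prod_zero_iff)
      qed
      then have "(\<Sum>j=1..s. card {p. \<kappa> j p \<noteq> \<mu> j p}) \<le> (\<Sum>j=1..s. 2 * \<alpha>)" by (intro sum_mono)
      also have "\<dots> \<le> g" using g by (simp add: mult_ac)
      finally have "\<kappa> = \<mu>" using \<kappa> \<mu> B' unfolding dual_def by (intro dual_net_hamming[OF b _ inj])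
      with ne show False by simp
    qed
    have "complex_of_real Q = (\<Sum>\<kappa>\<in>G. \<Sum>\<mu>\<in>G. (\<Prod>j=1..s. ?W (\<kappa> j) (\<mu> j)) * (\<phi> \<kappa> * cnj (\<phi> \<mu>)))"
      unfolding Q_def \<phi>_def G_def by (rule quadratic_form_walsh[OF b0])
    also have "\<dots> = (\<Sum>\<kappa>\<in>G. \<Sum>\<mu>\<in>G. if \<mu> = \<kappa> then if \<kappa> \<in> dual - {zero} then \<Prod>j=1..s. ?W (\<kappa> j) (\<kappa> j) else 0 else 0)"
    proof (intro sum.cong refl)
      fix \<kappa> \<mu> assume "\<kappa> \<in> G" "\<mu> \<in> G"
      then show "(\<Prod>j=1..s. ?W (\<kappa> j) (\<mu> j)) * (\<phi> \<kappa> * cnj (\<phi> \<mu>))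
        = (if \<mu> = \<kappa> then if \<kappa> \<in> dual - {zero} then \<Prod>j=1..s. ?W (\<kappa> j) (\<kappa> j) else 0 else 0)"
        using off[of \<kappa> \<mu>] by (auto simp: \<phi>)
    qed
    also have "\<dots> = (\<Sum>\<kappa>\<in>G. if \<kappa> \<in> dual - {zero} then \<Prod>j=1..s. ?W (\<kappa> j) (\<kappa> j) else 0)"
      using finG by (intro sum.cong refl) (simp only: sum.delta if_True)
    also have "\<dots> = (\<Sum>\<kappa>\<in>dual - {zero}. \<Prod>j=1..s. ?W (\<kappa> j) (\<kappa> j))"
      using finG dual_sub by (intro sum.mono_neutral_cong_right) auto
    finally have Q_eq: "complex_of_real Q = (\<Sum>\<kappa>\<in>dual - {zero}. \<Prod>j=1..s. ?W (\<kappa> j) (\<kappa> j))" .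
    have "Q \<le> norm (complex_of_real Q)" by simp
    also have "\<dots> \<le> (\<Sum>\<kappa>\<in>dual - {zero}. \<Prod>j=1..s. C0 * (1 / real b ^ (2 * pos_sum (T (digit_supp (\<kappa> j))))))"
      unfolding Q_eq
    proof (rule sum_norm_le)
      fix \<kappa> assume "\<kappa> \<in> dual - {zero}"
      then have \<kappa>: "\<kappa> \<in> G" using dual_sub by auto
      have "norm (?W (\<kappa> j) (\<kappa> j)) \<le> C0 * (1 / real b ^ (2 * pos_sum (T (digit_supp (\<kappa> j)))))" if j: "j \<in> {1..s}" for j
      proof -
        have v: "\<kappa> j \<in> digit_vecs b n" using \<kappa> j unfolding G_def by (rule PiE_mem)
        have "T (digit_supp (\<kappa> j)) \<subseteq> digit_supp (\<kappa> j)" "card (T (digit_supp (\<kappa> j))) \<le> \<alpha>"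
          using TA[OF finite_digit_supp[OF v]] by (auto simp: is_top_part_def)
        then show ?thesis using C0(2)[OF v] by simp
      qed
      then show "norm (\<Prod>j=1..s. ?W (\<kappa> j) (\<kappa> j)) \<le> (\<Prod>j=1..s. C0 * (1 / real b ^ (2 * pos_sum (T (digit_supp (\<kappa> j))))))"
        unfolding prod_norm[symmetric] by (intro prod_mono) auto
    qed
    also have "\<dots> = C0 ^ s * (\<Sum>\<kappa>\<in>dual - {zero}. \<Prod>j=1..s. 1 / real b ^ (2 * pos_sum (T (digit_supp (\<kappa> j)))))"
      unfolding prod.distrib prod_constant sum_distrib_left by simp
    also have "\<dots> \<le> C0 ^ s * (C1 * real (n + 1) ^ (s - 1) / real b ^ (2 * \<alpha> * m))"
    proof (intro mult_left_mono)
      show "(\<Sum>\<kappa>\<in>dual - {zero}. \<Prod>j=1..s. 1 / real b ^ (2 * pos_sum (T (digit_supp (\<kappa> j)))))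
        \<le> C1 * real (n + 1) ^ (s - 1) / real b ^ (2 * \<alpha> * m)"
        unfolding C1_def zero_def
      proof (rule sum_dual_le[OF b2 s \<alpha> \<beta> _ _ _ TA])
        show "dual \<subseteq> {1..s} \<rightarrow>\<^sub>E digit_vecs b n" using dual_sub unfolding G_def .
        show "(\<lambda>j\<in>{1..s}. \<lambda>_. 0) \<in> dual" using zero_dual unfolding zero_def .
        show "\<kappa> = \<mu>" if "\<kappa> \<in> dual" "\<mu> \<in> dual" "\<And>j p. j \<in> {1..s} \<Longrightarrow> \<kappa> j p \<noteq> \<mu> j p \<Longrightarrow> (j, p) \<in> U"
          "\<And>j p. (j, p + \<beta>) \<in> U \<Longrightarrow> (j, p) \<in> U" "finite U" "card U \<le> m" for \<kappa> \<mu> U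
          using that B' unfolding dual_def m_def
          by (intro dual_net_box[OF b _ inj, where \<kappa> = \<kappa> and \<mu> = \<mu> and U = U]) blast+
      qed
    qed (use C0 in simp)
    finally have Q_le: "Q \<le> (C0 ^ s * C1) * real (n + 1) ^ (s - 1) / real b ^ (2 * \<alpha> * m)" by simp
    have Q0: "0 \<le> (C0 ^ s * C1) * real (n + 1) ^ (s - 1) / real b ^ (2 * \<alpha> * m)"
      using C0 C1 by simp
    \<comment> \<open>\<open>Q\<close> is the squared norm of the functional net minus grid, so its
      Walsh estimate bounds the squared difference for every f in the unit ball.\<close>
    have "(\<Sum>a\<in>G. c a * f (grid_point b n s a))\<^sup>2
      \<le> ip f f * (\<Sum>a\<in>G. \<Sum>a'\<in>G. c a * c a' * sobolev_kernel_prod \<alpha> s (grid_point b n s a) (grid_point b n s a'))"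
      by (intro R.point_functional_bound finG f(1) grid_point_in_unit_cube[OF b0]) (simp add: G_def)
    also have "(\<Sum>a\<in>G. \<Sum>a'\<in>G. c a * c a' * sobolev_kernel_prod \<alpha> s (grid_point b n s a) (grid_point b n s a')) = Q"
      by (simp add: Q_def sobolev_kernel_prod_def grid_point_def)
    also have "ip f f * Q \<le> ip f f * ((C0 ^ s * C1) * real (n + 1) ^ (s - 1) / real b ^ (2 * \<alpha> * m))"
      using Q_le R.ip_nonneg[OF f(1)] by (rule mult_left_mono)
    also have "\<dots> \<le> 1 * ((C0 ^ s * C1) * real (n + 1) ^ (s - 1) / real b ^ (2 * \<alpha> * m))"
      using f(2) Q0 by (rule mult_right_mono)
    also have "(\<Sum>a\<in>G. c a * f (grid_point b n s a)) = (\<Sum>h<b ^ m. f (net_point b n m s ?D h)) / real (b ^ m) - (\<Sum>a\<in>G. f (grid_point b n s a)) / real (b ^ (n * s))"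
      using weights[of "\<lambda>a. f (grid_point b n s a)"] by (simp add: net_point_eq_grid_point nd_def)
    finally show ?thesis unfolding n_def m_def G_def by simp
  qed
  show ?thesis
  proof (intro exI[of _ "C0 ^ s * C1"] conjI allI impI)
    show "0 \<le> C0 ^ s * C1" using C0(1) C1 by simp
  qed (rule main; assumption)
qed

theorem theorem1:
  fixes s \<alpha> \<beta> b :: nat
  assumes "s \<ge> 1" and "\<alpha> \<ge> 2" and "\<beta> \<ge> 2 * \<alpha>" and "prime b"
  shows "\<exists>C > 0. \<forall>(g::nat) (w::nat) (B :: nat \<Rightarrow> nat \<Rightarrow> nat) V ip.
           g \<ge> 1 \<longrightarrow> w \<ge> 1 \<longrightarrow>
           g \<ge> 2 * \<alpha> * s \<longrightarrow> int g \<ge> \<lfloor>real (s * (\<beta> - 1)) / 2\<rfloor> \<longrightarrow> b \<ge> \<beta> * g * s \<longrightarrow>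
           (\<forall>j\<in>{1..\<beta> * s}. \<forall>l\<in>{1..g}. B j l < b) \<longrightarrow>
           inj_on (\<lambda>(j, l). B j l) ({1..\<beta> * s} \<times> {1..g}) \<longrightarrow>
           is_sobolev_space \<alpha> s V ip \<longrightarrow>
           (let P = interlaced_cs_net b s \<beta> g w B; N = b ^ (g * w)
            in size P = N \<and>
               worst_case_error s V (ip_norm ip) P
                 \<le> ereal (C * ln (real N) powr ((real s - 1) / 2) / real N ^ \<alpha>))"
proof -
  have \<alpha>: "\<alpha> \<ge> 1" using assms by simp
  have b2: "b \<ge> 2" using assms(4) by (rule prime_ge_2_nat)
  then have b0: "b > 0" by simp
  obtain C where C: "C \<ge> 0" and net: "\<And>g w B V ip f. g \<ge> 2 * \<alpha> * s \<Longrightarrow>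
    (\<forall>j\<in>{1..\<beta> * s}. \<forall>l\<in>{1..g}. B j l < b) \<Longrightarrow>
    inj_on (\<lambda>(j, l). B j l) ({1..\<beta> * s} \<times> {1..g}) \<Longrightarrow>
    is_sobolev_space \<alpha> s V ip \<Longrightarrow> f \<in> V \<Longrightarrow> ip f f \<le> 1 \<Longrightarrow>
    ((\<Sum>h<b ^ (g * w). f (net_point b (\<beta> * g * w) (g * w) s (interlace \<beta> (chen_skriganov_matrix b w B)) h)) / real (b ^ (g * w))
      - (\<Sum>a\<in>{1..s} \<rightarrow>\<^sub>E digit_vecs b (\<beta> * g * w). f (grid_point b (\<beta> * g * w) s a)) / real (b ^ (\<beta> * g * w * s)))\<^sup>2
    \<le> C * real (\<beta> * g * w + 1) ^ (s - 1) / real b ^ (2 * \<alpha> * (g * w))"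
    using net_grid_difference[OF assms(1) \<alpha> assms(3,4)] by metis
  obtain L where L: "L \<ge> 0" "\<forall>x\<in>unit_cube s. \<forall>y\<in>unit_cube s. \<forall>z\<in>unit_cube s.
    \<bar>sobolev_kernel_prod \<alpha> s x y - sobolev_kernel_prod \<alpha> s x z\<bar> \<le> L * (\<Sum>j=1..s. \<bar>y j - z j\<bar>)"
    using sobolev_kernel_prod_lipschitz[OF \<alpha>] by blast
  define e where "e = (real s - 1) / 2"
  \<comment> \<open>The two roots belong to net against grid and grid against integral. The power
    converts (\<beta> + 1) m, a bound for n + 1, into ln N = m ln b; the final 1 ensures strict
    positivity.\<close>
  define C' where "C' = (sqrt C + sqrt (2 * L * real s)) * ((real \<beta> + 1) / ln (real b)) powr e + 1"
  have e0: "e \<ge> 0" using assms(1) by (simp add: e_def)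
  have lnb: "ln (real b) > 0" using b2 by simp
  have C'0: "C' > 0" unfolding C'_def using C L by (intro add_nonneg_pos mult_nonneg_nonneg) auto
  have "size (interlaced_cs_net b s \<beta> g w B) = b ^ (g * w) \<and>
      worst_case_error s V (ip_norm ip) (interlaced_cs_net b s \<beta> g w B)
       \<le> ereal (C' * ln (real (b ^ (g * w))) powr ((real s - 1) / 2) / real (b ^ (g * w)) ^ \<alpha>)"
    if g: "g \<ge> 1" "w \<ge> 1" "g \<ge> 2 * \<alpha> * s" and B: "\<forall>j\<in>{1..\<beta> * s}. \<forall>l\<in>{1..g}. B j l < b"
      "inj_on (\<lambda>(j, l). B j l) ({1..\<beta> * s} \<times> {1..g})" and space: "is_sobolev_space \<alpha> s V ip"
    for g w B V ip
  proof -
    interpret R: reproducing_kernel_hilbert_space "unit_cube s" V ip "sobolev_kernel_prod \<alpha> s"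
      by (rule space)
    define n where "n = \<beta> * g * w"
    define m where "m = g * w"
    define P where "P = interlaced_cs_net b s \<beta> g w B"
    let ?D = "interlace \<beta> (chen_skriganov_matrix b w B)"
    have m1: "m \<ge> 1" using g by (simp add: m_def)
    have P_eq: "P = image_mset (net_point b n m s ?D) (mset_set {0..<b ^ m})"
      by (simp add: P_def interlaced_cs_net_def digital_net_def n_def m_def)
    have size: "size P = b ^ m" by (simp add: P_eq)
    have sum_P: "(\<Sum>x\<in>#P. f x) = (\<Sum>h<b ^ m. f (net_point b n m s ?D h))" for f :: "(nat \<Rightarrow> real) \<Rightarrow> real"
      by (simp add: P_eq image_mset.compositionality o_def sum_unfold_sum_mset atLeast0LessThan)
    let ?R = "C' * ln (real (b ^ m)) powr e / real (b ^ m) ^ \<alpha>"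
    have "\<bar>(\<Sum>x\<in>#P. f x) / real (size P) - (LINT x|unit_cube_measure s. f x)\<bar> \<le> ?R"
      if f: "f \<in> V" "ip_norm ip f \<le> 1" for f
    proof -
      have ip1: "ip f f \<le> 1" using f(2) by (simp add: ip_norm_def)
      \<comment> \<open>Both kernel differences in \<open>point_difference_bound\<close> are at most
        L times the distance, which gives the factor 2L.\<close>
      have hoelder: "(f x - f y)\<^sup>2 \<le> (2 * L) * (\<Sum>j=1..s. \<bar>x j - y j\<bar>)"
        if x: "x \<in> unit_cube s" and y: "y \<in> unit_cube s" for x y
      proof -
        let ?K = "sobolev_kernel_prod \<alpha> s" and ?S = "\<Sum>j=1..s. \<bar>x j - y j\<bar>"
        have "\<bar>?K x x - ?K x y\<bar> \<le> L * ?S" using L(2) x y by blast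
        moreover have "\<bar>?K y y - ?K y x\<bar> \<le> L * (\<Sum>j=1..s. \<bar>y j - x j\<bar>)" using L(2) x y by blast
        ultimately have le: "(?K x x - ?K x y) + (?K y y - ?K y x) \<le> (2 * L) * ?S"
          by (simp add: abs_minus_commute)
        have S0: "0 \<le> (2 * L) * ?S" using L(1) by (intro mult_nonneg_nonneg sum_nonneg) auto
        have "(f x - f y)\<^sup>2 \<le> ip f f * ((?K x x - ?K x y) + (?K y y - ?K y x))"
          by (rule R.point_difference_bound[OF x y f(1)])
        also have "\<dots> \<le> ip f f * ((2 * L) * ?S)" by (rule mult_left_mono[OF le R.ip_nonneg[OF f(1)]])
        also have "\<dots> \<le> 1 * ((2 * L) * ?S)" using ip1 S0 by (rule mult_right_mono)
        finally show ?thesis by simp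
      qed
      let ?net = "(\<Sum>h<b ^ m. f (net_point b n m s ?D h)) / real (b ^ m)"
      let ?grid = "(\<Sum>a\<in>{1..s} \<rightarrow>\<^sub>E digit_vecs b n. f (grid_point b n s a)) / real b ^ (n * s)"
      let ?int = "LINT x|unit_cube_measure s. f x"
      have N: "real b ^ (\<alpha> * m) > 0" using b0 by simp
      have "(?net - ?grid)\<^sup>2 \<le> C * real (n + 1) ^ (s - 1) / real b ^ (2 * \<alpha> * m)"
        using net[where g = g and w = w and B = B and V = V and ip = ip and f = f, OF g(3) B space f(1) ip1] by (simp add: n_def m_def)
      then have "\<bar>?net - ?grid\<bar> \<le> sqrt (C * real (n + 1) ^ (s - 1) / real b ^ (2 * \<alpha> * m))"
        by (intro real_le_rsqrt) simp
      also have "\<dots> = sqrt C * sqrt (real (n + 1) ^ (s - 1)) / real b ^ (\<alpha> * m)"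
      proof -
        have "real b ^ (2 * \<alpha> * m) = (real b ^ (\<alpha> * m))\<^sup>2" by (simp add: mult_ac flip: power_mult)
        then show ?thesis by (simp add: real_sqrt_divide real_sqrt_mult)
      qed
      also have "sqrt (real (n + 1) ^ (s - 1)) = real (n + 1) powr e"
      proof -
        have "sqrt (real (n + 1) ^ (s - 1)) = (real (n + 1) powr real (s - 1)) powr (1/2)"
          by (simp add: powr_realpow powr_half_sqrt)
        then show ?thesis using assms(1) by (simp add: powr_powr e_def of_nat_diff)
      qed
      also have "sqrt C * real (n + 1) powr e / real b ^ (\<alpha> * m) \<le> sqrt C * ((real \<beta> + 1) * real m) powr e / real b ^ (\<alpha> * m)"
      proof -
        have "real (n + 1) \<le> (real \<beta> + 1) * real m" using m1 by (simp add: n_def m_def distrib_right mult_ac flip: of_nat_mult)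
        then show ?thesis using C N e0
          by (intro divide_right_mono mult_left_mono powr_mono2) auto
      qed
      finally have 1: "\<bar>?net - ?grid\<bar> \<le> sqrt C * ((real \<beta> + 1) * real m) powr e / real b ^ (\<alpha> * m)" .
      have "\<bar>?grid - ?int\<bar> \<le> sqrt ((2 * L) * real s / real b ^ n)"
        using L(1) hoelder by (intro grid_error[OF b2]) auto
      \<comment> \<open>From \<beta> \<ge> 2\<alpha> it follows that b^n \<ge> b^(2\<alpha> m), so
        the root is of order N^(-\<alpha>).\<close>
      also have "\<dots> \<le> sqrt ((2 * L) * real s / (real b ^ (\<alpha> * m))\<^sup>2)"
      proof -
        have "2 * \<alpha> * (g * w) \<le> \<beta> * (g * w)" using assms(3) by (rule mult_le_mono1)
        then have "real b ^ (2 * \<alpha> * m) \<le> real b ^ n"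
          using b0 by (intro power_increasing) (auto simp: n_def m_def mult.assoc)
        then have "(real b ^ (\<alpha> * m))\<^sup>2 \<le> real b ^ n" by (simp add: mult_ac flip: power_mult)
        then show ?thesis using L(1) N
          by (intro real_sqrt_le_mono divide_left_mono) (auto simp: b0)
      qed
      also have "\<dots> = sqrt (2 * L * real s) * 1 / real b ^ (\<alpha> * m)"
        using N by (simp add: real_sqrt_divide)
      \<comment> \<open>A factor at least 1 is inserted so that the grid error has the same form as
        the net error.\<close>
      also have "\<dots> \<le> sqrt (2 * L * real s) * ((real \<beta> + 1) * real m) powr e / real b ^ (\<alpha> * m)"
      proof -
        have "1 * 1 \<le> (real \<beta> + 1) * real m" using m1 by (intro mult_mono) auto
        then have "1 \<le> ((real \<beta> + 1) * real m) powr e" using e0 by (intro ge_one_powr_ge_zero) auto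
        then show ?thesis using L(1) N by (intro divide_right_mono mult_left_mono) auto
      qed
      finally have 2: "\<bar>?grid - ?int\<bar> \<le> sqrt (2 * L * real s) * ((real \<beta> + 1) * real m) powr e / real b ^ (\<alpha> * m)" .
      have lnN: "ln (real (b ^ m)) = real m * ln (real b)" using b0 by (simp add: ln_realpow)
      have pw: "((real \<beta> + 1) * real m) powr e = ((real \<beta> + 1) / ln (real b)) powr e * ln (real (b ^ m)) powr e"
      proof -
        have "(real \<beta> + 1) * real m = (real \<beta> + 1) / ln (real b) * ln (real (b ^ m))"
          unfolding lnN using lnb by simp
        then show ?thesis by (simp only: powr_mult)
      qed
      have "\<bar>?net - ?int\<bar> \<le> (sqrt C + sqrt (2 * L * real s)) * ((real \<beta> + 1) * real m) powr e / real b ^ (\<alpha> * m)"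
        using 1 2 by (simp add: distrib_right add_divide_distrib)
      also have "\<dots> \<le> C' * ln (real (b ^ m)) powr e / real b ^ (\<alpha> * m)"
        unfolding pw C'_def using N by (intro divide_right_mono) (auto simp: distrib_right mult.assoc)
      also have "real b ^ (\<alpha> * m) = real (b ^ m) ^ \<alpha>" by (simp add: mult.commute flip: power_mult)
      finally show ?thesis unfolding sum_P size .
    qed
    then have "worst_case_error s V (ip_norm ip) P \<le> ereal ?R"
      unfolding worst_case_error_def by (intro SUP_least) auto
    then show ?thesis using size unfolding P_def m_def e_def by simp
  qed
  then show ?thesis using C'0 unfolding Let_def by (intro exI[of _ C'] conjI allI impI) auto
qed

end
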